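(* Let $\alpha>0$ and let $h$ be as in the context. The following are equivalent: (i) there exists a function $u_*\in D(m)$ such that, with $\gamma(t)=(1+t)^{1/\alpha}$ and $c_*(t,x)=\gamma(t)^2u_*(\gamma(t)x)$, we have $c_*(t,\cdot)\in D(m)$ for all $t\ge0$, $c_*$ is a solution of the fragmentation equation with initial condition $u_*$ (i.e. $c_*$ is a self-similar solution), and every solution $c$ of the fragmentation equation with initial condition $c_0\in D(m)$ satisfies $$\lim_{t\to\infty}\int_0^\infty |c(t,x)-c_*(t,x)|\,x\,dx=0;$$ (ii) $\displaystyle\int_0^1 \log z\, h(z)\,z\,dz>-\infty.$
   Context: Fix $\alpha>0$ and a Borel function $h\colon(0,1)\to[0,\infty)$ with $\int_0^1 h(r)\,r\,dr=1$. Let $m(dx)=x\,dx$ on $(0,\infty)$, $L^1=L^1((0,\infty),m)$ with norm $\|f\|=\int_0^\infty|f(x)|x\,dx$, and $D(m)=\{f\in L^1: f\ge0,\ \|f\|=1\}$. The fragmentation equation is $$\partial_t c(t,x)=\int_x^\infty \frac1y h\Big(\frac xy\Big) y^\alpha c(t,y)\,dy-x^\alpha c(t,x),\quad t,x>0,\qquad c(0,x)=c_0(x).$$ For $c_0\in D(m)$, "the solution" $c$ means the mass-conserving solution with $c(t,\cdot)\in D(m)$ given by the stochastic semigroup on $L^1$; equivalently, $c(t,\cdot)$ is the density with respect to $m$ of $Y(t)$, where $\{Y(t)\}$ is the pure jump Markov process on $(0,\infty)$ which, in state $x$, waits an exponential time with mean $x^{-\alpha}$ and then jumps to $\theta x$,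 with $\theta\in(0,1)$ independent having distribution $P(\theta\le r)=\int_0^r h(z)z\,dz$, and $Y(0)$ has density $c_0$ with respect to $m$. *)

theory Defs
  imports "HOL-Probability.Probability"
begin

definition mm :: "real measure" where
  "mm = density lborel (\<lambda>x. ennreal x * indicator {0<..} x)"

definition Dm :: "(real \<Rightarrow> real) set" where
  "Dm = {f. f \<in> borel_measurable borel \<and> integrable mm f \<and>
            (AE x in mm. 0 \<le> f x) \<and> (\<integral>x. \<bar>f x\<bar> \<partial>mm) = 1}"

definition theta_law :: "(real \<Rightarrow> real) \<Rightarrow> real measure" where
  "theta_law h = density lborel (\<lambda>z. ennreal (h z * z) * indicator {0<..<1} z)"

definition hold_law :: "real measure" where
  "hold_law = density lborel (exponential_density 1)"

text \<open>Underlying probability space: initial state Y(0) with density c0 w.r.t. m,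
  and an i.i.d. sequence of pairs (theta_n, E_n), theta_n ~ theta_law, E_n ~ Exp(1).\<close>
definition jump_space :: "(real \<Rightarrow> real) \<Rightarrow> (real \<Rightarrow> real) \<Rightarrow> (real \<times> (nat \<Rightarrow> real \<times> real)) measure" where
  "jump_space h c0 = density mm (\<lambda>x. ennreal (c0 x)) \<Otimes>\<^sub>M (\<Pi>\<^sub>M n\<in>UNIV. theta_law h \<Otimes>\<^sub>M hold_law)"

definition jchain :: "real \<times> (nat \<Rightarrow> real \<times> real) \<Rightarrow> nat \<Rightarrow> real" where
  "jchain \<omega> n = fst \<omega> * (\<Prod>i<n. fst (snd \<omega> i))"

text \<open>Holding time in state X_n: exponential with mean X_n^(-alpha), realised as E_n / X_n^alpha.\<close>
definition htime :: "real \<Rightarrow> real \<times> (nat \<Rightarrow> real \<times> real) \<Rightarrow> nat \<Rightarrow> real" where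
  "htime \<alpha> \<omega> n = snd (snd \<omega> n) / (jchain \<omega> n) powr \<alpha>"

definition jtime :: "real \<Rightarrow> real \<times> (nat \<Rightarrow> real \<times> real) \<Rightarrow> nat \<Rightarrow> real" where
  "jtime \<alpha> \<omega> n = (\<Sum>i<n. htime \<alpha> \<omega> i)"

text \<open>The pure jump process Y(t) = X_n for S_n \<le> t < S_(n+1) (defined 0 on the null event of explosion).\<close>
definition Yproc :: "real \<Rightarrow> real \<times> (nat \<Rightarrow> real \<times> real) \<Rightarrow> real \<Rightarrow> real" where
  "Yproc \<alpha> \<omega> t = (if \<exists>n. t < jtime \<alpha> \<omega> (Suc n)
                    then jchain \<omega> (LEAST n. t < jtime \<alpha> \<omega> (Suc n)) else 0)"

text \<open>c is the (mass-conserving) solution of the fragmentation equation with initial datum c0: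
  for every t \<ge> 0, c(t,.) \<in> D(m) and c(t,.) is the density w.r.t. m of the law of Y(t).\<close>
definition frag_solution :: "real \<Rightarrow> (real \<Rightarrow> real) \<Rightarrow> (real \<Rightarrow> real) \<Rightarrow> (real \<Rightarrow> real \<Rightarrow> real) \<Rightarrow> bool" where
  "frag_solution \<alpha> h c0 c \<longleftrightarrow>
     (\<forall>t\<ge>0. c t \<in> Dm \<and>
        distr (jump_space h c0) borel (\<lambda>\<omega>. Yproc \<alpha> \<omega> t) = density mm (\<lambda>x. ennreal (c t x)))"

end

theory Submission
  imports Defs
begin

text \<open>
  Let \<open>I = E + \<theta>\<^sup>\<alpha> I'\<close> (in law) be the perpetuity built from an exponential variable \<open>E\<close> and the fragmentation ratio
  \<open>\<theta>\<close>, and \<open>\<phi>\<close> its density. The only candidate for the profile is \<open>u(x) = const \<cdot> \<phi>(x\<^sup>\<alpha>) / x\<^sup>2\<close>. Its total mass is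
  finite because \<open>E[1/I] = E[ln I - ln (\<theta>\<^sup>\<alpha> I')] \<le> \<alpha> E[- ln \<theta>]\<close>, where truncated logarithms make up for the possible
  non-integrability of \<open>ln I\<close>. The functions \<open>\<phi>((1 + t) x\<^sup>\<alpha>) / x\<^sup>2\<close> satisfy the Duhamel equation of the process, so they
  dominate its minimal solution, which is the law of \<open>Y(t)\<close>; having the same mass, the two agree.

  For the convergence, rescale so that \<open>u\<close> becomes invariant. Densities bounded by \<open>C u\<close> stay bounded by \<open>C u\<close>, hence
  remain tight, and on compact sets the process has a common minorant since \<open>\<theta>\<close> has a density. Two such densities
  of equal mass at least \<open>\<delta>\<close> therefore overlap after one step by some \<open>\<eta>(\<delta>, C) > 0\<close>; removing the overlap and
  iterating brings the mass below \<open>\<delta>\<close> after finitely many steps. General initial data are approximated by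
  \<open>min(c\<^sub>0, C u)\<close>.

  Conversely, if a self-similar solution \<open>u\<close> exists, then truncated logarithms \<open>g\<close> satisfy
  \<open>E g(Y(0)) - E g(Y(1)) \<le> ln 2 / \<alpha>\<close>, whereas the first jump alone contributes at least
  \<open>E[(1 - exp (- Y(0)\<^sup>\<alpha>)) (g(Y(0)) - g(\<theta> Y(0)))]\<close>; removing the truncation bounds \<open>E[- ln \<theta>]\<close>.
\<close>

text \<open>Formally the profile can be read off as follows. Let J have the law of \<theta>^\<alpha>
  I and let k be its density. As \<open>phi\<close> is the density of E + J, it solves phi' = k -
  phi. At the argument (1 + t) x^\<alpha> and multiplied by x^\<alpha>, the term k becomes the mean
  of (x/\<theta>)^\<alpha> phi((1 + t) (x/\<theta>)^\<alpha>), the gain by fragmentation, and -phi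
  becomes the loss at rate x^\<alpha>. Nothing is differentiated below: a solution is a family of
  laws, so everything is stated for means of nonnegative test functions with values up to
  \<infinity>, and time is made a coordinate of the jump chain, which turns semigroup law, mass
  conservation and Duhamel's formula into renewal equations. The identity for E[1/I] rests on the
  exponential law, whose density equals its tail. The minorization must cope with an h that is
  merely measurable: the set where the density of -ln \<theta> is bounded below may contain no
  interval. Two consecutive jumps repair this once the set fills 95% of some interval, because it
  then meets its own reflections in a set of positive measure.\<close>

locale fragmentation =
  fixes \<alpha> :: real and h :: "real \<Rightarrow> real"
  assumes alpha_pos: "\<alpha> > 0"
    and h_measurable: "set_borel_measurable borel {0<..<1} h"
    and h_nonneg: "\<forall>r\<in>{0<..<1}. 0 \<le> h r"
    and h_mass: "(\<integral>\<^sup>+ r\<in>{0<..<1}. ennreal (h r * r) \<partial>lborel) = 1"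
begin

abbreviation "Th \<equiv> theta_law h"
abbreviation "Ho \<equiv> hold_law"

section \<open>The sample space of independent ratios and holding variables\<close>

definition S :: "(nat \<Rightarrow> real \<times> real) measure" where
  "S = (\<Pi>\<^sub>M n\<in>UNIV. Th \<Otimes>\<^sub>M Ho)"

lemma theta_density_measurable [measurable]:
  "(\<lambda>z. ennreal (h z * z) * indicator {0<..<1} z) \<in> borel_measurable borel"
proof -
  have [measurable]: "(\<lambda>z. indicator {0<..<1} z *\<^sub>R h z) \<in> borel_measurable borel"
    using h_measurable by (simp add: set_borel_measurable_def)
  have "(\<lambda>z. ennreal ((indicator {0<..<1} z *\<^sub>R h z) * z)) \<in> borel_measurable borel"
    by measurable
  also have "(\<lambda>z. ennreal ((indicator {0<..<1} z *\<^sub>R h z) * z)) =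
    (\<lambda>z. ennreal (h z * z) * indicator {0<..<1} z)"
    by (auto simp: fun_eq_iff indicator_def)
  finally show ?thesis .
qed

lemma sets_Th [measurable_cong, simp]: "sets Th = sets borel"
  by (simp add: theta_law_def)

lemma space_Th [simp]: "space Th = UNIV"
  by (simp add: theta_law_def)

lemma sets_Ho [measurable_cong, simp]: "sets Ho = sets borel"
  by (simp add: hold_law_def)

lemma space_Ho [simp]: "space Ho = UNIV"
  by (simp add: hold_law_def)

lemma nn_integral_Th:
  assumes [measurable]: "f \<in> borel_measurable borel"
  shows "(\<integral>\<^sup>+z. f z \<partial>Th) = (\<integral>\<^sup>+z. ennreal (h z * z) * indicator {0<..<1} z * f z \<partial>lborel)"
  unfolding theta_law_def by (subst nn_integral_density) auto

lemma nn_integral_Ho: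
  assumes [measurable]: "f \<in> borel_measurable borel"
  shows "(\<integral>\<^sup>+e. f e \<partial>Ho) = (\<integral>\<^sup>+e. ennreal (exp (- e)) * indicator {0<..} e * f e \<partial>lborel)"
proof -
  have "(\<integral>\<^sup>+e. f e \<partial>Ho) = (\<integral>\<^sup>+e. ennreal (exponential_density 1 e) * f e \<partial>lborel)"
    unfolding hold_law_def by (rule nn_integral_density) simp_all
  also have "\<dots> = (\<integral>\<^sup>+e. ennreal (exp (- e)) * indicator {0<..} e * f e \<partial>lborel)"
  proof (rule nn_integral_cong_AE)
    show "AE e in lborel. ennreal (exponential_density 1 e) * f e = ennreal (exp (- e)) * indicator {0<..} e * f e"
      using AE_lborel_singleton[of 0]
      by eventually_elim (simp add: exponential_density_def indicator_def)
  qed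
  finally show ?thesis .
qed

sublocale Th: prob_space Th
proof
  have "emeasure Th (space Th) = (\<integral>\<^sup>+z. 1 \<partial>Th)" by simp
  also have "\<dots> = 1" using h_mass by (subst nn_integral_Th) (auto)
  finally show "emeasure Th (space Th) = 1" .
qed

sublocale Ho: prob_space Ho
  unfolding hold_law_def by (rule prob_space_exponential_density) simp

sublocale TH: pair_prob_space Th Ho ..

lemma sequence_space_TH: "sequence_space (Th \<Otimes>\<^sub>M Ho)" ..

sublocale S: prob_space S
  unfolding S_def by (intro prob_space_PiM) unfold_locales

lemma AE_Th: "AE z in Th. 0 < z \<and> z < 1"
proof -
  have "(\<lambda>z. ennreal (h z * z) * indicator {0<..<1} z) \<in> borel_measurable lborel" by simp
  from AE_density[OF this] show ?thesis
    unfolding theta_law_def by (auto simp: indicator_def split: if_splits intro!: AE_I2)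
qed

lemma AE_Ho: "AE e in Ho. 0 < e"
proof -
  have "(\<integral>\<^sup>+e. indicator {..0} e \<partial>Ho) = 0"
    by (subst nn_integral_Ho) (auto simp: nn_integral_0_iff_AE indicator_def)
  then have "AE e in Ho. e \<notin> {..0}"
    by (subst (asm) nn_integral_0_iff_AE) (auto simp: indicator_def split: if_splits)
  then show ?thesis by eventually_elim auto
qed

lemma measurable_coord [measurable]:
  "(\<lambda>\<omega>. fst (\<omega> i)) \<in> borel_measurable S" "(\<lambda>\<omega>. snd (\<omega> i)) \<in> borel_measurable S"
proof -
  have *: "(\<lambda>\<omega>. \<omega> i) \<in> S \<rightarrow>\<^sub>M Th \<Otimes>\<^sub>M Ho"
    unfolding S_def by (rule measurable_component_singleton) simp
  show "(\<lambda>\<omega>. fst (\<omega> i)) \<in> borel_measurable S"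
    using measurable_compose[OF * measurable_fst] by (simp cong: measurable_cong_sets)
  show "(\<lambda>\<omega>. snd (\<omega> i)) \<in> borel_measurable S"
    using measurable_compose[OF * measurable_snd] by (simp cong: measurable_cong_sets)
qed

lemma sets_TH: "sets (Th \<Otimes>\<^sub>M Ho) = sets (borel \<Otimes>\<^sub>M borel)"
  by (intro sets_pair_measure_cong) auto

lemma measurable_cons [measurable (raw)]:
  assumes "f \<in> M \<rightarrow>\<^sub>M borel \<Otimes>\<^sub>M borel" "g \<in> M \<rightarrow>\<^sub>M S"
  shows "(\<lambda>x. case_nat (f x) (g x)) \<in> M \<rightarrow>\<^sub>M S"
proof -
  have "f \<in> M \<rightarrow>\<^sub>M Th \<Otimes>\<^sub>M Ho"
    using assms(1) by (simp add: sets_TH cong: measurable_cong_sets)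
  then show ?thesis
    using assms(2) unfolding S_def by (intro measurable_case_nat') auto
qed

text \<open>Splitting off the first pair leaves a sequence with the same law. The first-jump
  decompositions of the process and the recursion of the perpetuity are instances of this.\<close>

lemma nn_integral_shift:
  assumes [measurable]: "F \<in> borel_measurable S"
  shows "(\<integral>\<^sup>+\<omega>. F \<omega> \<partial>S) = (\<integral>\<^sup>+z. \<integral>\<^sup>+e. \<integral>\<^sup>+\<omega>. F (case_nat (z, e) \<omega>) \<partial>S \<partial>Ho \<partial>Th)"
proof -
  note sets_TH[measurable_cong]
  have m: "(\<lambda>p. case_nat (fst p) (snd p)) \<in> (Th \<Otimes>\<^sub>M Ho) \<Otimes>\<^sub>M S \<rightarrow>\<^sub>M S"
    by (rule measurable_cons) measurable
  have Fm: "(\<lambda>p. F (case_nat (fst p) (snd p))) \<in> borel_measurable ((Th \<Otimes>\<^sub>M Ho) \<Otimes>\<^sub>M S)"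
    using measurable_compose[OF m assms] .
  have "(\<integral>\<^sup>+\<omega>. F \<omega> \<partial>S) = (\<integral>\<^sup>+\<omega>. F \<omega> \<partial>distr ((Th \<Otimes>\<^sub>M Ho) \<Otimes>\<^sub>M S) S (\<lambda>p. case_nat (fst p) (snd p)))"
    using sequence_space.PiM_iter[OF sequence_space_TH] by (simp add: S_def split_beta')
  also have "\<dots> = (\<integral>\<^sup>+p. F (case_nat (fst p) (snd p)) \<partial>((Th \<Otimes>\<^sub>M Ho) \<Otimes>\<^sub>M S))"
    by (subst nn_integral_distr[OF m]) (simp_all add: assms)
  also have "\<dots> = (\<integral>\<^sup>+s. \<integral>\<^sup>+\<omega>. F (case_nat s \<omega>) \<partial>S \<partial>(Th \<Otimes>\<^sub>M Ho))"
    using S.nn_integral_fst[OF Fm] by simp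
  also have "\<dots> = (\<integral>\<^sup>+z. \<integral>\<^sup>+e. \<integral>\<^sup>+\<omega>. F (case_nat (z, e) \<omega>) \<partial>S \<partial>Ho \<partial>Th)"
    using Ho.nn_integral_fst[OF S.borel_measurable_nn_integral_fst[OF Fm]] by simp
  finally show ?thesis .
qed

lemma AE_S: "AE \<omega> in S. \<forall>i. 0 < fst (\<omega> i) \<and> fst (\<omega> i) < 1 \<and> 0 < snd (\<omega> i)"
proof -
  have "AE p in Th \<Otimes>\<^sub>M Ho. 0 < fst p \<and> fst p < 1 \<and> 0 < snd p"
  proof (rule TH.AE_pair_measure)
    show "{x \<in> space (Th \<Otimes>\<^sub>M Ho). 0 < fst x \<and> fst x < 1 \<and> 0 < snd x} \<in> sets (Th \<Otimes>\<^sub>M Ho)"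
    proof -
      have "{x \<in> space (borel \<Otimes>\<^sub>M borel). 0 < fst x \<and> fst x < (1::real) \<and> 0 < (snd x :: real)} \<in> sets (borel \<Otimes>\<^sub>M borel)"
        by measurable
      then show ?thesis by (simp add: sets_TH space_pair_measure)
    qed
    show "AE x in Th. AE y in Ho. 0 < fst (x, y) \<and> fst (x, y) < 1 \<and> 0 < snd (x, y)"
      using AE_Th
    proof eventually_elim
      case (elim z) then show ?case using AE_Ho by (auto elim: eventually_mono)
    qed
  qed
  then have "AE \<omega> in S. 0 < fst (\<omega> i) \<and> fst (\<omega> i) < 1 \<and> 0 < snd (\<omega> i)" for i
    unfolding S_def by (intro AE_PiM_component) (auto intro: TH.prob_space_axioms)
  then show ?thesis unfolding AE_all_countable by blast
qed

subsection \<open>The process\<close>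

lemma jchain_0 [simp]: "jchain w 0 = fst w"
  by (simp add: jchain_def)

lemma jtime_0 [simp]: "jtime \<alpha> w 0 = 0"
  by (simp add: jtime_def)

lemma jchain_shift: "jchain (x, case_nat (z, e) \<omega>) (Suc n) = jchain (z * x, \<omega>) n"
  by (simp add: jchain_def prod.lessThan_Suc_shift mult_ac del: prod.lessThan_Suc)

lemma jtime_shift:
  "jtime \<alpha> (x, case_nat (z, e) \<omega>) (Suc n) = e / x powr \<alpha> + jtime \<alpha> (z * x, \<omega>) n"
proof -
  have "htime \<alpha> (x, case_nat (z, e) \<omega>) (Suc i) = htime \<alpha> (z * x, \<omega>) i" for i
    by (simp add: htime_def jchain_shift)
  moreover have "htime \<alpha> (x, case_nat (z, e) \<omega>) 0 = e / x powr \<alpha>"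
    by (simp add: htime_def)
  ultimately show ?thesis
    by (simp add: jtime_def sum.lessThan_Suc_shift del: sum.lessThan_Suc)
qed

lemma measurable_jchain [measurable]:
  "(\<lambda>w. jchain w n) \<in> borel_measurable (borel \<Otimes>\<^sub>M S)"
  unfolding jchain_def by measurable

lemma measurable_jtime [measurable]:
  "(\<lambda>w. jtime \<alpha> w n) \<in> borel_measurable (borel \<Otimes>\<^sub>M S)"
  unfolding jtime_def htime_def by measurable

lemma measurable_Yproc [measurable]:
  "(\<lambda>w. Yproc \<alpha> w t) \<in> borel_measurable (borel \<Otimes>\<^sub>M S)"
proof -
  have [measurable]: "(\<lambda>w. jchain w (LEAST n. t < jtime \<alpha> w (Suc n))) \<in> borel_measurable (borel \<Otimes>\<^sub>M S)"
    by (rule measurable_compose_countable[where g="\<lambda>w. LEAST n. t < jtime \<alpha> w (Suc n)"]) measurable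
  show ?thesis unfolding Yproc_def by measurable
qed

lemma measurable_path [measurable]:
  "(\<lambda>\<omega>. jchain (x, \<omega>) n) \<in> borel_measurable S"
  "(\<lambda>\<omega>. jtime \<alpha> (x, \<omega>) n) \<in> borel_measurable S"
  "(\<lambda>\<omega>. Yproc \<alpha> (x, \<omega>) t) \<in> borel_measurable S"
  by measurable

text \<open>The semigroup in its dual form, acting on test functions; densities enter only when
  \<open>K\<close> is integrated against an initial density. Exploded paths contribute
  \<open>f 0\<close>, by the default value in \<open>Yproc\<close>.\<close>

definition K :: "real \<Rightarrow> (real \<Rightarrow> ennreal) \<Rightarrow> real \<Rightarrow> ennreal" where
  "K t f x = (\<integral>\<^sup>+\<omega>. f (Yproc \<alpha> (x, \<omega>) t) \<partial>S)"

lemma measurable_K [measurable]: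
  assumes [measurable]: "f \<in> borel_measurable borel"
  shows "K t f \<in> borel_measurable borel"
proof -
  have "(\<lambda>w. f (Yproc \<alpha> w t)) \<in> borel_measurable (borel \<Otimes>\<^sub>M S)" by measurable
  then have "(\<lambda>x. \<integral>\<^sup>+\<omega>. f (Yproc \<alpha> (x, \<omega>) t) \<partial>S) \<in> borel_measurable borel"
    by (rule S.borel_measurable_nn_integral_fst)
  then show ?thesis unfolding K_def[abs_def] .
qed

text \<open>\<open>A\<close> is the transition operator of the Markov chain of pairs (jump time, post-jump state), and \<open>Hf t f\<close> the
  expected value of \<open>f (Y t)\<close> on the event that the last jump before time \<open>t\<close> occurred at time \<open>s\<close> and led to \<open>y\<close>.\<close>
definition A :: "(real \<Rightarrow> real \<Rightarrow> ennreal) \<Rightarrow> real \<Rightarrow> real \<Rightarrow> ennreal" where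
  "A H s y = (\<integral>\<^sup>+z. \<integral>\<^sup>+e. H (s + e / y powr \<alpha>) (z * y) \<partial>Ho \<partial>Th)"

definition Hf :: "real \<Rightarrow> (real \<Rightarrow> ennreal) \<Rightarrow> real \<Rightarrow> real \<Rightarrow> ennreal" where
  "Hf t f s y = indicator {..t} s * ennreal (exp (- ((t - s) * y powr \<alpha>))) * f y"

abbreviation "m2 H \<equiv> case_prod H \<in> borel_measurable (borel \<Otimes>\<^sub>M borel)"

lemma m2D [measurable_dest]:
  assumes "m2 H" "f \<in> borel_measurable M" "g \<in> borel_measurable M"
  shows "(\<lambda>x. H (f x) (g x)) \<in> borel_measurable M"
  using measurable_compose[OF measurable_Pair[OF assms(2,3)] assms(1)] by simp

lemma m2_A: assumes "m2 H" shows "m2 (A H)"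
proof -
  note [measurable] = m2D[OF assms]
  show ?thesis unfolding A_def split_beta by measurable
qed

lemma m2_A_pow: "m2 H \<Longrightarrow> m2 ((A ^^ n) H)"
  by (induction n) (auto intro: m2_A)

lemma m2_Hf: assumes [measurable]: "f \<in> borel_measurable borel" shows "m2 (Hf t f)"
  unfolding Hf_def split_beta by measurable

lemma AE_Th_pos: "(\<And>z. 0 < z \<Longrightarrow> z < 1 \<Longrightarrow> P z) \<Longrightarrow> AE z in Th. P z"
  using AE_Th by (auto elim: eventually_mono)

text \<open>Ratios lie in (0, 1) almost surely, so the chain started in (0, b] never leaves it, and
  \<open>H\<close> and \<open>H'\<close> have to be compared only there. This later yields a
  contraction factor that depends on \<open>b\<close> alone.\<close>

lemma A_mono:
  assumes "\<And>s z. 0 < z \<Longrightarrow> z \<le> b \<Longrightarrow> H s z \<le> H' s z" "0 < y" "y \<le> b"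
  shows "A H s y \<le> A H' s y"
  unfolding A_def
proof (intro nn_integral_mono_AE AE_Th_pos AE_I2)
  fix z e :: real assume z: "0 < z" "z < 1"
  then have "z * y \<le> b" using assms(2,3) by (meson dual_order.trans less_imp_le mult_left_le_one_le)
  then show "H (s + e / y powr \<alpha>) (z * y) \<le> H' (s + e / y powr \<alpha>) (z * y)"
    using z assms by (auto)
qed

lemma A_pow_mono:
  assumes "\<And>s z. 0 < z \<Longrightarrow> z \<le> b \<Longrightarrow> H s z \<le> H' s z" "0 < y" "y \<le> b"
  shows "(A ^^ n) H s y \<le> (A ^^ n) H' s y"
  using assms(2,3) by (induction n arbitrary: s y) (auto intro: assms(1) A_mono)

lemma A_pow_cong:
  assumes "\<And>s z. 0 < z \<Longrightarrow> H s z = H' s z" "0 < y"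
  shows "(A ^^ n) H s y = (A ^^ n) H' s y"
  by (rule antisym) (auto intro!: A_pow_mono[where b=y] simp: assms)

lemma A_add:
  assumes "m2 H" "m2 H'" shows "A (\<lambda>s y. H s y + H' s y) s y = A H s y + A H' s y"
proof -
  note [measurable] = m2D[OF assms(1)] m2D[OF assms(2)]
  show ?thesis unfolding A_def by (simp add: nn_integral_add)
qed

lemma A_suminf:
  assumes "\<And>n. m2 (H n)" shows "A (\<lambda>s y. \<Sum>n. H n s y) s y = (\<Sum>n. A (H n) s y)"
proof -
  note [measurable] = m2D[OF assms]
  show ?thesis unfolding A_def by (simp add: nn_integral_suminf)
qed

text \<open>Substituting the absolute time r = s + e / y^\<alpha> of the next jump for the
  normalised holding variable. In this form the starting time \<open>s\<close> enters only through
  the range of \<open>r\<close> and an exponential factor, so times can be cut and shifted.\<close>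

lemma A_alt:
  assumes "m2 H" "0 < y"
  shows "A H s y = (\<integral>\<^sup>+r. indicator {s<..} r * ennreal (y powr \<alpha> * exp (- ((r - s) * y powr \<alpha>))) *
    (\<integral>\<^sup>+z. H r (z * y) \<partial>Th) \<partial>lborel)"
proof -
  note [measurable] = m2D[OF assms(1)]
  define l where "l = y powr \<alpha>"
  have l: "l > 0" using assms by (simp add: l_def)
  have "A H s y = (\<integral>\<^sup>+e. \<integral>\<^sup>+z. H (s + e / l) (z * y) \<partial>Th \<partial>Ho)"
    unfolding A_def l_def by (intro TH.Fubini'[symmetric]) measurable
  also have "\<dots> = (\<integral>\<^sup>+e. ennreal (exp (- e)) * indicator {0<..} e * (\<integral>\<^sup>+z. H (s + e / l) (z * y) \<partial>Th) \<partial>lborel)"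
    by (subst nn_integral_Ho) auto
  also have "\<dots> = ennreal \<bar>l\<bar> * (\<integral>\<^sup>+r. ennreal (exp (- (- s * l + l * r))) * indicator {0<..} (- s * l + l * r) *
      (\<integral>\<^sup>+z. H (s + (- s * l + l * r) / l) (z * y) \<partial>Th) \<partial>lborel)"
    using l by (intro nn_integral_real_affine) auto
  also have "\<dots> = (\<integral>\<^sup>+r. ennreal l * (ennreal (exp (- (- s * l + l * r))) * indicator {0<..} (- s * l + l * r) *
      (\<integral>\<^sup>+z. H (s + (- s * l + l * r) / l) (z * y) \<partial>Th)) \<partial>lborel)"
    using l by (subst nn_integral_cmult) auto
  also have "\<dots> = (\<integral>\<^sup>+r. indicator {s<..} r * ennreal (l * exp (- ((r - s) * l))) *
    (\<integral>\<^sup>+z. H r (z * y) \<partial>Th) \<partial>lborel)"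
  proof (intro nn_integral_cong)
    fix r
    have "s + (- s * l + l * r) / l = r" using l by (simp add: field_simps)
    moreover have "- s * l + l * r > 0 \<longleftrightarrow> s < r" using l by (simp add: mult.commute)
    moreover have "- (- s * l + l * r) = - ((r - s) * l)" by (simp add: algebra_simps)
    ultimately show "ennreal l * (ennreal (exp (- (- s * l + l * r))) * indicator {0<..} (- s * l + l * r) *
      (\<integral>\<^sup>+z. H (s + (- s * l + l * r) / l) (z * y) \<partial>Th)) = indicator {s<..} r * ennreal (l * exp (- ((r - s) * l))) *
    (\<integral>\<^sup>+z. H r (z * y) \<partial>Th)"
      using l by (auto simp: indicator_def ennreal_mult mult_ac)
  qed
  finally show ?thesis unfolding l_def .
qed

end

lemma nn_integral_exp_tail:
  fixes a c :: real assumes "c > 0"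
  shows "(\<integral>\<^sup>+r. indicator {a<..} r * ennreal (exp (- c * r)) \<partial>lborel) = ennreal (exp (- c * a) / c)"
proof -
  have "(\<integral>\<^sup>+r. indicator {a<..} r * ennreal (exp (- c * r)) \<partial>lborel) =
      (\<integral>\<^sup>+r. ennreal (exp (- c * r)) * indicator {a..} r \<partial>lborel)"
  proof (rule nn_integral_cong_AE)
    show "AE r in lborel. indicator {a<..} r * ennreal (exp (- c * r)) = ennreal (exp (- c * r)) * indicator {a..} r"
      using AE_lborel_singleton[of a] by eventually_elim (auto simp: indicator_def)
  qed
  also have "\<dots> = ennreal (0 - (- exp (- c * a) / c))"
  proof (rule nn_integral_FTC_atLeast)
    show "DERIV (\<lambda>r. - exp (- c * r) / c) x :> exp (- c * x)" for x
      using assms by (auto intro!: derivative_eq_intros simp: field_simps)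
    have "((\<lambda>r. exp (- (c * r))) \<longlongrightarrow> 0) at_top"
      using assms
      by (intro filterlim_compose[OF exp_at_bot])
         (auto simp: filterlim_uminus_at_bot intro!: filterlim_tendsto_pos_mult_at_top[OF tendsto_const] filterlim_ident)
    from tendsto_divide[OF tendsto_minus[OF this] tendsto_const[of c]]
    show "((\<lambda>r. - exp (- c * r) / c) \<longlongrightarrow> 0) at_top" using assms by simp
  qed auto
  finally show ?thesis by simp
qed

context fragmentation
begin

lemma Ho_tail: assumes "0 \<le> a" shows "emeasure Ho {a<..} = ennreal (exp (- a))"
proof -
  have "emeasure Ho {a<..} = (\<integral>\<^sup>+e. indicator {a<..} e \<partial>Ho)" by simp
  also have "\<dots> = (\<integral>\<^sup>+e. ennreal (exp (- e)) * indicator {0<..} e * indicator {a<..} e \<partial>lborel)"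
    by (rule nn_integral_Ho) simp
  also have "\<dots> = (\<integral>\<^sup>+r. indicator {a<..} r * ennreal (exp (- 1 * r)) \<partial>lborel)"
    using assms by (intro nn_integral_cong) (auto simp: indicator_def)
  also have "\<dots> = ennreal (exp (- a))" by (subst nn_integral_exp_tail) auto
  finally show ?thesis .
qed

text \<open>Induction on \<open>n\<close>, splitting off the first pair. The clock offset
  \<open>s\<close> is general because the path after a jump starts at a later time. For n = 0 the
  exponential in \<open>Hf\<close> is the probability that the state survives until
  \<open>t\<close>.\<close>

lemma A_pow_Hf:
  assumes [measurable]: "f \<in> borel_measurable borel" and "0 < x"
  shows "(\<integral>\<^sup>+\<omega>. (if s + jtime \<alpha> (x, \<omega>) n \<le> t \<and> t < s + jtime \<alpha> (x, \<omega>) (Suc n) then f (jchain (x, \<omega>) n) else 0) \<partial>S) =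
    (A ^^ n) (Hf t f) s x"
  using \<open>0 < x\<close>
proof (induction n arbitrary: s x)
  case 0
  have "(\<integral>\<^sup>+\<omega>. (if s + jtime \<alpha> (x, \<omega>) 0 \<le> t \<and> t < s + jtime \<alpha> (x, \<omega>) (Suc 0) then f (jchain (x, \<omega>) 0) else 0) \<partial>S)
     = (\<integral>\<^sup>+z. \<integral>\<^sup>+e. \<integral>\<^sup>+\<omega>. (if s \<le> t \<and> t < s + e / x powr \<alpha> then f x else 0) \<partial>S \<partial>Ho \<partial>Th)"
    by (subst nn_integral_shift) (auto simp: jtime_shift cong: if_cong)
  also have "\<dots> = (\<integral>\<^sup>+e. (if s \<le> t \<and> t < s + e / x powr \<alpha> then f x else 0) \<partial>Ho)"
    by (simp add: Th.emeasure_space_1[simplified] S.emeasure_space_1)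
  also have "\<dots> = (\<integral>\<^sup>+e. (indicator {..t} s * f x) * indicator {(t - s) * x powr \<alpha> <..} e \<partial>Ho)"
    using 0 by (intro nn_integral_cong) (auto simp: indicator_def field_simps)
  also have "\<dots> = (indicator {..t} s * f x) * emeasure Ho {(t - s) * x powr \<alpha> <..}"
    by (subst nn_integral_cmult_indicator) auto
  also have "\<dots> = Hf t f s x"
  proof (cases "s \<le> t")
    case True
    then have "emeasure Ho {(t - s) * x powr \<alpha> <..} = ennreal (exp (- ((t - s) * x powr \<alpha>)))"
      by (intro Ho_tail) auto
    then show ?thesis by (simp add: Hf_def mult_ac)
  qed (simp add: Hf_def)
  finally show ?case by simp
next
  case (Suc n)
  let ?F = "\<lambda>n s x \<omega>. (if s + jtime \<alpha> (x, \<omega>) n \<le> t \<and> t < s + jtime \<alpha> (x, \<omega>) (Suc n) then f (jchain (x, \<omega>) n) else 0)"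
  have "(\<integral>\<^sup>+\<omega>. ?F (Suc n) s x \<omega> \<partial>S) =
    (\<integral>\<^sup>+z. \<integral>\<^sup>+e. \<integral>\<^sup>+\<omega>. ?F (Suc n) s x (case_nat (z, e) \<omega>) \<partial>S \<partial>Ho \<partial>Th)"
    by (rule nn_integral_shift) measurable
  also have "\<dots> = (\<integral>\<^sup>+z. \<integral>\<^sup>+e. \<integral>\<^sup>+\<omega>. ?F n (s + e / x powr \<alpha>) (z * x) \<omega> \<partial>S \<partial>Ho \<partial>Th)"
    by (simp only: jtime_shift jchain_shift add.assoc)
  also have "\<dots> = (\<integral>\<^sup>+z. \<integral>\<^sup>+e. (A ^^ n) (Hf t f) (s + e / x powr \<alpha>) (z * x) \<partial>Ho \<partial>Th)"
    by (intro nn_integral_cong_AE AE_Th_pos AE_I2) (use Suc in auto)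
  also have "\<dots> = (A ^^ Suc n) (Hf t f) s x" by (simp add: A_def)
  finally show ?case .
qed

lemma jchain_pos: "0 < x \<Longrightarrow> (\<And>i. 0 < fst (\<omega> i)) \<Longrightarrow> 0 < jchain (x, \<omega>) n"
  by (simp add: jchain_def prod_pos)

lemma jtime_mono:
  assumes "\<And>i. 0 < snd (\<omega> i)" "m \<le> n"
  shows "jtime \<alpha> (x, \<omega>) m \<le> jtime \<alpha> (x, \<omega>) n"
  unfolding jtime_def using assms
  by (intro sum_mono2) (auto simp: htime_def intro!: divide_nonneg_nonneg intro: less_imp_le)

text \<open>The jump times increase, so at most one summand is nonzero, the one with the index
  chosen by \<open>LEAST\<close>. On explosion all summands vanish, and the left side vanishes
  because of \<open>f 0 = 0\<close>.\<close>

lemma Yproc_series: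
  fixes f :: "real \<Rightarrow> ennreal"
  assumes e: "\<And>i. 0 < snd (\<omega> i)" and "0 \<le> t" "f 0 = 0"
  shows "f (Yproc \<alpha> (x, \<omega>) t) =
    (\<Sum>n. if jtime \<alpha> (x, \<omega>) n \<le> t \<and> t < jtime \<alpha> (x, \<omega>) (Suc n) then f (jchain (x, \<omega>) n) else 0)"
proof (cases "\<exists>n. t < jtime \<alpha> (x, \<omega>) (Suc n)")
  case True
  define N where "N = (LEAST n. t < jtime \<alpha> (x, \<omega>) (Suc n))"
  have N: "t < jtime \<alpha> (x, \<omega>) (Suc N)" unfolding N_def using True by (rule LeastI_ex)
  have less: "jtime \<alpha> (x, \<omega>) (Suc n) \<le> t" if "n < N" for n
    using not_less_Least[of n "\<lambda>n. t < jtime \<alpha> (x, \<omega>) (Suc n)"] that by (auto simp: N_def)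
  have N': "jtime \<alpha> (x, \<omega>) N \<le> t"
    using less[of "N - 1"] \<open>0 \<le> t\<close> by (cases N) auto
  have iff: "jtime \<alpha> (x, \<omega>) n \<le> t \<and> t < jtime \<alpha> (x, \<omega>) (Suc n) \<longleftrightarrow> n = N" for n
  proof (cases n N rule: linorder_cases)
    case greater
    then have "jtime \<alpha> (x, \<omega>) (Suc N) \<le> jtime \<alpha> (x, \<omega>) n" by (intro jtime_mono e) auto
    then show ?thesis using N greater by auto
  qed (use N N' less in \<open>force+\<close>)
  have "(\<lambda>n. if n = N then f (jchain (x, \<omega>) n) else 0) sums f (jchain (x, \<omega>) N)"
    by (rule sums_single)
  then show ?thesis unfolding iff using True by (simp add: Yproc_def N_def[symmetric] sums_iff)
next
  case False
  then show ?thesis using assms by (auto simp: Yproc_def)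
qed

lemma K_series_aux:
  assumes [measurable]: "f \<in> borel_measurable borel" and "0 < x" "0 \<le> t" "f 0 = 0"
  shows "K t f x = (\<Sum>n. (A ^^ n) (Hf t f) 0 x)"
proof -
  have "K t f x = (\<integral>\<^sup>+\<omega>. (\<Sum>n. if jtime \<alpha> (x, \<omega>) n \<le> t \<and> t < jtime \<alpha> (x, \<omega>) (Suc n) then f (jchain (x, \<omega>) n) else 0) \<partial>S)"
    unfolding K_def
  proof (rule nn_integral_cong_AE)
    show "AE \<omega> in S. f (Yproc \<alpha> (x, \<omega>) t) =
      (\<Sum>n. if jtime \<alpha> (x, \<omega>) n \<le> t \<and> t < jtime \<alpha> (x, \<omega>) (Suc n) then f (jchain (x, \<omega>) n) else 0)"
      using AE_S by eventually_elim (rule Yproc_series, use assms in auto)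
  qed
  also have "\<dots> = (\<Sum>n. \<integral>\<^sup>+\<omega>. (if jtime \<alpha> (x, \<omega>) n \<le> t \<and> t < jtime \<alpha> (x, \<omega>) (Suc n) then f (jchain (x, \<omega>) n) else 0) \<partial>S)"
    by (rule nn_integral_suminf) measurable
  also have "\<dots> = (\<Sum>n. (A ^^ n) (Hf t f) 0 x)"
    using A_pow_Hf[OF assms(1,2), of 0] by simp
  finally show ?thesis .
qed

section \<open>Absence of explosion\<close>

lemma A_exp:
  assumes "0 < y" and that: "c \<ge> 0"
  shows "A (\<lambda>s y. ennreal (c * exp (- s))) s y = ennreal (exp (- s) * (y powr \<alpha> / (1 + y powr \<alpha>))) * ennreal c"
proof -
  define l where "l = y powr \<alpha>"
  have l: "l > 0" using assms by (simp add: l_def)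
  have "A (\<lambda>s y. ennreal (c * exp (- s))) s y = (\<integral>\<^sup>+e. ennreal (c * exp (- (s + e / l))) \<partial>Ho)"
    by (simp add: A_def l_def Th.emeasure_space_1[simplified])
  also have "\<dots> = (\<integral>\<^sup>+e. ennreal (exp (- e)) * indicator {0<..} e * ennreal (c * exp (- (s + e / l))) \<partial>lborel)"
    by (rule nn_integral_Ho) auto
  also have "\<dots> = (\<integral>\<^sup>+e. ennreal (c * exp (- s)) * (indicator {0<..} e * ennreal (exp (- (1 + 1 / l) * e))) \<partial>lborel)"
  proof (intro nn_integral_cong)
    fix e :: real
    have "exp (- e) * (c * exp (- (s + e / l))) = c * exp (- s) * exp (- (1 + 1 / l) * e)"
      by (simp add: mult_exp_exp algebra_simps diff_divide_distrib flip: exp_diff)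
    then show "ennreal (exp (- e)) * indicator {0<..} e * ennreal (c * exp (- (s + e / l))) =
        ennreal (c * exp (- s)) * (indicator {0<..} e * ennreal (exp (- (1 + 1 / l) * e)))"
      using that by (auto simp: indicator_def simp flip: ennreal_mult)
  qed
  also have "\<dots> = ennreal (c * exp (- s)) * (\<integral>\<^sup>+e. indicator {0<..} e * ennreal (exp (- (1 + 1 / l) * e)) \<partial>lborel)"
    by (rule nn_integral_cmult) auto
  also have "\<dots> = ennreal (c * exp (- s)) * ennreal (exp (- (1 + 1 / l) * 0) / (1 + 1 / l))"
    using l by (subst nn_integral_exp_tail) (auto intro: add_pos_pos)
  also have "\<dots> = ennreal (exp (- s) * (l / (1 + l))) * ennreal c"
  proof -
    have "1 / (1 + 1 / l) = l / (1 + l)" using l by (simp add: field_simps)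
    then show ?thesis using l that by (simp add: mult_ac flip: ennreal_mult)
  qed
  finally show ?thesis unfolding l_def .
qed

text \<open>The factor l / (1 + l) is the Laplace transform at 1 of a holding time of rate l =
  y^\<alpha>. It increases with y, and states stay below \<open>b\<close>. Hence the mean of exp(-
  S_n), with S_n the n-th jump time, decays geometrically.\<close>

lemma A_pow_exp:
  assumes "0 < y" "y \<le> b" "0 \<le> c"
  shows "(A ^^ n) (\<lambda>s y. ennreal (c * exp (- s))) s y \<le> ennreal (c * (b powr \<alpha> / (1 + b powr \<alpha>)) ^ n * exp (- s))"
  using assms(1,2)
proof (induction n arbitrary: s y)
  case 0 then show ?case by simp
next
  case (Suc n)
  let ?\<beta> = "b powr \<alpha> / (1 + b powr \<alpha>)"
  have le: "y powr \<alpha> / (1 + y powr \<alpha>) \<le> ?\<beta>"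
  proof -
    have "y powr \<alpha> \<le> b powr \<alpha>" using Suc alpha_pos by (intro powr_mono2) auto
    moreover have "0 \<le> y powr \<alpha>" "0 \<le> b powr \<alpha>" by auto
    ultimately show ?thesis by (simp add: divide_simps algebra_simps add_pos_nonneg)
  qed
  have "(A ^^ Suc n) (\<lambda>s y. ennreal (c * exp (- s))) s y \<le> A (\<lambda>s y. ennreal (c * ?\<beta> ^ n * exp (- s))) s y"
    using Suc by (auto intro: A_mono[where b=b])
  also have "\<dots> = ennreal (exp (- s) * (y powr \<alpha> / (1 + y powr \<alpha>))) * ennreal (c * ?\<beta> ^ n)"
    using Suc assms(3) by (intro A_exp) (auto intro!: mult_nonneg_nonneg zero_le_power divide_nonneg_nonneg add_nonneg_nonneg)
  also have "\<dots> \<le> ennreal (exp (- s) * ?\<beta>) * ennreal (c * ?\<beta> ^ n)"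
    using le by (intro mult_right_mono ennreal_leI mult_left_mono) auto
  also have "\<dots> = ennreal (c * ?\<beta> ^ Suc n * exp (- s))"
    using assms(3) by (subst ennreal_mult[symmetric]) (auto simp: mult_ac add_nonneg_nonneg)
  finally show ?case .
qed

lemma A_pow_add:
  assumes "m2 H" "m2 H'"
  shows "(A ^^ n) (\<lambda>s y. H s y + H' s y) s y = (A ^^ n) H s y + (A ^^ n) H' s y"
  using A_add[OF m2_A_pow m2_A_pow, OF assms]
proof (induction n arbitrary: s y)
  case (Suc n)
  have "(A ^^ n) (\<lambda>s y. H s y + H' s y) = (\<lambda>s y. (A ^^ n) H s y + (A ^^ n) H' s y)"
    using Suc.IH A_add[OF m2_A_pow m2_A_pow, OF assms] by (intro ext) blast
  then show ?case by (simp add: A_add m2_A_pow assms)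
qed auto

text \<open>A renewal equation \<open>V = g + A V\<close> determines a bounded \<open>V\<close> living on times up to \<open>T\<close>,
  because the chain does not explode.\<close>
lemma A_iterate:
  assumes V: "m2 V" and g: "m2 g"
    and eq: "\<And>s y. 0 < y \<Longrightarrow> V s y = g s y + A V s y"
    and le: "\<And>s y. 0 < y \<Longrightarrow> V s y \<le> indicator {..T} s"
    and x: "0 < x"
  shows "V s x = (\<Sum>n. (A ^^ n) g s x)"
proof -
  have split: "V s x = (\<Sum>n<N. (A ^^ n) g s x) + (A ^^ N) V s x" for N
  proof (induction N)
    case (Suc N)
    have "(A ^^ N) V s x = (A ^^ N) (\<lambda>s y. g s y + A V s y) s x"
      using eq x by (intro A_pow_cong) auto
    also have "\<dots> = (A ^^ N) g s x + (A ^^ N) (A V) s x"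
      by (rule A_pow_add[OF g m2_A[OF V]])
    also have "(A ^^ N) (A V) = (A ^^ Suc N) V" by (simp add: funpow_swap1)
    finally show ?case using Suc.IH by (simp add: add.assoc)
  qed simp
  \<comment> \<open>The remainder after N iterations is compared with exp (T - s), which dominates
    the indicator of s \<le> T and shrinks by the factor \<open>?\<beta>\<close> < 1 under every
    application of \<open>A\<close>.\<close>
  let ?\<beta> = "x powr \<alpha> / (1 + x powr \<alpha>)"
  have "(\<lambda>N. (A ^^ N) V s x) \<longlonglongrightarrow> 0"
  proof (rule tendsto_sandwich[OF _ _ tendsto_const])
    show "\<forall>\<^sub>F N in sequentially. (A ^^ N) V s x \<le> ennreal (exp T * ?\<beta> ^ N * exp (- s))"
    proof (intro always_eventually allI)
      fix N
      have "(A ^^ N) V s x \<le> (A ^^ N) (\<lambda>s y. ennreal (exp T * exp (- s))) s x"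
      proof (intro A_pow_mono[where b=x] x order_refl)
        fix s z :: real assume "0 < z"
        have "V s z \<le> indicator {..T} s" using le \<open>0 < z\<close> by auto
        also have "\<dots> \<le> ennreal (exp T * exp (- s))"
          by (auto simp: indicator_def mult_exp_exp)
        finally show "V s z \<le> ennreal (exp T * exp (- s))" .
      qed
      also have "\<dots> \<le> ennreal (exp T * ?\<beta> ^ N * exp (- s))"
        using x by (intro A_pow_exp) auto
      finally show "(A ^^ N) V s x \<le> ennreal (exp T * ?\<beta> ^ N * exp (- s))" .
    qed
    have "(\<lambda>N. exp T * ?\<beta> ^ N * exp (- s)) \<longlonglongrightarrow> exp T * 0 * exp (- s)"
      using x by (intro tendsto_intros LIMSEQ_realpow_zero) (auto simp: divide_less_eq add_pos_pos)
    from tendsto_ennrealI[OF this]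
    show "(\<lambda>N. ennreal (exp T * ?\<beta> ^ N * exp (- s))) \<longlonglongrightarrow> 0" by simp
  qed auto
  then have "(\<lambda>N. (\<Sum>n<N. (A ^^ n) g s x) + (A ^^ N) V s x) \<longlonglongrightarrow> (\<Sum>n. (A ^^ n) g s x) + 0"
    by (intro tendsto_add summable_LIMSEQ summableI)
  then show ?thesis
    unfolding split[symmetric] by (simp add: LIMSEQ_const_iff)
qed

text \<open>Either no jump happens up to time \<open>t\<close> or the first jump does. Combined with
  \<open>A_iterate\<close> this shows that the expansion by the number of jumps has total mass
  1.\<close>

lemma A_indicator:
  assumes "0 < y"
  shows "indicator {..t} s = Hf t (\<lambda>_. 1) s y + A (\<lambda>s _. indicator {..t} s) s y"
proof -
  define l where "l = y powr \<alpha>"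
  have l: "l > 0" using assms by (simp add: l_def)
  have "A (\<lambda>s _. indicator {..t} s) s y = (\<integral>\<^sup>+e. indicator {..t} (s + e / l) \<partial>Ho)"
    by (simp add: A_def l_def Th.emeasure_space_1[simplified])
  also have "\<dots> = (\<integral>\<^sup>+e. indicator {..(t - s) * l} e \<partial>Ho)"
    using l by (intro nn_integral_cong) (auto simp: indicator_def field_simps)
  also have "\<dots> = emeasure Ho {..(t - s) * l}" by simp
  finally have *: "A (\<lambda>s _. indicator {..t} s) s y = emeasure Ho {..(t - s) * l}" .
  show ?thesis
  proof (cases "s \<le> t")
    case True
    have "emeasure Ho {(t - s) * l<..} + emeasure Ho {..(t - s) * l} = emeasure Ho ({(t - s) * l<..} \<union> {..(t - s) * l})"
      by (intro plus_emeasure) auto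
    also have "{(t - s) * l<..} \<union> {..(t - s) * l} = UNIV" by auto
    finally have "emeasure Ho {(t - s) * l<..} + emeasure Ho {..(t - s) * l} = 1"
      using Ho.emeasure_space_1 by simp
    moreover have "emeasure Ho {(t - s) * l<..} = ennreal (exp (- ((t - s) * l)))"
      using True l by (intro Ho_tail) auto
    ultimately show ?thesis using True by (simp add: Hf_def * l_def)
  next
    case False
    have "emeasure Ho {..(t - s) * l} = 0"
    proof -
      have "AE e in Ho. e \<notin> {..(t - s) * l}"
        using AE_Ho
      proof eventually_elim
        case (elim e)
        have "(t - s) * l < 0" using False l by (intro mult_neg_pos) auto
        then show ?case using elim by auto
      qed
      then show ?thesis by (subst (asm) AE_iff_measurable[OF _ refl]) (auto simp: atMost_def)
    qed
    then show ?thesis using False by (simp add: Hf_def *)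
  qed
qed

text \<open>Non-explosion: since \<open>jchain\<close> stays positive, the state 0 marks exploded
  paths only (up to a null set), so mass 1 on (0, \<infinity>) says that nothing is lost.\<close>

lemma K_ne0:
  assumes "0 < x" "0 \<le> t"
  shows "K t (indicator {0<..}) x = 1" and "AE \<omega> in S. 0 < Yproc \<alpha> (x, \<omega>) t"
proof -
  have m: "m2 (\<lambda>s _. indicator {..t} s :: ennreal)" unfolding split_beta by measurable
  have "indicator {..t} 0 = (\<Sum>n. (A ^^ n) (Hf t (\<lambda>_. 1)) 0 x)"
    by (rule A_iterate[where T=t and V="\<lambda>s _. indicator {..t} s", OF m m2_Hf A_indicator _ assms(1)]) auto
  also have "\<dots> = (\<Sum>n. (A ^^ n) (Hf t (indicator {0<..})) 0 x)"
    using assms by (intro suminf_cong A_pow_cong) (auto simp: Hf_def)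
  also have "\<dots> = K t (indicator {0<..}) x"
    using assms by (intro K_series_aux[symmetric]) auto
  finally show 1: "K t (indicator {0<..}) x = 1" using assms by simp
  have "(\<integral>\<^sup>+\<omega>. indicator {\<omega>\<in>space S. 0 < Yproc \<alpha> (x, \<omega>) t} \<omega> \<partial>S) = (\<integral>\<^sup>+\<omega>. indicator {0<..} (Yproc \<alpha> (x, \<omega>) t) \<partial>S)"
    by (intro nn_integral_cong) (auto simp: indicator_def)
  then have "emeasure S {\<omega>\<in>space S. 0 < Yproc \<alpha> (x, \<omega>) t} = 1"
    using 1 unfolding K_def by simp
  then have "measure S {\<omega>\<in>space S. 0 < Yproc \<alpha> (x, \<omega>) t} = 1" by (simp add: measure_def)
  then show "AE \<omega> in S. 0 < Yproc \<alpha> (x, \<omega>) t"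
    by (rule S.AE_prob_1[THEN AE_mp]) (auto intro!: AE_I2)
qed

lemma K_cong:
  assumes "0 < x" "0 \<le> t" "\<And>y. 0 < y \<Longrightarrow> f y = g y"
  shows "K t f x = K t g x"
  unfolding K_def using K_ne0(2)[OF assms(1,2)]
  by (intro nn_integral_cong_AE) (auto elim: eventually_mono simp: assms(3))

section \<open>Backward renewal equation and Markov property\<close>

text \<open>The mean of \<open>f\<close> at time \<open>t\<close> when the state \<open>x\<close> is
  entered at time \<open>s\<close>. Keeping both times makes the renewal equation available for
  every \<open>s\<close>; for s \<le> t only t - s matters, see \<open>K_series\<close>.\<close>

definition U :: "real \<Rightarrow> (real \<Rightarrow> ennreal) \<Rightarrow> real \<Rightarrow> real \<Rightarrow> ennreal" where
  "U t f s x = (\<Sum>n. (A ^^ n) (Hf t f) s x)"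

lemma m2_U: assumes "f \<in> borel_measurable borel" shows "m2 (U t f)"
proof -
  have [measurable]: "case_prod ((A ^^ n) (Hf t f)) \<in> borel_measurable (borel \<Otimes>\<^sub>M borel)" for n
    by (intro m2_A_pow m2_Hf assms)
  have "(\<lambda>p. \<Sum>n. case_prod ((A ^^ n) (Hf t f)) p) \<in> borel_measurable (borel \<Otimes>\<^sub>M borel)" by measurable
  then show ?thesis by (simp add: U_def split_beta')
qed

lemma K_series:
  assumes [measurable]: "f \<in> borel_measurable borel" and "0 < x" "s \<le> t"
  shows "U t f s x = K (t - s) f x"
proof -
  \<comment> \<open>The expansion requires a test function that vanishes at 0; the cut-off changes
    neither side, as both see positive states only.\<close>
  let ?f = "\<lambda>y. indicator {0<..} y * f y"
  have "U t f s x = (\<Sum>n. (A ^^ n) (Hf t ?f) s x)"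
    unfolding U_def using assms by (intro suminf_cong A_pow_cong) (auto simp: Hf_def)
  also have "\<dots> = (\<Sum>n. (A ^^ n) (Hf (t - s) ?f) 0 x)"
  proof (rule suminf_cong)
    fix n
    show "(A ^^ n) (Hf t ?f) s x = (A ^^ n) (Hf (t - s) ?f) 0 x"
      using assms by (subst (1 2) A_pow_Hf[symmetric]) (auto intro!: nn_integral_cong simp: algebra_simps)
  qed
  also have "\<dots> = K (t - s) ?f x"
    using assms by (intro K_series_aux[symmetric]) auto
  also have "\<dots> = K (t - s) f x"
    using assms by (intro K_cong) auto
  finally show ?thesis .
qed

lemma U_renewal:
  assumes "f \<in> borel_measurable borel"
  shows "U t f s x = Hf t f s x + A (U t f) s x"
proof -
  have "A (U t f) s x = (\<Sum>n. (A ^^ Suc n) (Hf t f) s x)"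
    unfolding U_def by (subst A_suminf) (auto intro!: m2_A_pow m2_Hf assms)
  moreover have "U t f s x = (A ^^ 0) (Hf t f) s x + (\<Sum>n. (A ^^ Suc n) (Hf t f) s x)"
    unfolding U_def by (subst suminf_offset[where i=1]) (auto intro: summableI)
  ultimately show ?thesis by simp
qed


lemma K_le_1: "(\<And>y. f y \<le> 1) \<Longrightarrow> K t f x \<le> 1"
  using nn_integral_mono[of S "\<lambda>\<omega>. f (Yproc \<alpha> (x, \<omega>) t)" "\<lambda>_. 1"]
  by (simp add: K_def S.emeasure_space_1)

text \<open>\<open>U (s + t) f\<close>, cut off at time \<open>s\<close>, solves the renewal
  equation with source \<open>Hf s (K t f)\<close>, and by uniqueness it is the expansion of
  \<open>K s (K t f)\<close>. The bound on \<open>f\<close> provides the boundedness on which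
  uniqueness rests.\<close>

lemma K_semigroup:
  assumes f[measurable]: "f \<in> borel_measurable borel" and f1: "\<And>y. f y \<le> 1"
    and "0 \<le> s" "0 \<le> t" "0 < x"
  shows "K (s + t) f x = K s (K t f) x"
proof -
  define V where "V = U (s + t) f"
  have V: "m2 V" unfolding V_def by (rule m2_U) measurable
  note [measurable] = m2D[OF V]
  define V' where "V' = (\<lambda>\<sigma> y. indicator {..s} \<sigma> * V \<sigma> y)"
  have V': "m2 V'" unfolding V'_def split_beta by measurable
  have "V' 0 x = (\<Sum>n. (A ^^ n) (Hf s (K t f)) 0 x)"
  proof (rule A_iterate[OF V' m2_Hf[OF measurable_K[OF f]] _ _ \<open>0 < x\<close>])
    fix \<sigma> y :: real assume y: "0 < y"
    show "V' \<sigma> y \<le> indicator {..s} \<sigma>"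
      using y \<open>0 \<le> t\<close> by (auto simp: V'_def indicator_def V_def K_series intro: K_le_1 f1)
    define l where "l = y powr \<alpha>"
    have l: "l > 0" using y by (simp add: l_def)
    let ?W = "\<lambda>r. \<integral>\<^sup>+z. V r (z * y) \<partial>Th"
    have AV': "A V' \<sigma> y = (\<integral>\<^sup>+r. indicator {\<sigma><..} r * ennreal (l * exp (- ((r - \<sigma>) * l))) * (indicator {..s} r * ?W r) \<partial>lborel)"
      unfolding A_alt[OF V' y] l_def[symmetric] by (simp add: V'_def nn_integral_cmult)
    show "V' \<sigma> y = Hf s (K t f) \<sigma> y + A V' \<sigma> y"
    proof (cases "\<sigma> \<le> s")
      case False
      have "A V' \<sigma> y = (\<integral>\<^sup>+(r::real). 0 \<partial>lborel)"
        unfolding AV' using False by (intro nn_integral_cong) (auto simp: indicator_def)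
      then show ?thesis using False by (simp add: V'_def Hf_def)
    next
      case True
      define E where "E = exp (- ((s - \<sigma>) * l))"
      \<comment> \<open>Jumps after time \<open>s\<close> are separated from the earlier ones. On
        the former the density factors by the memoryless property; \<open>E\<close> is the
        probability of no jump between \<sigma> and \<open>s\<close>.\<close>
      have split: "indicator {\<sigma><..} r * ennreal (l * exp (- ((r - \<sigma>) * l))) * ?W r =
          indicator {\<sigma><..} r * ennreal (l * exp (- ((r - \<sigma>) * l))) * (indicator {..s} r * ?W r) +
          ennreal E * (indicator {s<..} r * ennreal (l * exp (- ((r - s) * l))) * ?W r)" for r
      proof (cases "r \<le> s")
        case False
        have "l * exp (- ((r - \<sigma>) * l)) = E * (l * exp (- ((r - s) * l)))"
          by (simp add: E_def mult_exp_exp algebra_simps)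
        then have "ennreal (l * exp (- ((r - \<sigma>) * l))) = ennreal E * ennreal (l * exp (- ((r - s) * l)))"
          using l by (simp add: ennreal_mult E_def mult_ac)
        then show ?thesis using False True by (simp add: mult_ac)
      qed (use True in simp)
      have "A V \<sigma> y = (\<integral>\<^sup>+r. indicator {\<sigma><..} r * ennreal (l * exp (- ((r - \<sigma>) * l))) * ?W r \<partial>lborel)"
        unfolding A_alt[OF V y] l_def ..
      also have "\<dots> = A V' \<sigma> y + (\<integral>\<^sup>+r. ennreal E * (indicator {s<..} r * ennreal (l * exp (- ((r - s) * l))) * ?W r) \<partial>lborel)"
        unfolding AV' split by (rule nn_integral_add) measurable
      also have "(\<integral>\<^sup>+r. ennreal E * (indicator {s<..} r * ennreal (l * exp (- ((r - s) * l))) * ?W r) \<partial>lborel) = ennreal E * A V s y"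
        unfolding A_alt[OF V y] l_def[symmetric] by (rule nn_integral_cmult) measurable
      finally have 1: "A V \<sigma> y = A V' \<sigma> y + ennreal E * A V s y" .
      have 2: "Hf (s + t) f \<sigma> y = ennreal E * Hf (s + t) f s y"
      proof -
        have "exp (- ((s + t - \<sigma>) * l)) = E * exp (- ((s + t - s) * l))"
          by (simp add: E_def mult_exp_exp algebra_simps)
        then have "ennreal (exp (- ((s + t - \<sigma>) * l))) = ennreal E * ennreal (exp (- ((s + t - s) * l)))"
          using l by (simp add: ennreal_mult E_def)
        then show ?thesis using True \<open>0 \<le> t\<close> by (simp add: Hf_def l_def[symmetric] mult_ac)
      qed
      have "V' \<sigma> y = Hf (s + t) f \<sigma> y + A V \<sigma> y"
        using True U_renewal[OF f, of "s + t" \<sigma> y] by (simp add: V'_def V_def)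
      also have "\<dots> = ennreal E * (Hf (s + t) f s y + A V s y) + A V' \<sigma> y"
        unfolding 1 2 by (simp add: distrib_left add_ac)
      also have "Hf (s + t) f s y + A V s y = K t f y"
        using U_renewal[OF f, of "s + t" s y] K_series[OF f y, of s "s + t"] \<open>0 \<le> t\<close> by (simp add: V_def)
      finally show ?thesis using True by (simp add: Hf_def E_def l_def)
    qed
  qed
  also have "\<dots> = K s (K t f) x"
    using K_series[OF measurable_K[OF f] \<open>0 < x\<close>, of 0 s t] assms by (simp add: U_def)
  finally show ?thesis
    using assms K_series[OF f \<open>0 < x\<close>, of 0 "s + t"] by (simp add: V'_def V_def)
qed

section \<open>Scaling, first jump and law of the process\<close>

lemma jchain_scale: "jchain (l * x, \<omega>) n = l * jchain (x, \<omega>) n"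
  by (simp add: jchain_def)

text \<open>Multiplying the state by \<open>l\<close> multiplies every jump rate by l^\<alpha>. On
  the same sample this is the same path, dilated and run l^\<alpha> times as fast.\<close>

lemma Yproc_scale:
  assumes "0 < l" "0 < x" "\<And>i. 0 < fst (\<omega> i)"
  shows "Yproc \<alpha> (l * x, \<omega>) (t / l powr \<alpha>) = l * Yproc \<alpha> (x, \<omega>) t"
proof -
  have "htime \<alpha> (l * x, \<omega>) n = htime \<alpha> (x, \<omega>) n / l powr \<alpha>" for n
    using jchain_pos[of x \<omega> n] assms by (simp add: htime_def jchain_scale powr_mult)
  then have "jtime \<alpha> (l * x, \<omega>) n = jtime \<alpha> (x, \<omega>) n / l powr \<alpha>" for n
    by (simp add: jtime_def sum_divide_distrib)
  then have "t / l powr \<alpha> < jtime \<alpha> (l * x, \<omega>) n \<longleftrightarrow> t < jtime \<alpha> (x, \<omega>) n" for n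
    using assms(1) by (simp add: divide_less_cancel)
  then show ?thesis by (simp add: Yproc_def jchain_scale)
qed

lemma K_scale:
  assumes "0 < l" "0 < x"
  shows "K t (\<lambda>y. f (l * y)) x = K (t / l powr \<alpha>) f (l * x)"
  unfolding K_def
proof (rule nn_integral_cong_AE)
  show "AE \<omega> in S. f (l * Yproc \<alpha> (x, \<omega>) t) = f (Yproc \<alpha> (l * x, \<omega>) (t / l powr \<alpha>))"
    using AE_S by eventually_elim (subst Yproc_scale, use assms in auto)
qed

text \<open>The renewal equation without the contribution of the paths that do not jump up to
  \<open>t\<close>. The minorization iterates this bound.\<close>

lemma K_first_jump:
  assumes f[measurable]: "f \<in> borel_measurable borel" and "0 < x" "0 \<le> t"
  shows "(\<integral>\<^sup>+r. indicator {0<..t} r * ennreal (x powr \<alpha> * exp (- (r * x powr \<alpha>))) *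
      (\<integral>\<^sup>+z. K (t - r) f (z * x) \<partial>Th) \<partial>lborel) \<le> K t f x"
proof -
  have "(\<integral>\<^sup>+r. indicator {0<..t} r * ennreal (x powr \<alpha> * exp (- (r * x powr \<alpha>))) *
      (\<integral>\<^sup>+z. K (t - r) f (z * x) \<partial>Th) \<partial>lborel)
     = (\<integral>\<^sup>+r. indicator {0<..t} r * ennreal (x powr \<alpha> * exp (- (r * x powr \<alpha>))) *
      (\<integral>\<^sup>+z. U t f r (z * x) \<partial>Th) \<partial>lborel)"
  proof (intro nn_integral_cong)
    fix r
    have "(\<integral>\<^sup>+z. K (t - r) f (z * x) \<partial>Th) = (\<integral>\<^sup>+z. U t f r (z * x) \<partial>Th)" if "r \<le> t"
      using that assms by (intro nn_integral_cong_AE AE_Th_pos) (simp add: K_series)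
    then show "indicator {0<..t} r * ennreal (x powr \<alpha> * exp (- (r * x powr \<alpha>))) * (\<integral>\<^sup>+z. K (t - r) f (z * x) \<partial>Th) =
      indicator {0<..t} r * ennreal (x powr \<alpha> * exp (- (r * x powr \<alpha>))) * (\<integral>\<^sup>+z. U t f r (z * x) \<partial>Th)"
      by (auto simp: indicator_def)
  qed
  also have "\<dots> \<le> (\<integral>\<^sup>+r. indicator {0<..} r * ennreal (x powr \<alpha> * exp (- ((r - 0) * x powr \<alpha>))) *
      (\<integral>\<^sup>+z. U t f r (z * x) \<partial>Th) \<partial>lborel)"
    by (intro nn_integral_mono mult_right_mono) (auto simp: indicator_def)
  also have "\<dots> = A (U t f) 0 x"
    by (rule A_alt[symmetric]) (use assms m2_U in auto)
  also have "\<dots> \<le> U t f 0 x"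
    unfolding U_renewal[OF f, of t 0 x] by (simp add: add_increasing)
  also have "\<dots> = K t f x" using K_series[OF f, of x 0 t] assms by simp
  finally show ?thesis .
qed

lemma sets_mm [measurable_cong, simp]: "sets mm = sets borel" and space_mm [simp]: "space mm = UNIV"
  by (simp_all add: mm_def)

lemma nn_integral_mm:
  assumes [measurable]: "f \<in> borel_measurable borel"
  shows "(\<integral>\<^sup>+x. f x \<partial>mm) = (\<integral>\<^sup>+x. ennreal x * indicator {0<..} x * f x \<partial>lborel)"
  unfolding mm_def by (rule nn_integral_density) auto

lemma AE_mm: "AE x in mm. 0 < x"
  unfolding mm_def by (subst AE_density) (auto simp: indicator_def split: if_splits intro!: AE_I2)

text \<open>Fubini's theorem between the initial state and the driving sequence. It translates laws
  of \<open>Yproc\<close>, and with them \<open>frag_solution\<close>, into integrals of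
  \<open>K\<close> against the initial density.\<close>

lemma law_Yproc:
  assumes [measurable]: "c0 \<in> borel_measurable borel" "f \<in> borel_measurable borel"
  shows "(\<integral>\<^sup>+y. f y \<partial>distr (jump_space h c0) borel (\<lambda>\<omega>. Yproc \<alpha> \<omega> t)) = (\<integral>\<^sup>+x. ennreal (c0 x) * K t f x \<partial>mm)"
proof -
  have js: "jump_space h c0 = density mm (\<lambda>x. ennreal (c0 x)) \<Otimes>\<^sub>M S"
    by (simp add: jump_space_def S_def)
  have sj: "sets (density mm (\<lambda>x. ennreal (c0 x)) \<Otimes>\<^sub>M S) = sets (borel \<Otimes>\<^sub>M S)"
    by (intro sets_pair_measure_cong) auto
  have Y: "(\<lambda>\<omega>. Yproc \<alpha> \<omega> t) \<in> borel_measurable (density mm (\<lambda>x. ennreal (c0 x)) \<Otimes>\<^sub>M S)"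
    using measurable_Yproc by (simp add: sj cong: measurable_cong_sets)
  have fY: "(\<lambda>\<omega>. f (Yproc \<alpha> \<omega> t)) \<in> borel_measurable (density mm (\<lambda>x. ennreal (c0 x)) \<Otimes>\<^sub>M S)"
    using measurable_compose[OF Y assms(2)] .
  have "(\<integral>\<^sup>+y. f y \<partial>distr (jump_space h c0) borel (\<lambda>\<omega>. Yproc \<alpha> \<omega> t)) =
      (\<integral>\<^sup>+\<omega>. f (Yproc \<alpha> \<omega> t) \<partial>(density mm (\<lambda>x. ennreal (c0 x)) \<Otimes>\<^sub>M S))"
    unfolding js by (rule nn_integral_distr[OF Y]) simp
  also have "\<dots> = (\<integral>\<^sup>+x. K t f x \<partial>density mm (\<lambda>x. ennreal (c0 x)))"
    using S.nn_integral_fst[OF fY] by (simp add: K_def)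
  also have "\<dots> = (\<integral>\<^sup>+x. ennreal (c0 x) * K t f x \<partial>mm)"
    by (rule nn_integral_density) measurable
  finally show ?thesis .
qed

end

subsection \<open>Multiplicative Haar measure\<close>

text \<open>This is dx / x on (0, \<infinity>). Both the jump from x to \<theta> x and the
  self-similar rescaling are dilations, which leave it invariant, and logarithms turn it into
  Lebesgue measure.\<close>

definition hm :: "real measure" where
  "hm = distr lborel borel exp"

lemma sets_hm [measurable_cong, simp]: "sets hm = sets borel" and space_hm [simp]: "space hm = UNIV"
  by (simp_all add: hm_def)

lemma nn_integral_hm:
  "f \<in> borel_measurable borel \<Longrightarrow> (\<integral>\<^sup>+x. f x \<partial>hm) = (\<integral>\<^sup>+v. f (exp v) \<partial>lborel)"
  unfolding hm_def by (rule nn_integral_distr) auto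

lemma AE_hm: "AE x in hm. 0 < x"
  unfolding hm_def by (subst AE_distr_iff) auto

text \<open>Substitution x = exp v between exp (- n) and exp n, followed by monotone
  convergence.\<close>

lemma nn_integral_pos_hm:
  fixes f :: "real \<Rightarrow> ennreal"
  assumes [measurable]: "f \<in> borel_measurable borel"
  shows "(\<integral>\<^sup>+x. indicator {0<..} x * f x \<partial>lborel) = (\<integral>\<^sup>+x. f x * ennreal x \<partial>hm)"
proof -
  have ev: "\<forall>\<^sub>F n in sequentially. - real n \<le> c \<and> c \<le> real n" for c
    using eventually_ge_at_top[of "nat \<lceil>\<bar>c\<bar>\<rceil>"] by eventually_elim linarith
  have 1: "(\<lambda>n. \<integral>\<^sup>+x. f x * indicator {exp (- real n)..exp (real n)} x \<partial>lborel) \<longlonglongrightarrow> (\<integral>\<^sup>+x. indicator {0<..} x * f x \<partial>lborel)"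
  proof (rule nn_integral_LIMSEQ)
    show "incseq (\<lambda>n x. f x * indicator {exp (- real n)..exp (real n)} x)"
    proof (intro monoI le_funI mult_left_mono)
      fix m n :: nat and x :: real assume "m \<le> n"
      then have "exp (- real n) \<le> exp (- real m)" "exp (real m) \<le> exp (real n)" by auto
      then show "indicator {exp (- real m)..exp (real m)} x \<le> (indicator {exp (- real n)..exp (real n)} x :: ennreal)"
        by (intro indicator_leI) (metis atLeastAtMost_iff order_trans)
    qed simp
    show "(\<lambda>n. f x * indicator {exp (- real n)..exp (real n)} x) \<longlonglongrightarrow> indicator {0<..} x * f x" for x
    proof (cases "0 < x")
      case True
      show ?thesis
      proof (rule tendsto_eventually)
        show "\<forall>\<^sub>F n in sequentially. f x * indicator {exp (- real n)..exp (real n)} x = indicator {0<..} x * f x"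
          using ev[of "ln x"]
        proof eventually_elim
          case (elim n)
          then have "exp (- real n) \<le> exp (ln x)" "exp (ln x) \<le> exp (real n)" by (auto simp del: exp_ln)
          then show ?case using True by simp
        qed
      qed
    next
      case False
      then have "\<not> exp (- real n) \<le> x" for n using exp_gt_zero[of "- real n"] by linarith
      then show ?thesis using False by (simp add: indicator_def)
    qed
  qed measurable
  have 2: "(\<lambda>n. \<integral>\<^sup>+v. f (exp v) * ennreal (exp v) * indicator {- real n..real n} v \<partial>lborel) \<longlonglongrightarrow> (\<integral>\<^sup>+v. f (exp v) * ennreal (exp v) \<partial>lborel)"
  proof (rule nn_integral_LIMSEQ)
    show "incseq (\<lambda>n v. f (exp v) * ennreal (exp v) * indicator {- real n..real n} v)"
      by (auto simp: incseq_def le_fun_def indicator_def)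
    show "(\<lambda>n. f (exp v) * ennreal (exp v) * indicator {- real n..real n} v) \<longlonglongrightarrow> f (exp v) * ennreal (exp v)" for v
      by (rule tendsto_eventually) (use ev[of v] in eventually_elim, auto)
  qed measurable
  have "(\<integral>\<^sup>+x. f x * indicator {exp (- real n)..exp (real n)} x \<partial>lborel) =
      (\<integral>\<^sup>+v. f (exp v) * ennreal (exp v) * indicator {- real n..real n} v \<partial>lborel)" for n
  proof (cases "n = 0")
    case True
    have "(\<integral>\<^sup>+x. f x * indicator {1} x \<partial>lborel) = 0" "(\<integral>\<^sup>+v. f (exp v) * ennreal (exp v) * indicator {0::real} v \<partial>lborel) = 0"
      by (auto simp: nn_integral_0_iff_AE indicator_def intro: AE_mp[OF AE_lborel_singleton])
    then show ?thesis using True by simp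
  next
    case False
    then show ?thesis
      by (intro nn_integral_substitution_aux) (auto intro!: derivative_eq_intros continuous_intros)
  qed
  with 1 2 have "(\<integral>\<^sup>+x. indicator {0<..} x * f x \<partial>lborel) = (\<integral>\<^sup>+v. f (exp v) * ennreal (exp v) \<partial>lborel)"
    using LIMSEQ_unique by auto
  then show ?thesis by (simp add: nn_integral_hm)
qed

lemma nn_integral_hm_scale:
  assumes [measurable]: "f \<in> borel_measurable borel" and "0 < c"
  shows "(\<integral>\<^sup>+x. f (c * x) \<partial>hm) = (\<integral>\<^sup>+x. f x \<partial>hm)"
  using nn_integral_real_affine[of "\<lambda>v. f (exp v)" 1 "ln c"] assms
  by (simp add: nn_integral_hm exp_add)

lemma nn_integral_hm_powr:
  assumes [measurable]: "f \<in> borel_measurable borel" and "0 < a"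
  shows "ennreal a * (\<integral>\<^sup>+x. f (x powr a) \<partial>hm) = (\<integral>\<^sup>+x. f x \<partial>hm)"
  using nn_integral_real_affine[of "\<lambda>v. f (exp v)" a 0] assms
  by (simp add: nn_integral_hm powr_def)

text \<open>An image measure does not inherit this property in general. Here the intervals from exp
  (- n) to exp n have measure 2 n and exhaust (0, \<infinity>), and the rest is a null set. Fubini's
  theorem in \<open>occ_A\<close> relies on it.\<close>

lemma sigma_finite_hm: "sigma_finite_measure hm"
proof
  let ?B = "\<lambda>n. {exp (- real n)..exp (real n)}"
  have "emeasure hm (?B n) = ennreal (2 * real n)" for n
  proof -
    have "emeasure hm (?B n) = (\<integral>\<^sup>+x. indicator (?B n) x \<partial>hm)" by simp
    also have "\<dots> = (\<integral>\<^sup>+v. indicator {- real n..real n} v \<partial>lborel)"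
    proof (subst nn_integral_hm)
      have "indicator (?B n) (exp v) = (indicator {- real n..real n} v :: ennreal)" for v by (simp add: indicator_def)
      then show "(\<integral>\<^sup>+v. indicator (?B n) (exp v) \<partial>lborel) = (\<integral>\<^sup>+v. indicator {- real n..real n} v \<partial>lborel)"
        by simp
    qed simp
    also have "\<dots> = ennreal (2 * real n)" by (subst nn_integral_indicator) auto
    finally show ?thesis .
  qed
  moreover have "emeasure hm {..0} = 0"
    unfolding hm_def by (subst emeasure_distr) (auto simp: vimage_def not_le)
  moreover have "UNIV = {..0} \<union> (\<Union>n. ?B n)"
  proof (intro equalityI subsetI UNIV_I)
    fix x :: real
    show "x \<in> {..0} \<union> (\<Union>n. ?B n)"
    proof (cases "0 < x")
      case True
      obtain n where "\<bar>ln x\<bar> \<le> real n" using real_arch_simple by blast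
      then have "exp (- real n) \<le> exp (ln x)" "exp (ln x) \<le> exp (real n)" by (auto simp del: exp_ln)
      then show ?thesis using True by auto
    qed auto
  qed
  ultimately show "\<exists>A. countable A \<and> A \<subseteq> sets hm \<and> \<Union>A = space hm \<and> (\<forall>a\<in>A. emeasure hm a \<noteq> \<infinity>)"
    by (intro exI[of _ "insert {..0} (range ?B)"]) auto
qed

text \<open>Boundedness allows means to be cancelled. Clamping is monotone and 1-Lipschitz, so
  increments keep their sign and do not exceed those of \<open>ln\<close>; pointwise convergence and
  Fatou's lemma remove the truncation in the end.\<close>

definition clamp_ln :: "nat \<Rightarrow> real \<Rightarrow> real" where
  "clamp_ln n x = max (- real n) (min (real n) (ln x))"

lemma measurable_clamp_ln [measurable]: "clamp_ln n \<in> borel_measurable borel"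
  unfolding clamp_ln_def by measurable

lemma clamp_ln_bounds: "- real n \<le> clamp_ln n x" "clamp_ln n x \<le> real n"
  by (auto simp: clamp_ln_def)

lemma clamp_ln_mono: "0 < x \<Longrightarrow> x \<le> y \<Longrightarrow> clamp_ln n x \<le> clamp_ln n y"
  using ln_mono[of x y] unfolding clamp_ln_def by linarith

lemma clamp_ln_diff: "0 < x \<Longrightarrow> x \<le> y \<Longrightarrow> clamp_ln n y - clamp_ln n x \<le> ln y - ln x"
  using ln_mono[of x y] unfolding clamp_ln_def by linarith

lemma clamp_ln_tendsto: "(\<lambda>n. clamp_ln n x) \<longlonglongrightarrow> ln x"
proof (rule tendsto_eventually)
  show "\<forall>\<^sub>F n in sequentially. clamp_ln n x = ln x"
    using eventually_ge_at_top[of "nat \<lceil>\<bar>ln x\<bar>\<rceil>"]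
  proof eventually_elim
    case (elim n)
    then have "\<bar>ln x\<bar> \<le> real n" by linarith
    then show ?case unfolding clamp_ln_def by linarith
  qed
qed

context fragmentation
begin

text \<open>Writing x dx as x^2 (dx / x); this is the origin of the factor x^2 in the
  profile.\<close>

lemma nn_integral_mm_hm:
  assumes [measurable]: "f \<in> borel_measurable borel"
  shows "(\<integral>\<^sup>+x. f x \<partial>mm) = (\<integral>\<^sup>+x. f x * ennreal (x\<^sup>2) \<partial>hm)"
proof -
  have "(\<integral>\<^sup>+x. f x \<partial>mm) = (\<integral>\<^sup>+x. indicator {0<..} x * (ennreal x * f x) \<partial>lborel)"
    by (subst nn_integral_mm) (auto simp: mult_ac)
  also have "\<dots> = (\<integral>\<^sup>+x. (ennreal x * f x) * ennreal x \<partial>hm)"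
    by (rule nn_integral_pos_hm) measurable
  also have "\<dots> = (\<integral>\<^sup>+x. f x * ennreal (x\<^sup>2) \<partial>hm)"
    using AE_hm by (intro nn_integral_cong_AE)
      (auto elim!: eventually_mono simp: power2_eq_square ennreal_mult mult_ac)
  finally show ?thesis .
qed

text \<open>The density of \<open>- ln \<theta>\<close>.\<close>
definition kd :: "real \<Rightarrow> ennreal" where
  "kd v = ennreal (h (exp (- v)) * exp (- v)) * indicator {0<..<1} (exp (- v)) * ennreal (exp (- v))"

lemma measurable_kd [measurable]: "kd \<in> borel_measurable borel"
proof -
  have "(\<lambda>v::real. exp (- v)) \<in> borel_measurable borel" by measurable
  from measurable_compose[OF this theta_density_measurable]
  have [measurable]: "(\<lambda>v. ennreal (h (exp (- v)) * exp (- v)) * indicator {0<..<1} (exp (- v))) \<in> borel_measurable borel" .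
  show ?thesis unfolding kd_def[abs_def] by measurable
qed

lemma nn_integral_Th_log:
  assumes [measurable]: "f \<in> borel_measurable borel"
  shows "(\<integral>\<^sup>+z. f z \<partial>Th) = (\<integral>\<^sup>+v. kd v * f (exp (- v)) \<partial>lborel)"
proof -
  let ?d = "\<lambda>z. ennreal (h z * z) * indicator {0<..<1} z"
  have "(\<integral>\<^sup>+z. f z \<partial>Th) = (\<integral>\<^sup>+z. indicator {0<..} z * (?d z * f z) \<partial>lborel)"
    by (subst nn_integral_Th) (auto intro!: nn_integral_cong simp: indicator_def)
  also have "\<dots> = (\<integral>\<^sup>+z. ?d z * f z * ennreal z \<partial>hm)"
    by (rule nn_integral_pos_hm) measurable
  also have "\<dots> = (\<integral>\<^sup>+v. ?d (exp v) * f (exp v) * ennreal (exp v) \<partial>lborel)"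
  proof (rule nn_integral_hm)
    show "(\<lambda>z. ?d z * f z * ennreal z) \<in> borel_measurable borel" by measurable
  qed
  also have "\<dots> = (\<integral>\<^sup>+v. ?d (exp (- v)) * f (exp (- v)) * ennreal (exp (- v)) \<partial>lborel)"
  proof -
    have "(\<lambda>v::real. exp v) \<in> borel_measurable borel" by measurable
    from measurable_compose[OF this theta_density_measurable]
    have [measurable]: "(\<lambda>v. ?d (exp v)) \<in> borel_measurable borel" .
    show ?thesis
      using nn_integral_real_affine[of "\<lambda>v. ?d (exp v) * f (exp v) * ennreal (exp v)" "-1" 0] by simp
  qed
  also have "\<dots> = (\<integral>\<^sup>+v. kd v * f (exp (- v)) \<partial>lborel)"
    by (intro nn_integral_cong) (simp add: kd_def mult_ac)
  finally show ?thesis .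
qed


subsection \<open>The perpetuity\<close>

definition pterm :: "nat \<Rightarrow> (nat \<Rightarrow> real \<times> real) \<Rightarrow> ennreal" where
  "pterm n \<omega> = ennreal ((\<Prod>i<n. fst (\<omega> i) powr \<alpha>) * snd (\<omega> n))"

definition perp :: "(nat \<Rightarrow> real \<times> real) \<Rightarrow> ennreal" where
  "perp \<omega> = (\<Sum>n. pterm n \<omega>)"

lemma measurable_pterm [measurable]: "pterm n \<in> borel_measurable S"
  unfolding pterm_def[abs_def] by measurable

lemma measurable_perp [measurable]: "perp \<in> borel_measurable S"
  unfolding perp_def[abs_def] by measurable

lemma pterm_shift: "pterm (Suc n) (case_nat (z, e) \<omega>) = ennreal (z powr \<alpha>) * pterm n \<omega>"
  by (simp add: pterm_def prod.lessThan_Suc_shift mult.assoc ennreal_mult' del: prod.lessThan_Suc)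

lemma perp_shift: "perp (case_nat (z, e) \<omega>) = ennreal e + ennreal (z powr \<alpha>) * perp \<omega>"
proof -
  have "perp (case_nat (z, e) \<omega>) = pterm 0 (case_nat (z, e) \<omega>) + (\<Sum>n. pterm (Suc n) (case_nat (z, e) \<omega>))"
    unfolding perp_def by (subst suminf_offset[where i=1]) (auto intro: summableI)
  then show ?thesis by (simp add: pterm_shift) (simp add: pterm_def perp_def)
qed

lemma theta_powr_mean_less: "(\<integral>\<^sup>+z. ennreal (z powr \<alpha>) \<partial>Th) < 1"
proof -
  have lt: "AE z in Th. 0 < z powr \<alpha> \<and> z powr \<alpha> < 1"
    using alpha_pos powr_less_mono2[of \<alpha> _ 1] by (intro AE_Th_pos) auto
  have "(\<integral>\<^sup>+z. ennreal (1 - z powr \<alpha>) + ennreal (z powr \<alpha>) \<partial>Th) = (\<integral>\<^sup>+z. 1 \<partial>Th)"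
  proof (rule nn_integral_cong_AE)
    show "AE z in Th. ennreal (1 - z powr \<alpha>) + ennreal (z powr \<alpha>) = 1"
      using lt by eventually_elim (simp flip: ennreal_plus)
  qed
  then have 1: "(\<integral>\<^sup>+z. ennreal (1 - z powr \<alpha>) \<partial>Th) + (\<integral>\<^sup>+z. ennreal (z powr \<alpha>) \<partial>Th) = 1"
    using Th.emeasure_space_1 by (subst (asm) nn_integral_add) auto
  have 2: "(\<integral>\<^sup>+z. ennreal (1 - z powr \<alpha>) \<partial>Th) \<noteq> 0"
  proof
    assume "(\<integral>\<^sup>+z. ennreal (1 - z powr \<alpha>) \<partial>Th) = 0"
    then have "AE z in Th. ennreal (1 - z powr \<alpha>) = 0" by (subst (asm) nn_integral_0_iff_AE) auto
    with lt have "AE z in Th. False" by eventually_elim (auto simp: ennreal_eq_0_iff)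
    then show False by simp
  qed
  have le: "(\<integral>\<^sup>+z. ennreal (z powr \<alpha>) \<partial>Th) \<le> 1" using 1 by (metis add_increasing zero_le order_refl)
  have "(\<integral>\<^sup>+z. ennreal (z powr \<alpha>) \<partial>Th) \<noteq> 1"
  proof
    assume "(\<integral>\<^sup>+z. ennreal (z powr \<alpha>) \<partial>Th) = 1"
    with 1 have "1 + (\<integral>\<^sup>+z. ennreal (1 - z powr \<alpha>) \<partial>Th) = 1 + 0" by (simp add: add.commute)
    then show False using 2 by (simp only: ennreal_add_left_cancel) simp
  qed
  with le show ?thesis by simp
qed

text \<open>The exact mean is 1, but finiteness is all that matters. The estimate e \<le> 2 exp (e /
  2) reduces the bound to an exponential tail.\<close>

lemma hold_mean_finite: "(\<integral>\<^sup>+e. ennreal e \<partial>Ho) \<le> 4"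
proof -
  have "(\<integral>\<^sup>+e. ennreal e \<partial>Ho) = (\<integral>\<^sup>+e. ennreal (exp (- e)) * indicator {0<..} e * ennreal e \<partial>lborel)"
    by (rule nn_integral_Ho) measurable
  also have "\<dots> \<le> (\<integral>\<^sup>+e. 2 * (indicator {0<..} e * ennreal (exp (- (1/2) * e))) \<partial>lborel)"
  proof (intro nn_integral_mono)
    fix e :: real
    have "exp (- e) * e \<le> 2 * exp (- (1/2) * e)"
    proof -
      have "e / 2 \<le> exp (e / 2)" using exp_ge_add_one_self[of "e/2"] by linarith
      then have "exp (- e) * e \<le> exp (- e) * (2 * exp (e / 2))" by (intro mult_left_mono) auto
      also have "\<dots> = 2 * exp (- (1/2) * e)" by (simp add: mult_exp_exp)
      finally show ?thesis .
    qed
    then show "ennreal (exp (- e)) * indicator {0<..} e * ennreal e \<le> 2 * (indicator {0<..} e * ennreal (exp (- (1/2) * e)))"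
      by (auto simp: indicator_def ennreal_leI simp flip: ennreal_mult ennreal_mult' ennreal_numeral)
  qed
  also have "\<dots> = 2 * (\<integral>\<^sup>+e. indicator {0<..} e * ennreal (exp (- (1/2) * e)) \<partial>lborel)"
    by (rule nn_integral_cmult) measurable
  also have "\<dots> = 4" by (subst nn_integral_exp_tail) (auto simp flip: ennreal_mult' ennreal_numeral)
  finally show ?thesis .
qed

text \<open>The n-th term has mean at most 4 q^n, where q is the mean of \<theta>^\<alpha>, and q <
  1 because \<theta> < 1 almost surely. So even the mean of the perpetuity is finite.\<close>

lemma perp_finite: "AE \<omega> in S. perp \<omega> < \<infinity>"
proof -
  define q where "q = (\<integral>\<^sup>+z. ennreal (z powr \<alpha>) \<partial>Th)"
  have q1: "q < 1" unfolding q_def by (rule theta_powr_mean_less)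
  have bd: "(\<integral>\<^sup>+\<omega>. pterm n \<omega> \<partial>S) \<le> 4 * q ^ n" for n
  proof (induction n)
    case 0
    have "(\<integral>\<^sup>+\<omega>. pterm 0 \<omega> \<partial>S) = (\<integral>\<^sup>+z. \<integral>\<^sup>+e. \<integral>\<^sup>+\<omega>. ennreal e \<partial>S \<partial>Ho \<partial>Th)"
      by (subst nn_integral_shift) (auto simp: pterm_def)
    also have "\<dots> = (\<integral>\<^sup>+e. ennreal e \<partial>Ho)"
      by (simp add: S.emeasure_space_1 Th.emeasure_space_1[simplified])
    finally show ?case using hold_mean_finite by simp
  next
    case (Suc n)
    have "(\<integral>\<^sup>+\<omega>. pterm (Suc n) \<omega> \<partial>S) = (\<integral>\<^sup>+z. \<integral>\<^sup>+e. \<integral>\<^sup>+\<omega>. ennreal (z powr \<alpha>) * pterm n \<omega> \<partial>S \<partial>Ho \<partial>Th)"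
      by (subst nn_integral_shift) (auto simp: pterm_shift)
    also have "\<dots> = q * (\<integral>\<^sup>+\<omega>. pterm n \<omega> \<partial>S)"
      using Ho.emeasure_space_1 by (simp add: nn_integral_cmult nn_integral_multc q_def)
    also have "\<dots> \<le> q * (4 * q ^ n)" using Suc by (intro mult_left_mono) auto
    finally show ?case by (simp add: mult_ac)
  qed
  obtain q' where q': "q = ennreal q'" "0 \<le> q'" using q1 by (cases q) auto
  have "q' < 1" using q1 q' by (simp add: ennreal_less_one_iff)
  have "(\<integral>\<^sup>+\<omega>. perp \<omega> \<partial>S) = (\<Sum>n. \<integral>\<^sup>+\<omega>. pterm n \<omega> \<partial>S)"
    unfolding perp_def by (rule nn_integral_suminf) measurable
  also have "\<dots> \<le> (\<Sum>n. ennreal (4 * q' ^ n))"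
    using bd q' by (intro suminf_le summableI) (auto simp: ennreal_mult ennreal_power)
  also have "\<dots> < \<infinity>"
    using q' \<open>q' < 1\<close> by (subst suminf_ennreal2) (auto intro!: summable_mult summable_geometric)
  finally have "(\<integral>\<^sup>+\<omega>. perp \<omega> \<partial>S) \<noteq> \<infinity>" by simp
  from nn_integral_PInf_AE[OF _ this] show ?thesis by (auto elim!: eventually_mono simp: less_top)
qed

definition rho :: "real measure" where
  "rho = distr S borel (\<lambda>\<omega>. enn2real (perp \<omega>))"

lemma sets_rho [measurable_cong, simp]: "sets rho = sets borel" and space_rho [simp]: "space rho = UNIV"
  by (simp_all add: rho_def)

sublocale rho: prob_space rho
  unfolding rho_def by (rule S.prob_space_distr) measurable

lemma nn_integral_rho:
  assumes [measurable]: "F \<in> borel_measurable borel"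
  shows "(\<integral>\<^sup>+i. F i \<partial>rho) = (\<integral>\<^sup>+z. \<integral>\<^sup>+e. \<integral>\<^sup>+i. F (e + z powr \<alpha> * i) \<partial>rho \<partial>Ho \<partial>Th)"
proof -
  have "(\<integral>\<^sup>+i. F i \<partial>rho) = (\<integral>\<^sup>+\<omega>. F (enn2real (perp \<omega>)) \<partial>S)"
    unfolding rho_def by (rule nn_integral_distr) measurable
  also have "\<dots> = (\<integral>\<^sup>+z. \<integral>\<^sup>+e. \<integral>\<^sup>+\<omega>. F (enn2real (perp (case_nat (z, e) \<omega>))) \<partial>S \<partial>Ho \<partial>Th)"
    by (rule nn_integral_shift) measurable
  also have "\<dots> = (\<integral>\<^sup>+z. \<integral>\<^sup>+e. \<integral>\<^sup>+i. F (e + z powr \<alpha> * i) \<partial>rho \<partial>Ho \<partial>Th)"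
  proof (rule nn_integral_cong, rule nn_integral_cong_AE)
    fix z
    show "AE e in Ho. (\<integral>\<^sup>+\<omega>. F (enn2real (perp (case_nat (z, e) \<omega>))) \<partial>S) = (\<integral>\<^sup>+i. F (e + z powr \<alpha> * i) \<partial>rho)"
      using AE_Ho
    proof eventually_elim
      case (elim e)
      have "(\<integral>\<^sup>+\<omega>. F (enn2real (perp (case_nat (z, e) \<omega>))) \<partial>S) = (\<integral>\<^sup>+\<omega>. F (e + z powr \<alpha> * enn2real (perp \<omega>)) \<partial>S)"
      proof (rule nn_integral_cong_AE)
        show "AE \<omega> in S. F (enn2real (perp (case_nat (z, e) \<omega>))) = F (e + z powr \<alpha> * enn2real (perp \<omega>))"
          using perp_finite
        proof eventually_elim
          case (elim \<omega>)
          then show ?case using \<open>0 < e\<close>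
            by (simp add: perp_shift enn2real_plus enn2real_mult ennreal_mult_less_top)
        qed
      qed
      also have "\<dots> = (\<integral>\<^sup>+i. F (e + z powr \<alpha> * i) \<partial>rho)"
        unfolding rho_def by (rule nn_integral_distr[symmetric]) measurable
      finally show ?case .
    qed
  qed
  finally show ?thesis .
qed

lemma AE_rho: "AE i in rho. 0 < i"
proof -
  have nn: "AE i in rho. 0 \<le> i"
    unfolding rho_def by (subst AE_distr_iff) auto
  have "(\<integral>\<^sup>+i. indicator {..0} i \<partial>rho) = (\<integral>\<^sup>+z. \<integral>\<^sup>+e. \<integral>\<^sup>+i. indicator {..0} (e + z powr \<alpha> * i) \<partial>rho \<partial>Ho \<partial>Th)"
    by (rule nn_integral_rho) measurable
  also have "\<dots> = (\<integral>\<^sup>+z. \<integral>\<^sup>+e. \<integral>\<^sup>+i. 0 \<partial>rho \<partial>Ho \<partial>Th)"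
  proof (rule nn_integral_cong, rule nn_integral_cong_AE)
    fix z
    show "AE e in Ho. (\<integral>\<^sup>+i. indicator {..0} (e + z powr \<alpha> * i) \<partial>rho) = (\<integral>\<^sup>+i. 0 \<partial>rho)"
      using AE_Ho
    proof eventually_elim
      case (elim e)
      then show ?case using nn
        by (intro nn_integral_cong_AE) (auto elim!: eventually_mono simp: indicator_def not_le add_pos_nonneg)
    qed
  qed
  finally have "(\<integral>\<^sup>+i. indicator {..0} i \<partial>rho) = 0" by simp
  then have "AE i in rho. indicator {..0} i = (0::ennreal)" by (subst (asm) nn_integral_0_iff_AE) auto
  then show ?thesis by eventually_elim (auto simp: indicator_def split: if_splits)
qed

sublocale Tr: pair_prob_space Th rho ..

text \<open>The law of \<open>\<theta>\<^sup>\<alpha> I\<close>, where \<open>I = E + \<theta>\<^sup>\<alpha> I'\<close> in law is the perpetuity; \<open>phi\<close> below is then the density of \<open>I\<close>.\<close>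
definition kap :: "real measure" where
  "kap = distr (Th \<Otimes>\<^sub>M rho) borel (\<lambda>p. fst p powr \<alpha> * snd p)"

lemma sets_kap [measurable_cong, simp]: "sets kap = sets borel" and space_kap [simp]: "space kap = UNIV"
  by (simp_all add: kap_def)

sublocale kap: prob_space kap
  unfolding kap_def by (rule Tr.prob_space_distr) measurable

lemma nn_integral_kap:
  assumes [measurable]: "F \<in> borel_measurable borel"
  shows "(\<integral>\<^sup>+j. F j \<partial>kap) = (\<integral>\<^sup>+z. \<integral>\<^sup>+i. F (z powr \<alpha> * i) \<partial>rho \<partial>Th)"
proof -
  have "(\<integral>\<^sup>+j. F j \<partial>kap) = (\<integral>\<^sup>+p. F (fst p powr \<alpha> * snd p) \<partial>(Th \<Otimes>\<^sub>M rho))"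
    unfolding kap_def by (rule nn_integral_distr) measurable
  also have "\<dots> = (\<integral>\<^sup>+z. \<integral>\<^sup>+i. F (z powr \<alpha> * i) \<partial>rho \<partial>Th)"
    by (subst rho.nn_integral_fst[symmetric]) auto
  finally show ?thesis .
qed

lemma AE_kap: "AE j in kap. 0 < j"
proof -
  have "(\<integral>\<^sup>+j. indicator {..0} j \<partial>kap) = (\<integral>\<^sup>+z. \<integral>\<^sup>+i. indicator {..0} (z powr \<alpha> * i) \<partial>rho \<partial>Th)"
    by (rule nn_integral_kap) measurable
  also have "\<dots> = (\<integral>\<^sup>+z. \<integral>\<^sup>+i. 0 \<partial>rho \<partial>Th)"
  proof (rule nn_integral_cong_AE, rule AE_Th_pos)
    fix z :: real assume "0 < z"
    then show "(\<integral>\<^sup>+i. indicator {..0} (z powr \<alpha> * i) \<partial>rho) = (\<integral>\<^sup>+i. 0 \<partial>rho)"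
      using AE_rho by (intro nn_integral_cong_AE)
        (auto elim!: eventually_mono simp: indicator_def not_le mult_le_0_iff)
  qed
  finally have "(\<integral>\<^sup>+j. indicator {..0} j \<partial>kap) = 0" by simp
  then have "AE j in kap. indicator {..0} j = (0::ennreal)" by (subst (asm) nn_integral_0_iff_AE) auto
  then show ?thesis by eventually_elim (auto simp: indicator_def split: if_splits)
qed

lemma rho_kap:
  assumes [measurable]: "F \<in> borel_measurable borel"
  shows "(\<integral>\<^sup>+i. F i \<partial>rho) = (\<integral>\<^sup>+j. \<integral>\<^sup>+e. F (e + j) \<partial>Ho \<partial>kap)"
proof -
  have "(\<integral>\<^sup>+j. \<integral>\<^sup>+e. F (e + j) \<partial>Ho \<partial>kap) = (\<integral>\<^sup>+z. \<integral>\<^sup>+i. \<integral>\<^sup>+e. F (e + z powr \<alpha> * i) \<partial>Ho \<partial>rho \<partial>Th)"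
    by (rule nn_integral_kap) measurable
  also have "\<dots> = (\<integral>\<^sup>+z. \<integral>\<^sup>+e. \<integral>\<^sup>+i. F (e + z powr \<alpha> * i) \<partial>rho \<partial>Ho \<partial>Th)"
  proof (rule nn_integral_cong)
    interpret rH: pair_prob_space rho Ho ..
    show "(\<integral>\<^sup>+i. \<integral>\<^sup>+e. F (e + z powr \<alpha> * i) \<partial>Ho \<partial>rho) = (\<integral>\<^sup>+e. \<integral>\<^sup>+i. F (e + z powr \<alpha> * i) \<partial>rho \<partial>Ho)" for z
      by (rule rH.Fubini'[symmetric]) measurable
  qed
  finally show ?thesis using nn_integral_rho[OF assms] by simp
qed

text \<open>The convolution of the exponential density with \<open>kap\<close>. The formula fixes a
  value at every point, which gives meaning to pointwise statements such as \<open>phi_pos\<close>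
  and \<open>phi_split\<close>.\<close>

definition phi :: "real \<Rightarrow> ennreal" where
  "phi s = (\<integral>\<^sup>+j. indicator {..s} j * ennreal (exp (j - s)) \<partial>kap)"

lemma measurable_phi [measurable]: "phi \<in> borel_measurable borel"
  unfolding phi_def[abs_def] indicator_def[abs_def] atMost_iff by measurable

lemma phi_le_1: "phi s \<le> 1"
proof -
  have "phi s \<le> (\<integral>\<^sup>+j. 1 \<partial>kap)" unfolding phi_def
    by (intro nn_integral_mono) (auto simp: indicator_def)
  then show ?thesis using kap.emeasure_space_1 by simp
qed

lemma rho_density:
  assumes [measurable]: "F \<in> borel_measurable borel"
  shows "(\<integral>\<^sup>+i. F i \<partial>rho) = (\<integral>\<^sup>+s. phi s * F s \<partial>lborel)"
proof -
  have [measurable]: "(\<lambda>p. indicator {..fst p} (snd p) * ennreal (exp (snd p - fst p))) \<in> borel_measurable (borel \<Otimes>\<^sub>M borel)"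
    unfolding indicator_def[abs_def] atMost_iff by measurable
  interpret kl: pair_sigma_finite kap lborel ..
  have "(\<integral>\<^sup>+i. F i \<partial>rho) = (\<integral>\<^sup>+j. \<integral>\<^sup>+e. F (e + j) \<partial>Ho \<partial>kap)" by (rule rho_kap) measurable
  also have "\<dots> = (\<integral>\<^sup>+j. \<integral>\<^sup>+s. indicator {..s} j * ennreal (exp (j - s)) * F s \<partial>lborel \<partial>kap)"
  proof (rule nn_integral_cong)
    fix j
    have "(\<integral>\<^sup>+e. F (e + j) \<partial>Ho) = (\<integral>\<^sup>+e. ennreal (exp (- e)) * indicator {0<..} e * F (e + j) \<partial>lborel)"
      by (rule nn_integral_Ho) measurable
    also have "\<dots> = (\<integral>\<^sup>+s. ennreal (exp (- (- j + s))) * indicator {0<..} (- j + s) * F (- j + s + j) \<partial>lborel)"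
      by (subst nn_integral_real_affine[where c=1 and t="-j"]) (auto simp: algebra_simps)
    also have "\<dots> = (\<integral>\<^sup>+s. indicator {..s} j * ennreal (exp (j - s)) * F s \<partial>lborel)"
    proof (rule nn_integral_cong_AE)
      show "AE s in lborel. ennreal (exp (- (- j + s))) * indicator {0<..} (- j + s) * F (- j + s + j) = indicator {..s} j * ennreal (exp (j - s)) * F s"
        using AE_lborel_singleton[of j] by eventually_elim (auto simp: indicator_def)
    qed
    finally show "(\<integral>\<^sup>+e. F (e + j) \<partial>Ho) = (\<integral>\<^sup>+s. indicator {..s} j * ennreal (exp (j - s)) * F s \<partial>lborel)" .
  qed
  also have "\<dots> = (\<integral>\<^sup>+s. \<integral>\<^sup>+j. indicator {..s} j * ennreal (exp (j - s)) * F s \<partial>kap \<partial>lborel)"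
    unfolding indicator_def[abs_def] atMost_iff by (rule kl.Fubini'[symmetric]) measurable
  also have "\<dots> = (\<integral>\<^sup>+s. phi s * F s \<partial>lborel)"
    unfolding phi_def by (intro nn_integral_cong nn_integral_multc) measurable
  finally show ?thesis .
qed


section \<open>Positivity of the density of the perpetuity\<close>

lemma theta_small: "\<exists>q>0. q < 1 \<and> emeasure Th {z. z powr \<alpha> \<le> q} \<noteq> 0"
proof (rule ccontr)
  assume neg: "\<not> ?thesis"
  have "AE z in Th. 1 - 1 / real (n + 2) < z powr \<alpha>" for n
  proof -
    have "emeasure Th {z. z powr \<alpha> \<le> 1 - 1 / real (n + 2)} = 0"
    proof -
      have "0 < 1 - 1 / real (n + 2)" "1 - 1 / real (n + 2) < 1" by (auto simp: field_simps)
      then show ?thesis using neg by blast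
    qed
    then show ?thesis by (subst AE_iff_measurable[OF _ refl]) (auto simp: not_less)
  qed
  then have "AE z in Th. \<forall>n. 1 - 1 / real (n + 2) < z powr \<alpha>" by (simp add: AE_all_countable)
  with AE_Th have "AE z in Th. False"
  proof eventually_elim
    case (elim z)
    have "(\<lambda>n. 1 - 1 / real (n + 2)) \<longlonglongrightarrow> 1 - 0"
      by (intro tendsto_diff tendsto_const LIMSEQ_ignore_initial_segment[OF lim_1_over_n])
    then have "1 \<le> z powr \<alpha>" using elim by (intro LIMSEQ_le_const2[of _ 1]) (auto intro: less_imp_le)
    moreover have "z powr \<alpha> < 1" using elim alpha_pos powr_less_mono2[of \<alpha> z 1] by auto
    ultimately show ?case by simp
  qed
  then show False by simp
qed

lemma Ho_atMost_pos: assumes "0 < d" shows "emeasure Ho {..d} \<noteq> 0"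
proof
  assume 0: "emeasure Ho {..d} = 0"
  have "emeasure Ho {d<..} + emeasure Ho {..d} = emeasure Ho ({d<..} \<union> {..d})"
    by (intro plus_emeasure) auto
  also have "{d<..} \<union> {..d} = UNIV" by auto
  finally have "ennreal (exp (- d)) = 1"
    using Ho.emeasure_space_1 assms 0 by (simp add: Ho_tail)
  then show False using assms by (simp flip: ennreal_1)
qed

text \<open>If the law charges the values up to \<open>c\<close>, then, by the perpetuity equation
  restricted to \<theta>^\<alpha> \<le> q and E \<le> d, it charges the values up to q c + d for
  every d > 0. Iteration reaches every neighbourhood of 0.\<close>

lemma rho_atMost_pos: assumes "0 < s" shows "emeasure rho {..s} \<noteq> 0"
proof -
  obtain q where q: "0 < q" "q < 1" "emeasure Th {z. z powr \<alpha> \<le> q} \<noteq> 0" using theta_small by auto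
  have step: "emeasure rho {..q * c + d} \<noteq> 0" if c: "emeasure rho {..c} \<noteq> 0" "0 < c" "0 < d" for c d
  proof -
    have "emeasure Th {z. z powr \<alpha> \<le> q} * emeasure Ho {..d} * emeasure rho {..c} =
      (\<integral>\<^sup>+z. \<integral>\<^sup>+e. \<integral>\<^sup>+i. indicator {z. z powr \<alpha> \<le> q} z * (indicator {..d} e * indicator {..c} i) \<partial>rho \<partial>Ho \<partial>Th)"
      by (simp add: nn_integral_cmult nn_integral_multc mult.assoc)
    also have "\<dots> \<le> (\<integral>\<^sup>+z. \<integral>\<^sup>+e. \<integral>\<^sup>+i. indicator {..q * c + d} (e + z powr \<alpha> * i) \<partial>rho \<partial>Ho \<partial>Th)"
    proof (intro nn_integral_mono)
      fix z e i :: real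
      have "e + z powr \<alpha> * i \<le> q * c + d" if "z powr \<alpha> \<le> q" "e \<le> d" "i \<le> c"
      proof -
        have "z powr \<alpha> * i \<le> z powr \<alpha> * c" using that by (intro mult_left_mono) auto
        also have "\<dots> \<le> q * c" using that c by (intro mult_right_mono) auto
        finally show ?thesis using that by simp
      qed
      then show "indicator {z. z powr \<alpha> \<le> q} z * (indicator {..d} e * indicator {..c} i) \<le> (indicator {..q * c + d} (e + z powr \<alpha> * i) :: ennreal)"
        by (auto simp: indicator_def)
    qed
    also have "\<dots> = (\<integral>\<^sup>+i. indicator {..q * c + d} i \<partial>rho)" by (rule nn_integral_rho[symmetric]) measurable
    also have "\<dots> = emeasure rho {..q * c + d}" by simp
    finally show ?thesis using q(3) c Ho_atMost_pos[OF c(3)] by auto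
  qed
  have "(\<lambda>n. emeasure rho {..real n}) \<longlonglongrightarrow> emeasure rho (\<Union>n. {..real n})"
    by (rule Lim_emeasure_incseq) (auto simp: incseq_def)
  moreover have "(\<Union>n. {..real n}) = UNIV" using real_arch_simple by auto
  ultimately have lim: "(\<lambda>n. emeasure rho {..real n}) \<longlonglongrightarrow> 1" using rho.emeasure_space_1 by simp
  have "\<exists>n. emeasure rho {..real n} \<noteq> 0"
  proof (rule ccontr)
    assume "\<not> ?thesis"
    then have "(\<lambda>n. emeasure rho {..real n}) = (\<lambda>_. 0)" by auto
    with lim show False by (simp add: LIMSEQ_const_iff)
  qed
  then obtain n where n: "emeasure rho {..real n} \<noteq> 0" by auto
  define c0 where "c0 = real n + 1"
  have "emeasure rho {..real n} \<le> emeasure rho {..c0}" by (intro emeasure_mono) (auto simp: c0_def)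
  with n have c0: "emeasure rho {..c0} \<noteq> 0" "0 < c0" by (auto simp: c0_def)
  have iter: "emeasure rho {..c0 * ((1 + q) / 2) ^ n} \<noteq> 0" for n
  proof (induction n)
    case 0 then show ?case using c0 by simp
  next
    case (Suc n)
    let ?c = "c0 * ((1 + q) / 2) ^ n"
    have "0 < ?c" using c0 q by simp
    \<comment> \<open>The choice d = (1 - q) c / 2 turns q c + d into c (1 + q) / 2, which contracts
      to 0.\<close>
    then have "emeasure rho {..q * ?c + (1 - q) / 2 * ?c} \<noteq> 0" using q by (intro step Suc) auto
    moreover have "q * ?c + (1 - q) / 2 * ?c = c0 * ((1 + q) / 2) ^ Suc n" by (simp add: field_simps)
    ultimately show ?case by (simp only: not_False_eq_True)
  qed
  have "(\<lambda>n. c0 * ((1 + q) / 2) ^ n) \<longlonglongrightarrow> c0 * 0"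
    using q by (intro tendsto_intros LIMSEQ_realpow_zero) auto
  then have "\<forall>\<^sub>F n in sequentially. c0 * ((1 + q) / 2) ^ n < s"
    using assms by (intro order_tendstoD(2)) auto
  then obtain n where "c0 * ((1 + q) / 2) ^ n < s" by (auto dest: eventually_happens)
  then have "emeasure rho {..c0 * ((1 + q) / 2) ^ n} \<le> emeasure rho {..s}" by (intro emeasure_mono) auto
  with iter[of n] show ?thesis by auto
qed

text \<open>As \<theta>^\<alpha> I \<le> I, \<open>kap\<close> charges the values up to
  \<open>s\<close> just as \<open>rho\<close> does, and exp (j - s) \<ge> exp (- s) for j > 0.
  Strict positivity is what allows an arbitrary initial density to be cut off at multiples of the
  profile.\<close>

lemma phi_pos: assumes "0 < s" shows "0 < phi s"
proof -
  have "0 < emeasure rho {..s}" using rho_atMost_pos[OF assms] by (simp add: zero_less_iff_neq_zero)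
  also have "emeasure rho {..s} = (\<integral>\<^sup>+z. \<integral>\<^sup>+i. indicator {..s} i \<partial>rho \<partial>Th)"
    by (simp add: Th.emeasure_space_1[simplified])
  also have "\<dots> \<le> (\<integral>\<^sup>+z. \<integral>\<^sup>+i. indicator {..s} (z powr \<alpha> * i) \<partial>rho \<partial>Th)"
  proof (rule nn_integral_mono_AE, rule AE_Th_pos, rule nn_integral_mono_AE)
    fix z :: real assume z: "0 < z" "z < 1"
    have z1: "z powr \<alpha> \<le> 1" using z alpha_pos powr_less_mono2[of \<alpha> z 1] by auto
    show "AE i in rho. indicator {..s} i \<le> (indicator {..s} (z powr \<alpha> * i) :: ennreal)"
      using AE_rho
    proof eventually_elim
      case (elim i)
      then have "z powr \<alpha> * i \<le> i" using z1 by (simp add: mult_le_cancel_right1)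
      then show ?case by (auto simp: indicator_def)
    qed
  qed
  also have "\<dots> = (\<integral>\<^sup>+j. indicator {..s} j \<partial>kap)" by (rule nn_integral_kap[symmetric]) measurable
  finally have 1: "0 < (\<integral>\<^sup>+j. indicator {..s} j \<partial>kap)" .
  have "ennreal (exp (- s)) * (\<integral>\<^sup>+j. indicator {..s} j \<partial>kap) = (\<integral>\<^sup>+j. ennreal (exp (- s)) * indicator {..s} j \<partial>kap)"
    by (rule nn_integral_cmult[symmetric]) measurable
  also have "\<dots> \<le> phi s" unfolding phi_def
    using AE_kap by (intro nn_integral_mono_AE) (auto elim!: eventually_mono simp: indicator_def ennreal_leI)
  finally show ?thesis using 1 by (metis ennreal_zero_less_mult_iff ennreal_less_zero_iff exp_gt_zero order_less_le_trans)
qed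

text \<open>Duhamel's formula expressed through \<open>kap\<close>, to be read with r = x^\<alpha>:
  mass present at time 0 survives with probability exp (- t r), and a value j in (r, (1 + t) r]
  stands for an arrival at \<open>x\<close> at time j / r - 1.\<close>

lemma phi_split:
  assumes "0 < r" "0 \<le> t"
  shows "phi ((1 + t) * r) = ennreal (exp (- (t * r))) * phi r +
    (\<integral>\<^sup>+j. (if r < j \<and> j \<le> (1 + t) * r then ennreal (exp (j - (1 + t) * r)) else 0) \<partial>kap)"
proof -
  have "phi ((1 + t) * r) = (\<integral>\<^sup>+j. ennreal (exp (- (t * r))) * (indicator {..r} j * ennreal (exp (j - r))) +
      (if r < j \<and> j \<le> (1 + t) * r then ennreal (exp (j - (1 + t) * r)) else 0) \<partial>kap)"
    unfolding phi_def
  proof (rule nn_integral_cong)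
    fix j
    have "r \<le> (1 + t) * r" using assms by (simp add: algebra_simps)
    moreover have "exp (j - (1 + t) * r) = exp (- (t * r)) * exp (j - r)" by (simp add: mult_exp_exp algebra_simps)
    ultimately show "indicator {..(1 + t) * r} j * ennreal (exp (j - (1 + t) * r)) =
      ennreal (exp (- (t * r))) * (indicator {..r} j * ennreal (exp (j - r))) +
      (if r < j \<and> j \<le> (1 + t) * r then ennreal (exp (j - (1 + t) * r)) else 0)"
      by (auto simp: indicator_def ennreal_mult)
  qed
  also have "\<dots> = ennreal (exp (- (t * r))) * phi r +
    (\<integral>\<^sup>+j. (if r < j \<and> j \<le> (1 + t) * r then ennreal (exp (j - (1 + t) * r)) else 0) \<partial>kap)"
    unfolding phi_def by (subst nn_integral_add) (auto simp: nn_integral_cmult)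
  finally show ?thesis .
qed

subsection \<open>The occupation functional of the self-similar profile\<close>

text \<open>The candidate for the expected sum of \<open>H\<close> over all pairs (jump time, post-jump state) of the process started
  from the (unnormalised) density \<open>phi (x\<^sup>\<alpha>)\<close> with respect to \<open>dx / x\<close>. It solves the same renewal equation as that sum,
  hence dominates it.\<close>
definition occ :: "(real \<Rightarrow> real \<Rightarrow> ennreal) \<Rightarrow> ennreal" where
  "occ H = (\<integral>\<^sup>+x. phi (x powr \<alpha>) * H 0 x +
     (\<integral>\<^sup>+j. (if x powr \<alpha> < j then H (j / x powr \<alpha> - 1) x else 0) \<partial>kap) \<partial>hm)"

text \<open>This is \<open>phi_split\<close> read backwards, with j / x^\<alpha> - 1 as the time of
  the last jump.\<close>

lemma occ_Hf:
  assumes [measurable]: "f \<in> borel_measurable borel" and t: "0 \<le> t"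
  shows "occ (Hf t f) = (\<integral>\<^sup>+x. f x * phi ((1 + t) * x powr \<alpha>) \<partial>hm)"
  unfolding occ_def
proof (rule nn_integral_cong_AE)
  show "AE x in hm. phi (x powr \<alpha>) * Hf t f 0 x +
     (\<integral>\<^sup>+j. (if x powr \<alpha> < j then Hf t f (j / x powr \<alpha> - 1) x else 0) \<partial>kap) = f x * phi ((1 + t) * x powr \<alpha>)"
    using AE_hm
  proof eventually_elim
    case (elim x)
    define l where "l = x powr \<alpha>"
    have l: "0 < l" using elim by (simp add: l_def)
    have "(\<integral>\<^sup>+j. (if l < j then Hf t f (j / l - 1) x else 0) \<partial>kap) =
      (\<integral>\<^sup>+j. f x * (if l < j \<and> j \<le> (1 + t) * l then ennreal (exp (j - (1 + t) * l)) else 0) \<partial>kap)"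
    proof (rule nn_integral_cong)
      fix j
      have "j / l - 1 \<le> t \<longleftrightarrow> j \<le> (1 + t) * l" using l by (simp add: field_simps)
      moreover have "- ((t - (j / l - 1)) * l) = j - (1 + t) * l" using l by (simp add: field_simps)
      ultimately show "(if l < j then Hf t f (j / l - 1) x else 0) =
         f x * (if l < j \<and> j \<le> (1 + t) * l then ennreal (exp (j - (1 + t) * l)) else 0)"
        by (auto simp: Hf_def l_def[symmetric] mult.commute)
    qed
    also have "\<dots> = f x * (\<integral>\<^sup>+j. (if l < j \<and> j \<le> (1 + t) * l then ennreal (exp (j - (1 + t) * l)) else 0) \<partial>kap)"
      by (rule nn_integral_cmult) measurable
    finally have J: "(\<integral>\<^sup>+j. (if l < j then Hf t f (j / l - 1) x else 0) \<partial>kap) = \<dots>" .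
    show ?case
      unfolding l_def[symmetric] J phi_split[OF l t]
      using t by (simp add: Hf_def l_def[symmetric] distrib_left mult_ac del: ennreal_add_left_cancel)
  qed
qed

lemma A_alt_le:
  assumes "m2 H" "0 < y"
  shows "A H s y = (\<integral>\<^sup>+r. (if s \<le> r then ennreal (y powr \<alpha> * exp (- ((r - s) * y powr \<alpha>))) else 0) *
    (\<integral>\<^sup>+z. H r (z * y) \<partial>Th) \<partial>lborel)"
  unfolding A_alt[OF assms]
proof (rule nn_integral_cong_AE)
  show "AE r in lborel. indicator {s<..} r * ennreal (y powr \<alpha> * exp (- ((r - s) * y powr \<alpha>))) * (\<integral>\<^sup>+z. H r (z * y) \<partial>Th) =
    (if s \<le> r then ennreal (y powr \<alpha> * exp (- ((r - s) * y powr \<alpha>))) else 0) * (\<integral>\<^sup>+z. H r (z * y) \<partial>Th)"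
    using AE_lborel_singleton[of s] by eventually_elim (auto simp: indicator_def)
qed

text \<open>The flux of jumps out of \<open>y\<close> at time \<open>r\<close> is the rate
  y^\<alpha> times the candidate density phi((1 + r) y^\<alpha>); \<open>phi_split\<close> merges
  the initial mass with the earlier arrivals into it.\<close>

lemma occ_A_aux:
  assumes "m2 H"
  shows "occ (A H) = (\<integral>\<^sup>+y. \<integral>\<^sup>+r. (if 0 \<le> r then ennreal (y powr \<alpha>) * phi ((1 + r) * y powr \<alpha>) else 0) *
    (\<integral>\<^sup>+z. H r (z * y) \<partial>Th) \<partial>lborel \<partial>hm)"
  unfolding occ_def
proof (rule nn_integral_cong_AE)
  note [measurable] = m2D[OF assms]
  interpret kl: pair_sigma_finite kap lborel ..
  show "AE y in hm. phi (y powr \<alpha>) * A H 0 y + (\<integral>\<^sup>+j. (if y powr \<alpha> < j then A H (j / y powr \<alpha> - 1) y else 0) \<partial>kap) =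
    (\<integral>\<^sup>+r. (if 0 \<le> r then ennreal (y powr \<alpha>) * phi ((1 + r) * y powr \<alpha>) else 0) * (\<integral>\<^sup>+z. H r (z * y) \<partial>Th) \<partial>lborel)"
    using AE_hm
  proof eventually_elim
    case (elim y)
    define l where "l = y powr \<alpha>"
    have l: "0 < l" using elim by (simp add: l_def)
    define W where "W r = (\<integral>\<^sup>+z. H r (z * y) \<partial>Th)" for r
    have [measurable]: "W \<in> borel_measurable borel" unfolding W_def[abs_def] by measurable
    have AH: "A H s y = (\<integral>\<^sup>+r. (if s \<le> r then ennreal (l * exp (- ((r - s) * l))) else 0) * W r \<partial>lborel)" for s
      unfolding A_alt_le[OF assms elim] l_def W_def ..
    let ?g = "\<lambda>j r. if l < j \<and> j \<le> (1 + r) * l then ennreal (exp (j - (1 + r) * l)) else 0"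
    have "(\<integral>\<^sup>+j. (if l < j then A H (j / l - 1) y else 0) \<partial>kap) = (\<integral>\<^sup>+j. \<integral>\<^sup>+r. ennreal l * W r * ?g j r \<partial>lborel \<partial>kap)"
    proof (rule nn_integral_cong)
      fix j
      show "(if l < j then A H (j / l - 1) y else 0) = (\<integral>\<^sup>+r. ennreal l * W r * ?g j r \<partial>lborel)"
      proof (cases "l < j")
        case True
        have "j / l - 1 \<le> r \<longleftrightarrow> j \<le> (1 + r) * l" for r using l by (simp add: field_simps)
        moreover have "- ((r - (j / l - 1)) * l) = j - (1 + r) * l" for r using l by (simp add: field_simps)
        ultimately show ?thesis
          unfolding AH using True l by (auto intro!: nn_integral_cong simp: ennreal_mult mult_ac)
      qed simp
    qed
    also have "\<dots> = (\<integral>\<^sup>+r. \<integral>\<^sup>+j. ennreal l * W r * ?g j r \<partial>kap \<partial>lborel)"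
      by (rule kl.Fubini'[symmetric]) measurable
    also have "\<dots> = (\<integral>\<^sup>+r. ennreal l * W r * (\<integral>\<^sup>+j. ?g j r \<partial>kap) \<partial>lborel)"
      by (intro nn_integral_cong nn_integral_cmult) measurable
    finally have 1: "(\<integral>\<^sup>+j. (if l < j then A H (j / l - 1) y else 0) \<partial>kap) = \<dots>" .
    have 2: "phi l * A H 0 y = (\<integral>\<^sup>+r. phi l * ((if 0 \<le> r then ennreal (l * exp (- (r * l))) else 0) * W r) \<partial>lborel)"
      unfolding AH by (subst nn_integral_cmult) (auto cong: if_cong)
    have "phi l * A H 0 y + (\<integral>\<^sup>+j. (if l < j then A H (j / l - 1) y else 0) \<partial>kap) =
       (\<integral>\<^sup>+r. phi l * ((if 0 \<le> r then ennreal (l * exp (- (r * l))) else 0) * W r) + ennreal l * W r * (\<integral>\<^sup>+j. ?g j r \<partial>kap) \<partial>lborel)"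
      unfolding 1 2 by (rule nn_integral_add[symmetric]) measurable
    also have "\<dots> = (\<integral>\<^sup>+r. (if 0 \<le> r then ennreal l * phi ((1 + r) * l) else 0) * W r \<partial>lborel)"
    proof (rule nn_integral_cong)
      fix r
      show "phi l * ((if 0 \<le> r then ennreal (l * exp (- (r * l))) else 0) * W r) + ennreal l * W r * (\<integral>\<^sup>+j. ?g j r \<partial>kap) =
        (if 0 \<le> r then ennreal l * phi ((1 + r) * l) else 0) * W r"
      proof (cases "0 \<le> r")
        case True
        then show ?thesis
          unfolding phi_split[OF l True] using l by (simp add: ennreal_mult distrib_left distrib_right mult_ac)
      next
        case False
        then have "r * l < 0" using l by (intro mult_neg_pos) auto
        then have n: "\<not> (l < j \<and> j \<le> (1 + r) * l)" for j by (auto simp: algebra_simps)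
        have "(\<lambda>j. ?g j r) = (\<lambda>_. 0)" by (rule ext, rule if_not_P, rule n)
        then show ?thesis using False by simp
      qed
    qed
    finally show ?case unfolding l_def W_def .
  qed
qed

text \<open>The flux out of y is moved to x = z y by dilation invariance. With b = (x / z)^\<alpha>,
  the weight b phi((1 + r) b) dr on r > 0 is the law of I / b - 1, which equals z^\<alpha> I /
  x^\<alpha> - 1. Averaging over z turns z^\<alpha> I into \<open>kap\<close>, and this is where the
  fixed point equation of the perpetuity enters.\<close>

lemma occ_A:
  assumes "m2 H"
  shows "occ H = (\<integral>\<^sup>+x. phi (x powr \<alpha>) * H 0 x \<partial>hm) + occ (A H)"
proof -
  note [measurable] = m2D[OF assms]
  interpret hm: sigma_finite_measure hm by (rule sigma_finite_hm)
  interpret hT: pair_sigma_finite hm Th ..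
  interpret lT: pair_sigma_finite lborel Th ..
  let ?w = "\<lambda>r y. if 0 \<le> r then ennreal (y powr \<alpha>) * phi ((1 + r) * y powr \<alpha>) else 0"
  have "occ (A H) = (\<integral>\<^sup>+y. \<integral>\<^sup>+r. \<integral>\<^sup>+z. ?w r y * H r (z * y) \<partial>Th \<partial>lborel \<partial>hm)"
    unfolding occ_A_aux[OF assms] by (intro nn_integral_cong nn_integral_cmult[symmetric]) measurable
  also have "\<dots> = (\<integral>\<^sup>+y. \<integral>\<^sup>+z. \<integral>\<^sup>+r. ?w r y * H r (z * y) \<partial>lborel \<partial>Th \<partial>hm)"
    by (intro nn_integral_cong lT.Fubini'[symmetric]) measurable
  also have "\<dots> = (\<integral>\<^sup>+z. \<integral>\<^sup>+y. \<integral>\<^sup>+r. ?w r y * H r (z * y) \<partial>lborel \<partial>hm \<partial>Th)"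
    by (rule hT.Fubini'[symmetric]) measurable
  also have "\<dots> = (\<integral>\<^sup>+z. \<integral>\<^sup>+x. \<integral>\<^sup>+r. ?w r (x / z) * H r x \<partial>lborel \<partial>hm \<partial>Th)"
  proof (rule nn_integral_cong_AE, rule AE_Th_pos)
    fix z :: real assume z: "0 < z"
    have "(\<integral>\<^sup>+y. \<integral>\<^sup>+r. ?w r (z * y / z) * H r (z * y) \<partial>lborel \<partial>hm) = (\<integral>\<^sup>+x. \<integral>\<^sup>+r. ?w r (x / z) * H r x \<partial>lborel \<partial>hm)"
      using z by (intro nn_integral_hm_scale[where f="\<lambda>x. \<integral>\<^sup>+r. ?w r (x / z) * H r x \<partial>lborel"]) measurable
    then show "(\<integral>\<^sup>+y. \<integral>\<^sup>+r. ?w r y * H r (z * y) \<partial>lborel \<partial>hm) = (\<integral>\<^sup>+x. \<integral>\<^sup>+r. ?w r (x / z) * H r x \<partial>lborel \<partial>hm)"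
      using z by (simp cong: if_cong)
  qed
  also have "\<dots> = (\<integral>\<^sup>+x. \<integral>\<^sup>+z. \<integral>\<^sup>+r. ?w r (x / z) * H r x \<partial>lborel \<partial>Th \<partial>hm)"
    by (rule hT.Fubini') measurable
  also have "\<dots> = (\<integral>\<^sup>+x. \<integral>\<^sup>+j. (if x powr \<alpha> < j then H (j / x powr \<alpha> - 1) x else 0) \<partial>kap \<partial>hm)"
  proof (rule nn_integral_cong_AE)
    show "AE x in hm. (\<integral>\<^sup>+z. \<integral>\<^sup>+r. ?w r (x / z) * H r x \<partial>lborel \<partial>Th) = (\<integral>\<^sup>+j. (if x powr \<alpha> < j then H (j / x powr \<alpha> - 1) x else 0) \<partial>kap)"
      using AE_hm
    proof eventually_elim
      case (elim x)
      define l where "l = x powr \<alpha>"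
      have l: "0 < l" using elim by (simp add: l_def)
      have "(\<integral>\<^sup>+j. (if l < j then H (j / l - 1) x else 0) \<partial>kap) =
         (\<integral>\<^sup>+z. \<integral>\<^sup>+i. (if l < z powr \<alpha> * i then H (z powr \<alpha> * i / l - 1) x else 0) \<partial>rho \<partial>Th)"
        by (rule nn_integral_kap) measurable
      also have "\<dots> = (\<integral>\<^sup>+z. \<integral>\<^sup>+r. ?w r (x / z) * H r x \<partial>lborel \<partial>Th)"
      proof (rule nn_integral_cong_AE, rule AE_Th_pos)
        fix z :: real assume z: "0 < z"
        define b where "b = (x / z) powr \<alpha>"
        have b: "0 < b" using z elim by (simp add: b_def)
        have lb: "l = z powr \<alpha> * b" using z elim by (simp add: b_def l_def powr_divide)
        have za: "0 < z powr \<alpha>" using z by simp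
        have "(\<integral>\<^sup>+i. (if l < z powr \<alpha> * i then H (z powr \<alpha> * i / l - 1) x else 0) \<partial>rho) =
          (\<integral>\<^sup>+i. (if b < i then H (i / b - 1) x else 0) \<partial>rho)"
          using za b by (intro nn_integral_cong) (simp add: lb)
        also have "\<dots> = (\<integral>\<^sup>+i. phi i * (if b < i then H (i / b - 1) x else 0) \<partial>lborel)"
          by (rule rho_density) measurable
        also have "\<dots> = ennreal \<bar>b\<bar> * (\<integral>\<^sup>+r. phi (b + b * r) * (if b < b + b * r then H ((b + b * r) / b - 1) x else 0) \<partial>lborel)"
          using b by (intro nn_integral_real_affine) auto
        also have "\<dots> = (\<integral>\<^sup>+r. ennreal b * (phi (b + b * r) * (if b < b + b * r then H ((b + b * r) / b - 1) x else 0)) \<partial>lborel)"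
          using b by (subst nn_integral_cmult) auto
        also have "\<dots> = (\<integral>\<^sup>+r. ?w r (x / z) * H r x \<partial>lborel)"
        proof (rule nn_integral_cong_AE)
          have e: "(b + b * r) / b - 1 = r" "b < b + b * r \<longleftrightarrow> 0 < r" "b + b * r = (1 + r) * b" for r
            using b by (auto simp: field_simps zero_less_mult_iff)
          show "AE r in lborel. ennreal b * (phi (b + b * r) * (if b < b + b * r then H ((b + b * r) / b - 1) x else 0)) = ?w r (x / z) * H r x"
            using AE_lborel_singleton[of 0] unfolding e(1) e(2) unfolding e(3) b_def[symmetric]
            by eventually_elim (auto simp: mult_ac)
        qed
        finally show "(\<integral>\<^sup>+i. (if l < z powr \<alpha> * i then H (z powr \<alpha> * i / l - 1) x else 0) \<partial>rho) = (\<integral>\<^sup>+r. ?w r (x / z) * H r x \<partial>lborel)" .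
      qed
      finally show ?case unfolding l_def by simp
    qed
  qed
  finally show ?thesis unfolding occ_def[of H] by (subst nn_integral_add) auto
qed

text \<open>Iteration of \<open>occ_A\<close>. Of the remainder only nonnegativity is known, hence
  an inequality; equality of total masses in \<open>cs_law\<close> makes up for it.\<close>

lemma occ_ge:
  assumes "m2 H"
  shows "(\<Sum>n. \<integral>\<^sup>+x. phi (x powr \<alpha>) * (A ^^ n) H 0 x \<partial>hm) \<le> occ H"
proof (rule suminf_le_const)
  show "(\<Sum>n<N. \<integral>\<^sup>+x. phi (x powr \<alpha>) * (A ^^ n) H 0 x \<partial>hm) \<le> occ H" for N
  proof -
    have "occ H = (\<Sum>n<N. \<integral>\<^sup>+x. phi (x powr \<alpha>) * (A ^^ n) H 0 x \<partial>hm) + occ ((A ^^ N) H)"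
    proof (induction N)
      case (Suc N)
      then show ?case using occ_A[OF m2_A_pow[OF assms], of N] by (simp add: add.assoc)
    qed simp
    then show ?thesis by (simp add: le_iff_add)
  qed
qed (rule summableI)

lemma phi_K_le:
  assumes f[measurable]: "f \<in> borel_measurable borel" and t: "0 \<le> t"
  shows "(\<integral>\<^sup>+x. phi (x powr \<alpha>) * K t f x \<partial>hm) \<le> (\<integral>\<^sup>+x. f x * phi ((1 + t) * x powr \<alpha>) \<partial>hm)"
proof -
  have [measurable]: "(\<lambda>x. (A ^^ n) (Hf t f) 0 x) \<in> borel_measurable borel" for n
    by (intro m2D[OF m2_A_pow[OF m2_Hf[OF f]]]) auto
  have "(\<integral>\<^sup>+x. phi (x powr \<alpha>) * K t f x \<partial>hm) = (\<integral>\<^sup>+x. (\<Sum>n. phi (x powr \<alpha>) * (A ^^ n) (Hf t f) 0 x) \<partial>hm)"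
  proof (rule nn_integral_cong_AE)
    show "AE x in hm. phi (x powr \<alpha>) * K t f x = (\<Sum>n. phi (x powr \<alpha>) * (A ^^ n) (Hf t f) 0 x)"
      using AE_hm
    proof eventually_elim
      case (elim x)
      then show ?case using K_series[OF f elim, of 0 t] t by (simp add: U_def)
    qed
  qed
  also have "\<dots> = (\<Sum>n. \<integral>\<^sup>+x. phi (x powr \<alpha>) * (A ^^ n) (Hf t f) 0 x \<partial>hm)"
    by (rule nn_integral_suminf) measurable
  also have "\<dots> \<le> occ (Hf t f)" by (rule occ_ge[OF m2_Hf[OF f]])
  also have "\<dots> = (\<integral>\<^sup>+x. f x * phi ((1 + t) * x powr \<alpha>) \<partial>hm)" by (rule occ_Hf[OF f t])
  finally show ?thesis .
qed

end

lemma nn_integral_le_of_tendsto: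
  fixes f :: "nat \<Rightarrow> 'a \<Rightarrow> ennreal"
  assumes "\<And>n. f n \<in> borel_measurable M" "\<And>n. (\<integral>\<^sup>+x. f n x \<partial>M) \<le> C"
    and "AE x in M. (\<lambda>n. f n x) \<longlonglongrightarrow> g x"
  shows "(\<integral>\<^sup>+x. g x \<partial>M) \<le> C"
proof -
  have "(\<integral>\<^sup>+x. g x \<partial>M) = (\<integral>\<^sup>+x. liminf (\<lambda>n. f n x) \<partial>M)"
    using assms(3) by (intro nn_integral_cong_AE) (auto elim!: eventually_mono simp: lim_imp_Liminf)
  also have "\<dots> \<le> liminf (\<lambda>n. \<integral>\<^sup>+x. f n x \<partial>M)" by (rule nn_integral_liminf) (rule assms)
  also have "\<dots> \<le> liminf (\<lambda>n. C)" by (rule Liminf_mono) (simp add: assms)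
  also have "\<dots> = C" by (simp add: Liminf_const)
  finally show ?thesis .
qed

text \<open>For probability measures, the inequality for the complement is the reverse inequality
  for the set.\<close>

lemma prob_space_eqI_le:
  assumes "prob_space M" "prob_space N" "sets M = sets N" "\<And>B. B \<in> sets M \<Longrightarrow> emeasure M B \<le> emeasure N B"
  shows "M = N"
proof (rule measure_eqI[OF assms(3)])
  interpret M: prob_space M by fact
  interpret N: prob_space N by fact
  have sp: "space M = space N" using assms(3) by (rule sets_eq_imp_space_eq)
  fix B assume B: "B \<in> sets M"
  then have B': "B \<in> sets N" using assms(3) by simp
  have C: "space M - B \<in> sets M" using B by auto
  have "measure M B \<le> measure N B" using assms(4)[OF B] by (simp add: M.emeasure_eq_measure N.emeasure_eq_measure)
  moreover have "measure M (space M - B) \<le> measure N (space N - B)"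
    using assms(4)[OF C] sp by (simp add: M.emeasure_eq_measure N.emeasure_eq_measure)
  moreover have "measure M (space M - B) = 1 - measure M B" "measure N (space N - B) = 1 - measure N B"
    using M.prob_compl[OF B] N.prob_compl[OF B'] by auto
  ultimately have "measure M B = measure N B" by simp
  then show "emeasure M B = emeasure N B" by (simp add: M.emeasure_eq_measure N.emeasure_eq_measure)
qed

context fragmentation
begin

section \<open>The logarithmic moment and the mass of the profile\<close>

definition Lmean :: ennreal where
  "Lmean = (\<integral>\<^sup>+z. ennreal (- ln z) \<partial>Th)"

lemma Lmean_eq: "Lmean = (\<integral>\<^sup>+z\<in>{0<..<1}. ennreal (- ln z * h z * z) \<partial>lborel)"
proof -
  have "Lmean = (\<integral>\<^sup>+z. ennreal (h z * z) * indicator {0<..<1} z * ennreal (- ln z) \<partial>lborel)"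
    unfolding Lmean_def by (rule nn_integral_Th) measurable
  also have "\<dots> = (\<integral>\<^sup>+z\<in>{0<..<1}. ennreal (- ln z * h z * z) \<partial>lborel)"
  proof (rule nn_integral_cong)
    fix z :: real
    show "ennreal (h z * z) * indicator {0<..<1} z * ennreal (- ln z) = ennreal (- ln z * h z * z) * indicator {0<..<1} z"
    proof (cases "z \<in> {0<..<1}")
      case True
      then have "0 \<le> h z * z" "0 \<le> - ln z" using h_nonneg by auto
      then have "ennreal (h z * z) * ennreal (- ln z) = ennreal ((h z * z) * - ln z)" by (simp only: ennreal_mult)
      then show ?thesis using True by (simp add: mult_ac)
    qed simp
  qed
  finally show ?thesis .
qed

text \<open>With J distributed as \<open>kap\<close>, the mean of g(I) is computed twice, from I = E
  + J and from J = \<theta>^\<alpha> I in law. The mean of g(J) occurs both times and cancels, being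
  finite for the bounded \<open>g\<close>. What remains is the mean of g(I) - g(\<theta>^\<alpha>
  I), and this difference is at most - \<alpha> ln \<theta>.\<close>

lemma clamp_perp:
  "(\<integral>\<^sup>+j. \<integral>\<^sup>+e. ennreal (clamp_ln n (e + j) - clamp_ln n j) \<partial>Ho \<partial>kap) \<le> ennreal \<alpha> * Lmean"
proof -
  define g where "g = clamp_ln n"
  have [measurable]: "g \<in> borel_measurable borel" by (simp add: g_def)
  define G where "G x = ennreal (g x + real n)" for x
  have [measurable]: "G \<in> borel_measurable borel" unfolding G_def[abs_def] by measurable
  have gb: "0 \<le> g x + real n" "g x + real n \<le> 2 * real n" for x
    using clamp_ln_bounds[where n=n and x=x] by (auto simp: g_def)
  have split: "G y = G x + ennreal (g y - g x)" if "0 < x" "x \<le> y" for x y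
    using clamp_ln_mono[OF that, of n] gb[of x] by (simp add: G_def g_def flip: ennreal_plus)
  have fin: "(\<integral>\<^sup>+j. G j \<partial>kap) \<noteq> \<infinity>"
  proof -
    have "(\<integral>\<^sup>+j. G j \<partial>kap) \<le> (\<integral>\<^sup>+j. ennreal (2 * real n) \<partial>kap)"
      unfolding G_def using gb by (intro nn_integral_mono ennreal_leI) auto
    also have "\<dots> < \<infinity>" using kap.emeasure_space_1 by simp
    finally show ?thesis by simp
  qed
  have "(\<integral>\<^sup>+j. G j \<partial>kap) + (\<integral>\<^sup>+j. \<integral>\<^sup>+e. ennreal (g (e + j) - g j) \<partial>Ho \<partial>kap) =
      (\<integral>\<^sup>+j. \<integral>\<^sup>+e. G j + ennreal (g (e + j) - g j) \<partial>Ho \<partial>kap)"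
    using Ho.emeasure_space_1 by (simp add: nn_integral_add)
  also have "\<dots> = (\<integral>\<^sup>+j. \<integral>\<^sup>+e. G (e + j) \<partial>Ho \<partial>kap)"
  proof (rule nn_integral_cong_AE)
    show "AE j in kap. (\<integral>\<^sup>+e. G j + ennreal (g (e + j) - g j) \<partial>Ho) = (\<integral>\<^sup>+e. G (e + j) \<partial>Ho)"
      using AE_kap
    proof eventually_elim
      case (elim j)
      then show ?case using AE_Ho
        by (intro nn_integral_cong_AE) (auto elim!: eventually_mono intro!: split[symmetric])
    qed
  qed
  also have "\<dots> = (\<integral>\<^sup>+i. G i \<partial>rho)" by (rule rho_kap[symmetric]) measurable
  also have "\<dots> = (\<integral>\<^sup>+z. \<integral>\<^sup>+i. G i \<partial>rho \<partial>Th)" by (simp add: Th.emeasure_space_1[simplified])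
  also have "\<dots> = (\<integral>\<^sup>+z. \<integral>\<^sup>+i. G (z powr \<alpha> * i) + ennreal (g i - g (z powr \<alpha> * i)) \<partial>rho \<partial>Th)"
  proof (rule nn_integral_cong_AE, rule AE_Th_pos)
    fix z :: real assume z: "0 < z" "z < 1"
    have z1: "0 < z powr \<alpha>" "z powr \<alpha> \<le> 1" using z alpha_pos powr_less_mono2[of \<alpha> z 1] by auto
    show "(\<integral>\<^sup>+i. G i \<partial>rho) = (\<integral>\<^sup>+i. G (z powr \<alpha> * i) + ennreal (g i - g (z powr \<alpha> * i)) \<partial>rho)"
    proof (rule nn_integral_cong_AE)
      show "AE i in rho. G i = G (z powr \<alpha> * i) + ennreal (g i - g (z powr \<alpha> * i))"
        using AE_rho
      proof eventually_elim
        case (elim i)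
        then show ?case using z1 by (intro split) (auto simp: mult_le_cancel_right1)
      qed
    qed
  qed
  also have "\<dots> = (\<integral>\<^sup>+j. G j \<partial>kap) + (\<integral>\<^sup>+z. \<integral>\<^sup>+i. ennreal (g i - g (z powr \<alpha> * i)) \<partial>rho \<partial>Th)"
    by (simp add: nn_integral_add nn_integral_kap)
  finally have "(\<integral>\<^sup>+j. \<integral>\<^sup>+e. ennreal (g (e + j) - g j) \<partial>Ho \<partial>kap) =
      (\<integral>\<^sup>+z. \<integral>\<^sup>+i. ennreal (g i - g (z powr \<alpha> * i)) \<partial>rho \<partial>Th)"
    using fin by (simp add: ennreal_add_left_cancel)
  also have "\<dots> \<le> (\<integral>\<^sup>+z. \<integral>\<^sup>+i. ennreal \<alpha> * ennreal (- ln z) \<partial>rho \<partial>Th)"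
  proof (rule nn_integral_mono_AE, rule AE_Th_pos, rule nn_integral_mono_AE)
    fix z :: real assume z: "0 < z" "z < 1"
    have z1: "0 < z powr \<alpha>" "z powr \<alpha> \<le> 1" using z alpha_pos powr_less_mono2[of \<alpha> z 1] by auto
    show "AE i in rho. ennreal (g i - g (z powr \<alpha> * i)) \<le> ennreal \<alpha> * ennreal (- ln z)"
      using AE_rho
    proof eventually_elim
      case (elim i)
      have "g i - g (z powr \<alpha> * i) \<le> ln i - ln (z powr \<alpha> * i)"
        unfolding g_def using z1 elim by (intro clamp_ln_diff) (auto simp: mult_le_cancel_right1)
      also have "\<dots> = \<alpha> * (- ln z)" using z elim by (simp add: ln_mult ln_powr)
      finally show ?case using alpha_pos by (simp add: ennreal_leI flip: ennreal_mult')
    qed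
  qed
  also have "\<dots> = ennreal \<alpha> * Lmean"
    using rho.emeasure_space_1 by (simp add: Lmean_def nn_integral_cmult)
  finally show ?thesis unfolding g_def .
qed

lemma ln_diff_integral:
  assumes "0 < j" "0 < e"
  shows "ennreal (ln (e + j) - ln j) = (\<integral>\<^sup>+s. (if 0 < s \<and> s < e then ennreal (1 / (s + j)) else 0) \<partial>lborel)"
proof -
  have "(\<integral>\<^sup>+s. ennreal (1 / (s + j)) * indicator {0..e} s \<partial>lborel) = ennreal (ln (e + j) - ln (0 + j))"
    using assms by (intro nn_integral_FTC_Icc) (auto intro!: derivative_eq_intros)
  moreover have "(\<integral>\<^sup>+s. ennreal (1 / (s + j)) * indicator {0..e} s \<partial>lborel) = (\<integral>\<^sup>+s. (if 0 < s \<and> s < e then ennreal (1 / (s + j)) else 0) \<partial>lborel)"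
  proof (rule nn_integral_cong_AE)
    show "AE s in lborel. ennreal (1 / (s + j)) * indicator {0..e} s = (if 0 < s \<and> s < e then ennreal (1 / (s + j)) else 0)"
      using AE_lborel_singleton[of 0] AE_lborel_singleton[of e] by eventually_elim (auto simp: indicator_def)
  qed
  ultimately show ?thesis by simp
qed

text \<open>For the exponential law the density at \<open>s\<close> equals the probability of
  exceeding \<open>s\<close>. So 1 / (s + j) may be integrated against the tail, and Fubini's
  theorem turns this into the mean of the primitive.\<close>

lemma hold_log:
  assumes "0 < j"
  shows "(\<integral>\<^sup>+e. ennreal (1 / (e + j)) \<partial>Ho) = (\<integral>\<^sup>+e. ennreal (ln (e + j) - ln j) \<partial>Ho)"
proof -
  interpret lH: pair_sigma_finite lborel Ho ..
  have "(\<integral>\<^sup>+e. ennreal (ln (e + j) - ln j) \<partial>Ho) = (\<integral>\<^sup>+e. \<integral>\<^sup>+s. (if 0 < s \<and> s < e then ennreal (1 / (s + j)) else 0) \<partial>lborel \<partial>Ho)"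
    using AE_Ho by (intro nn_integral_cong_AE) (auto elim!: eventually_mono simp: ln_diff_integral[OF assms])
  also have "\<dots> = (\<integral>\<^sup>+s. \<integral>\<^sup>+e. (if 0 < s \<and> s < e then ennreal (1 / (s + j)) else 0) \<partial>Ho \<partial>lborel)"
    by (rule lH.Fubini') measurable
  also have "\<dots> = (\<integral>\<^sup>+s. ennreal (exp (- s)) * indicator {0<..} s * ennreal (1 / (s + j)) \<partial>lborel)"
  proof (rule nn_integral_cong)
    fix s :: real
    show "(\<integral>\<^sup>+e. (if 0 < s \<and> s < e then ennreal (1 / (s + j)) else 0) \<partial>Ho) = ennreal (exp (- s)) * indicator {0<..} s * ennreal (1 / (s + j))"
    proof (cases "0 < s")
      case True
      then have "(\<integral>\<^sup>+e. (if 0 < s \<and> s < e then ennreal (1 / (s + j)) else 0) \<partial>Ho) = (\<integral>\<^sup>+e. ennreal (1 / (s + j)) * indicator {s<..} e \<partial>Ho)"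
        by (intro nn_integral_cong) (auto simp: indicator_def)
      also have "\<dots> = ennreal (1 / (s + j)) * emeasure Ho {s<..}" by (rule nn_integral_cmult_indicator) simp
      finally show ?thesis using True by (simp add: Ho_tail mult_ac)
    qed simp
  qed
  also have "\<dots> = (\<integral>\<^sup>+e. ennreal (1 / (e + j)) \<partial>Ho)" by (rule nn_integral_Ho[symmetric]) measurable
  finally show ?thesis by simp
qed

text \<open>The left side is the mean of 1 / I. Conditioning on J and \<open>hold_log\<close> make
  it the mean of ln I - ln J, and the bound of \<open>clamp_perp\<close> survives the limit by
  Fatou's lemma.\<close>

lemma phi_mass_le: "(\<integral>\<^sup>+x. phi x \<partial>hm) \<le> ennreal \<alpha> * Lmean"
proof -
  have "(\<integral>\<^sup>+x. phi x \<partial>hm) = (\<integral>\<^sup>+x. phi x * ennreal (1 / x) * ennreal x \<partial>hm)"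
    using AE_hm by (intro nn_integral_cong_AE) (auto elim!: eventually_mono simp: mult.assoc simp flip: ennreal_mult)
  also have "\<dots> = (\<integral>\<^sup>+s. indicator {0<..} s * (phi s * ennreal (1 / s)) \<partial>lborel)"
    by (rule nn_integral_pos_hm[symmetric]) measurable
  also have "\<dots> = (\<integral>\<^sup>+s. phi s * (indicator {0<..} s * ennreal (1 / s)) \<partial>lborel)"
    by (simp add: mult_ac)
  also have "\<dots> = (\<integral>\<^sup>+i. indicator {0<..} i * ennreal (1 / i) \<partial>rho)"
    by (rule rho_density[symmetric]) measurable
  also have "\<dots> = (\<integral>\<^sup>+j. \<integral>\<^sup>+e. indicator {0<..} (e + j) * ennreal (1 / (e + j)) \<partial>Ho \<partial>kap)"
    by (rule rho_kap) measurable
  also have "\<dots> = (\<integral>\<^sup>+j. \<integral>\<^sup>+e. ennreal (ln (e + j) - ln j) \<partial>Ho \<partial>kap)"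
  proof (rule nn_integral_cong_AE)
    show "AE j in kap. (\<integral>\<^sup>+e. indicator {0<..} (e + j) * ennreal (1 / (e + j)) \<partial>Ho) = (\<integral>\<^sup>+e. ennreal (ln (e + j) - ln j) \<partial>Ho)"
      using AE_kap
    proof eventually_elim
      case (elim j)
      then have "(\<integral>\<^sup>+e. indicator {0<..} (e + j) * ennreal (1 / (e + j)) \<partial>Ho) = (\<integral>\<^sup>+e. ennreal (1 / (e + j)) \<partial>Ho)"
        using AE_Ho by (intro nn_integral_cong_AE) (auto elim!: eventually_mono)
      then show ?case using hold_log[OF elim] by simp
    qed
  qed
  also have "\<dots> = (\<integral>\<^sup>+p. ennreal (ln (snd p + fst p) - ln (fst p)) \<partial>(kap \<Otimes>\<^sub>M Ho))"
    by (subst Ho.nn_integral_fst[symmetric]) auto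
  also have "\<dots> \<le> ennreal \<alpha> * Lmean"
  proof (rule nn_integral_le_of_tendsto)
    show "(\<integral>\<^sup>+p. ennreal (clamp_ln n (snd p + fst p) - clamp_ln n (fst p)) \<partial>(kap \<Otimes>\<^sub>M Ho)) \<le> ennreal \<alpha> * Lmean" for n
      using clamp_perp[of n] by (subst Ho.nn_integral_fst[symmetric]) auto
    show "AE p in kap \<Otimes>\<^sub>M Ho. (\<lambda>n. ennreal (clamp_ln n (snd p + fst p) - clamp_ln n (fst p))) \<longlonglongrightarrow> ennreal (ln (snd p + fst p) - ln (fst p))"
      by (intro AE_I2 tendsto_ennrealI tendsto_diff clamp_ln_tendsto)
  qed measurable
  finally show ?thesis .
qed

subsection \<open>Necessity of the logarithmic moment\<close>

lemma nn_integral_mm_scale: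
  assumes [measurable]: "f \<in> borel_measurable borel" and "0 < c"
  shows "(\<integral>\<^sup>+x. ennreal (c\<^sup>2) * f (c * x) \<partial>mm) = (\<integral>\<^sup>+x. f x \<partial>mm)"
proof -
  have "(\<integral>\<^sup>+x. ennreal (c\<^sup>2) * f (c * x) \<partial>mm) = (\<integral>\<^sup>+x. f (c * x) * ennreal ((c * x)\<^sup>2) \<partial>hm)"
    by (subst nn_integral_mm_hm) (auto intro!: nn_integral_cong simp: power_mult_distrib ennreal_mult mult_ac)
  also have "\<dots> = (\<integral>\<^sup>+x. f x * ennreal (x\<^sup>2) \<partial>hm)"
    using assms by (intro nn_integral_hm_scale[where f="\<lambda>x. f x * ennreal (x\<^sup>2)"]) auto
  also have "\<dots> = (\<integral>\<^sup>+x. f x \<partial>mm)" by (rule nn_integral_mm_hm[symmetric]) measurable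
  finally show ?thesis .
qed

lemma DmD:
  assumes "u \<in> Dm"
  shows "u \<in> borel_measurable borel" "AE x in mm. 0 \<le> u x" "(\<integral>\<^sup>+x. ennreal (u x) \<partial>mm) = 1" "integrable mm u"
proof -
  show m: "u \<in> borel_measurable borel" "AE x in mm. 0 \<le> u x" "integrable mm u" using assms by (auto simp: Dm_def)
  have "(\<integral>\<^sup>+x. ennreal (norm (u x)) \<partial>mm) = ennreal (\<integral>x. norm (u x) \<partial>mm)"
    using m(3) by (intro nn_integral_eq_integral) auto
  also have "\<dots> = 1" using assms by (simp add: Dm_def)
  also have "(\<integral>\<^sup>+x. ennreal (norm (u x)) \<partial>mm) = (\<integral>\<^sup>+x. ennreal (u x) \<partial>mm)"
    using m(2) by (intro nn_integral_cong_AE) (auto elim!: eventually_mono)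
  finally show "(\<integral>\<^sup>+x. ennreal (u x) \<partial>mm) = 1" .
qed

lemma jchain_antimono:
  assumes "0 < x" "\<And>i. 0 < fst (\<omega> i) \<and> fst (\<omega> i) < 1" "m \<le> n"
  shows "jchain (x, \<omega>) n \<le> jchain (x, \<omega>) m"
proof (rule lift_Suc_antimono_le[OF _ \<open>m \<le> n\<close>])
  fix n
  have "jchain (x, \<omega>) (Suc n) = jchain (x, \<omega>) n * fst (\<omega> n)" by (simp add: jchain_def)
  also have "\<dots> \<le> jchain (x, \<omega>) n * 1"
    using assms jchain_pos[of x \<omega> n] by (intro mult_left_mono) (auto intro: less_imp_le)
  finally show "jchain (x, \<omega>) (Suc n) \<le> jchain (x, \<omega>) n" by simp
qed

text \<open>States decrease along a path, so the final state is at most the first fragment if the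
  first jump comes in time, and at most \<open>x\<close> otherwise. \<open>G 0 = 0\<close> takes
  care of exploded paths.\<close>

lemma K_le_first_jump:
  fixes G :: "real \<Rightarrow> ennreal"
  assumes [measurable]: "G \<in> borel_measurable borel" and G0: "G 0 = 0" and x: "0 < x"
    and mono: "\<And>a b. 0 < a \<Longrightarrow> a \<le> b \<Longrightarrow> G a \<le> G b"
  shows "K t G x \<le> (\<integral>\<^sup>+z. \<integral>\<^sup>+e. (if e \<le> t * x powr \<alpha> then G (z * x) else G x) \<partial>Ho \<partial>Th)"
proof -
  have "K t G x \<le> (\<integral>\<^sup>+\<omega>. (if snd (\<omega> 0) \<le> t * x powr \<alpha> then G (fst (\<omega> 0) * x) else G x) \<partial>S)"
    unfolding K_def
  proof (rule nn_integral_mono_AE)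
    show "AE \<omega> in S. G (Yproc \<alpha> (x, \<omega>) t) \<le> (if snd (\<omega> 0) \<le> t * x powr \<alpha> then G (fst (\<omega> 0) * x) else G x)"
      using AE_S
    proof eventually_elim
      case (elim \<omega>)
      show ?case
      proof (cases "\<exists>n. t < jtime \<alpha> (x, \<omega>) (Suc n)")
        case False
        then have "Yproc \<alpha> (x, \<omega>) t = 0" unfolding Yproc_def by simp
        then show ?thesis using G0 by simp
      next
        case True
        define N where "N = (LEAST n. t < jtime \<alpha> (x, \<omega>) (Suc n))"
        have N: "t < jtime \<alpha> (x, \<omega>) (Suc N)" unfolding N_def using True by (rule LeastI_ex)
        have Y: "Yproc \<alpha> (x, \<omega>) t = jchain (x, \<omega>) N" using True by (simp add: Yproc_def N_def)
        have pos: "0 < jchain (x, \<omega>) n" for n using elim x by (intro jchain_pos) auto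
        show ?thesis
        proof (cases "snd (\<omega> 0) \<le> t * x powr \<alpha>")
          case True
          have "jtime \<alpha> (x, \<omega>) (Suc 0) \<le> t" using True x by (simp add: jtime_def htime_def field_simps)
          with N have "N \<noteq> 0" by (cases N) auto
          then have "jchain (x, \<omega>) N \<le> jchain (x, \<omega>) 1"
            using elim x by (intro jchain_antimono) auto
          also have "\<dots> = fst (\<omega> 0) * x" by (simp add: jchain_def)
          finally show ?thesis using True mono[OF pos[of N]] by (simp add: Y)
        next
          case False
          have "jchain (x, \<omega>) N \<le> jchain (x, \<omega>) 0" using elim x by (intro jchain_antimono) auto
          then show ?thesis using False mono[OF pos[of N], of x] by (simp add: Y)
        qed
      qed
    qed
  qed
  also have "\<dots> = (\<integral>\<^sup>+z. \<integral>\<^sup>+e. \<integral>\<^sup>+\<omega>. (if e \<le> t * x powr \<alpha> then G (z * x) else G x) \<partial>S \<partial>Ho \<partial>Th)"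
    by (subst nn_integral_shift) (auto cong: if_cong)
  finally show ?thesis by (simp add: S.emeasure_space_1)
qed

text \<open>Self-similarity gives Y(1) the law of Y(0) / c with c = 2^(1/\<alpha>). The outcome is
  that \<open>Lmean\<close>, times the probability of a jump before time 1, is at most ln c, and
  that probability is positive.\<close>

lemma self_similar_imp_log_moment:
  assumes u: "u \<in> Dm"
    and sol: "frag_solution \<alpha> h u (\<lambda>t x. ((1 + t) powr (1 / \<alpha>))\<^sup>2 * u ((1 + t) powr (1 / \<alpha>) * x))"
  shows "Lmean < \<infinity>"
proof -
  note [measurable] = DmD(1)[OF u]
  note u1 = DmD(3)[OF u]
  define c :: real where "c = 2 powr (1 / \<alpha>)"
  have c: "1 \<le> c" using alpha_pos by (simp add: c_def ge_one_powr_ge_zero)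
  have scal: "(\<integral>\<^sup>+x. ennreal (u x) * K 1 f x \<partial>mm) = (\<integral>\<^sup>+x. ennreal (u x) * f (x / c) \<partial>mm)"
    if [measurable]: "f \<in> borel_measurable borel" for f
  proof -
    have "distr (jump_space h u) borel (\<lambda>\<omega>. Yproc \<alpha> \<omega> 1) = density mm (\<lambda>x. ennreal (c\<^sup>2 * u (c * x)))"
      using sol[unfolded frag_solution_def, rule_format, of 1] by (simp add: c_def)
    then have "(\<integral>\<^sup>+x. ennreal (u x) * K 1 f x \<partial>mm) = (\<integral>\<^sup>+x. f x \<partial>density mm (\<lambda>x. ennreal (c\<^sup>2 * u (c * x))))"
      using law_Yproc[of u f 1] by simp
    also have "\<dots> = (\<integral>\<^sup>+x. ennreal (c\<^sup>2 * u (c * x)) * f x \<partial>mm)" by (rule nn_integral_density) measurable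
    also have "\<dots> = (\<integral>\<^sup>+x. ennreal (c\<^sup>2) * (ennreal (u (c * x)) * f (c * x / c)) \<partial>mm)"
      using c by (intro nn_integral_cong) (simp add: ennreal_mult' mult.assoc)
    also have "\<dots> = (\<integral>\<^sup>+x. ennreal (u x) * f (x / c) \<partial>mm)"
      using c by (intro nn_integral_mm_scale[where f="\<lambda>x. ennreal (u x) * f (x / c)"]) auto
    finally show ?thesis .
  qed
  \<comment> \<open>The probability of a jump up to time 1 from state \<open>x\<close>; the factor 1
    keeps the shape of \<open>K_le_first_jump\<close> at t = 1.\<close>
  define P where "P x = emeasure Ho {..1 * x powr \<alpha>}" for x
  have P_eq: "P x = (\<integral>\<^sup>+e. (if e \<le> 1 * x powr \<alpha> then 1 else 0) \<partial>Ho)" for x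
  proof -
    have "(\<integral>\<^sup>+e. (if e \<le> 1 * x powr \<alpha> then 1 else 0) \<partial>Ho) = (\<integral>\<^sup>+e. indicator {..1 * x powr \<alpha>} e \<partial>Ho)"
      by (intro nn_integral_cong) (simp add: indicator_def)
    then show ?thesis by (simp add: P_def)
  qed
  have [measurable]: "P \<in> borel_measurable borel" unfolding P_eq[abs_def] by measurable
  have bound: "(\<integral>\<^sup>+x. ennreal (u x) * (P x * (\<integral>\<^sup>+z. ennreal (clamp_ln n x - clamp_ln n (z * x)) \<partial>Th)) \<partial>mm) \<le> ennreal (ln c)" for n
  proof -
    define g where "g = clamp_ln n"
    have [measurable]: "g \<in> borel_measurable borel" by (simp add: g_def)
    define G where "G x = (if 0 < x then ennreal (g x + real n) else 0)" for x
    have [measurable]: "G \<in> borel_measurable borel" unfolding G_def[abs_def] by measurable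
    have gb: "0 \<le> g x + real n" "g x + real n \<le> 2 * real n" for x
      using clamp_ln_bounds[where n=n and x=x] by (auto simp: g_def)
    have split: "G y = G x + ennreal (g y - g x)" if "0 < x" "x \<le> y" for x y
      using clamp_ln_mono[OF that, of n] gb[of x] that by (simp add: G_def g_def flip: ennreal_plus)
    let ?D = "\<lambda>x. \<integral>\<^sup>+z. ennreal (g x - g (z * x)) \<partial>Th"
    \<comment> \<open>An additive form avoids subtraction of extended values: the mean after unit
      time plus the loss at the first jump is at most the initial value. Time and ratio of that jump
      are independent, hence the product.\<close>
    have key: "K 1 G x + P x * ?D x \<le> G x" if x: "0 < x" for x
    proof -
      have "K 1 G x + P x * ?D x \<le> (\<integral>\<^sup>+z. \<integral>\<^sup>+e. (if e \<le> 1 * x powr \<alpha> then G (z * x) else G x) \<partial>Ho \<partial>Th) +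
          (\<integral>\<^sup>+z. \<integral>\<^sup>+e. (if e \<le> 1 * x powr \<alpha> then 1 else 0) * ennreal (g x - g (z * x)) \<partial>Ho \<partial>Th)"
      proof (rule add_mono)
        show "K 1 G x \<le> (\<integral>\<^sup>+z. \<integral>\<^sup>+e. (if e \<le> 1 * x powr \<alpha> then G (z * x) else G x) \<partial>Ho \<partial>Th)"
        proof (rule K_le_first_jump)
          show "G a \<le> G b" if "0 < a" "a \<le> b" for a b using split[OF that] by simp
        qed (use x in \<open>auto simp: G_def\<close>)
        show "P x * ?D x \<le> (\<integral>\<^sup>+z. \<integral>\<^sup>+e. (if e \<le> 1 * x powr \<alpha> then 1 else 0) * ennreal (g x - g (z * x)) \<partial>Ho \<partial>Th)"
          by (simp add: nn_integral_multc nn_integral_cmult P_eq)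
      qed
      also have "\<dots> = (\<integral>\<^sup>+z. \<integral>\<^sup>+e. (if e \<le> 1 * x powr \<alpha> then G (z * x) else G x) +
          (if e \<le> 1 * x powr \<alpha> then 1 else 0) * ennreal (g x - g (z * x)) \<partial>Ho \<partial>Th)"
        by (simp add: nn_integral_add)
      also have "\<dots> = (\<integral>\<^sup>+z. \<integral>\<^sup>+e. G x \<partial>Ho \<partial>Th)"
      proof (rule nn_integral_cong_AE, rule AE_Th_pos, rule nn_integral_cong)
        fix z e :: real assume z: "0 < z" "z < 1"
        have "G x = G (z * x) + ennreal (g x - g (z * x))"
          using z x by (intro split) (auto simp: mult_le_cancel_right1)
        then show "(if e \<le> 1 * x powr \<alpha> then G (z * x) else G x) + (if e \<le> 1 * x powr \<alpha> then 1 else 0) * ennreal (g x - g (z * x)) = G x"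
          by simp
      qed
      also have "\<dots> = G x" using Ho.emeasure_space_1 Th.emeasure_space_1 by simp
      finally show ?thesis .
    qed
    have "(\<integral>\<^sup>+x. ennreal (u x) * G (x / c) \<partial>mm) + (\<integral>\<^sup>+x. ennreal (u x) * (P x * ?D x) \<partial>mm) =
        (\<integral>\<^sup>+x. ennreal (u x) * K 1 G x \<partial>mm) + (\<integral>\<^sup>+x. ennreal (u x) * (P x * ?D x) \<partial>mm)"
      by (subst scal) auto
    also have "\<dots> = (\<integral>\<^sup>+x. ennreal (u x) * (K 1 G x + P x * ?D x) \<partial>mm)"
      by (simp add: distrib_left nn_integral_add)
    also have "\<dots> \<le> (\<integral>\<^sup>+x. ennreal (u x) * G x \<partial>mm)"
      using AE_mm by (intro nn_integral_mono_AE) (auto elim!: eventually_mono intro!: mult_left_mono key)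
    also have "\<dots> \<le> (\<integral>\<^sup>+x. ennreal (u x) * G (x / c) + ennreal (ln c) * ennreal (u x) \<partial>mm)"
    proof (rule nn_integral_mono_AE)
      show "AE x in mm. ennreal (u x) * G x \<le> ennreal (u x) * G (x / c) + ennreal (ln c) * ennreal (u x)"
        using AE_mm
      proof eventually_elim
        case (elim x)
        have d: "0 < x / c" "x / c \<le> x" using elim c by (auto simp: divide_le_eq mult_le_cancel_left1)
        have "g x - g (x / c) \<le> ln x - ln (x / c)" unfolding g_def by (rule clamp_ln_diff[OF d])
        also have "\<dots> = ln c" using elim c by (simp add: ln_div)
        finally have "G x \<le> G (x / c) + ennreal (ln c)" unfolding split[OF d] by (intro add_mono ennreal_leI) auto
        then have "ennreal (u x) * G x \<le> ennreal (u x) * (G (x / c) + ennreal (ln c))" by (intro mult_left_mono) auto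
        then show ?case by (simp add: distrib_left mult_ac)
      qed
    qed
    also have "\<dots> = (\<integral>\<^sup>+x. ennreal (u x) * G (x / c) \<partial>mm) + ennreal (ln c)"
      using u1 by (simp add: nn_integral_add nn_integral_cmult)
    finally have le: "(\<integral>\<^sup>+x. ennreal (u x) * G (x / c) \<partial>mm) + (\<integral>\<^sup>+x. ennreal (u x) * (P x * ?D x) \<partial>mm) \<le>
      (\<integral>\<^sup>+x. ennreal (u x) * G (x / c) \<partial>mm) + ennreal (ln c)" .
    have "(\<integral>\<^sup>+x. ennreal (u x) * G (x / c) \<partial>mm) \<le> (\<integral>\<^sup>+x. ennreal (u x) * ennreal (2 * real n) \<partial>mm)"
      using gb by (intro nn_integral_mono mult_left_mono) (auto simp: G_def ennreal_leI)
    also have "\<dots> < \<infinity>" using u1 by (simp add: nn_integral_multc)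
    finally have "(\<integral>\<^sup>+x. ennreal (u x) * G (x / c) \<partial>mm) \<noteq> top" by simp
    then show ?thesis using le unfolding g_def by (simp add: ennreal_add_left_cancel_le)
  qed
  have "(\<integral>\<^sup>+x. ennreal (u x) * (P x * Lmean) \<partial>mm) \<le> ennreal (ln c)"
  proof -
    interpret N: sigma_finite_measure mm unfolding mm_def
      by (subst sigma_finite_measure.sigma_finite_iff_density_finite) (auto simp: lborel.sigma_finite_measure_axioms indicator_def ennreal_mult_less_top)
    interpret NT: pair_sigma_finite mm Th ..
    have "(\<integral>\<^sup>+x. ennreal (u x) * (P x * Lmean) \<partial>mm) = (\<integral>\<^sup>+p. ennreal (u (fst p)) * (P (fst p) * ennreal (- ln (snd p))) \<partial>(mm \<Otimes>\<^sub>M Th))"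
      by (subst Th.nn_integral_fst[symmetric]) (auto simp: Lmean_def nn_integral_cmult)
    also have "\<dots> \<le> ennreal (ln c)"
    proof (rule nn_integral_le_of_tendsto)
      show "(\<integral>\<^sup>+p. ennreal (u (fst p)) * (P (fst p) * ennreal (clamp_ln n (fst p) - clamp_ln n (snd p * fst p))) \<partial>(mm \<Otimes>\<^sub>M Th)) \<le> ennreal (ln c)" for n
        using bound[of n] by (subst Th.nn_integral_fst[symmetric]) (auto simp: nn_integral_cmult)
      have "AE p in mm \<Otimes>\<^sub>M Th. 0 < fst p \<and> 0 < snd p"
      proof (rule NT.AE_pair_measure)
        show "AE x in mm. AE y in Th. 0 < fst (x, y) \<and> 0 < snd (x, y)"
          using AE_mm
        proof eventually_elim
          case (elim x) then show ?case by (intro AE_Th_pos) auto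
        qed
      qed measurable
      then show "AE p in mm \<Otimes>\<^sub>M Th. (\<lambda>n. ennreal (u (fst p)) * (P (fst p) * ennreal (clamp_ln n (fst p) - clamp_ln n (snd p * fst p))))
          \<longlonglongrightarrow> ennreal (u (fst p)) * (P (fst p) * ennreal (- ln (snd p)))"
      proof eventually_elim
        case (elim p)
        have "P (fst p) \<le> 1" unfolding P_def by (rule Ho.emeasure_le_1)
        then have "P (fst p) < top" by (rule order_le_less_trans) simp
        moreover have "- ln (snd p) = ln (fst p) - ln (snd p * fst p)" using elim by (simp add: ln_mult)
        ultimately show ?case
          by (auto intro!: ennreal_tendsto_cmult tendsto_ennrealI tendsto_diff clamp_ln_tendsto)
      qed
    qed measurable
    finally show ?thesis .
  qed
  then have le: "Lmean * (\<integral>\<^sup>+x. ennreal (u x) * P x \<partial>mm) \<le> ennreal (ln c)"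
    by (subst nn_integral_cmult[symmetric]) (auto simp: mult_ac)
  have "(\<integral>\<^sup>+x. ennreal (u x) * P x \<partial>mm) \<noteq> 0"
  proof
    assume "(\<integral>\<^sup>+x. ennreal (u x) * P x \<partial>mm) = 0"
    then have "AE x in mm. ennreal (u x) * P x = 0" by (subst (asm) nn_integral_0_iff_AE) auto
    with AE_mm have "AE x in mm. ennreal (u x) = 0"
      by eventually_elim (auto simp: P_def Ho_atMost_pos)
    then have "(\<integral>\<^sup>+x. ennreal (u x) \<partial>mm) = 0" by (subst nn_integral_0_iff_AE) auto
    with u1 show False by simp
  qed
  with le show ?thesis
    by (metis ennreal_mult_eq_top_iff ennreal_neq_top infinity_ennreal_def less_top top.extremum_uniqueI)
qed


subsection \<open>The self-similar solution\<close>

definition Zn :: real where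
  "Zn = enn2real (\<integral>\<^sup>+x. phi x \<partial>hm)"

text \<open>The factor \<alpha> compensates the substitution of x^\<alpha> in dx / x, and x^2 is the
  density of m with respect to dx / x; so \<open>Zn\<close> normalises the mass to 1. If the mass of
  \<open>phi\<close> is infinite, \<open>Zn\<close> is 0 and the formula degenerates to the zero
  function.\<close>

definition us :: "real \<Rightarrow> real" where
  "us x = (if 0 < x then \<alpha> * enn2real (phi (x powr \<alpha>)) / (Zn * x\<^sup>2) else 0)"

definition cs :: "real \<Rightarrow> real \<Rightarrow> real" where
  "cs t x = ((1 + t) powr (1 / \<alpha>))\<^sup>2 * us ((1 + t) powr (1 / \<alpha>) * x)"

lemma measurable_us [measurable]: "us \<in> borel_measurable borel"
  unfolding us_def[abs_def] by measurable

lemma measurable_cs [measurable]: "cs t \<in> borel_measurable borel"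
  unfolding cs_def[abs_def] by measurable

lemma phi_enn2real: "ennreal (enn2real (phi s)) = phi s"
  using phi_le_1[of s] by (intro ennreal_enn2real) (auto simp: less_top[symmetric] top_unique)

lemma Zn:
  assumes "Lmean < \<infinity>"
  shows "(\<integral>\<^sup>+x. phi x \<partial>hm) = ennreal Zn" "0 < Zn"
proof -
  have "(\<integral>\<^sup>+x. phi x \<partial>hm) \<le> ennreal \<alpha> * Lmean" by (rule phi_mass_le)
  also have "\<dots> < \<infinity>" using assms by (simp add: ennreal_mult_less_top)
  finally show 1: "(\<integral>\<^sup>+x. phi x \<partial>hm) = ennreal Zn" unfolding Zn_def by simp
  have "(\<integral>\<^sup>+x. phi x \<partial>hm) \<noteq> 0"
  proof
    assume "(\<integral>\<^sup>+x. phi x \<partial>hm) = 0"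
    then have "AE x in hm. phi x = 0" by (subst (asm) nn_integral_0_iff_AE) auto
    with AE_hm have "AE x in hm. False" by eventually_elim (use phi_pos in fastforce)
    then have "AE x::real in lborel. False" unfolding hm_def by (subst (asm) AE_distr_iff) auto
    then have "emeasure lborel (UNIV :: real set) = 0" by (simp add: AE_iff_null null_sets_def)
    then show False by simp
  qed
  then have "ennreal Zn \<noteq> 0" unfolding 1 .
  then show "0 < Zn" by (simp add: ennreal_eq_0_iff)
qed

lemma cs_eq:
  assumes "0 < x" "0 \<le> t"
  shows "cs t x = \<alpha> * enn2real (phi ((1 + t) * x powr \<alpha>)) / (Zn * x\<^sup>2)"
proof -
  define c where "c = (1 + t) powr (1 / \<alpha>)"
  have c: "0 < c" using assms by (simp add: c_def)
  have "(c * x) powr \<alpha> = (1 + t) * x powr \<alpha>"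
    using assms alpha_pos c by (simp add: powr_mult) (simp add: c_def powr_powr)
  then show ?thesis
    using assms c by (simp add: cs_def us_def c_def[symmetric] power_mult_distrib divide_simps)
qed

lemma nn_integral_cs:
  assumes L: "Lmean < \<infinity>" and [measurable]: "F \<in> borel_measurable borel" and t: "0 \<le> t"
  shows "(\<integral>\<^sup>+x. ennreal (cs t x) * F x \<partial>mm) = ennreal (\<alpha> / Zn) * (\<integral>\<^sup>+x. F x * phi ((1 + t) * x powr \<alpha>) \<partial>hm)"
proof -
  have "(\<integral>\<^sup>+x. ennreal (cs t x) * F x \<partial>mm) = (\<integral>\<^sup>+x. ennreal (cs t x) * F x * ennreal (x\<^sup>2) \<partial>hm)"
    by (rule nn_integral_mm_hm) measurable
  also have "\<dots> = (\<integral>\<^sup>+x. ennreal (\<alpha> / Zn) * (F x * phi ((1 + t) * x powr \<alpha>)) \<partial>hm)"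
  proof (rule nn_integral_cong_AE)
    show "AE x in hm. ennreal (cs t x) * F x * ennreal (x\<^sup>2) = ennreal (\<alpha> / Zn) * (F x * phi ((1 + t) * x powr \<alpha>))"
      using AE_hm
    proof eventually_elim
      case (elim x)
      let ?p = "enn2real (phi ((1 + t) * x powr \<alpha>))"
      have nn: "0 \<le> cs t x" using cs_eq[OF elim t] alpha_pos Zn(2)[OF L] by simp
      have "cs t x * x\<^sup>2 = \<alpha> / Zn * ?p" using cs_eq[OF elim t] elim by (simp add: field_simps)
      then have "ennreal (cs t x) * ennreal (x\<^sup>2) = ennreal (\<alpha> / Zn) * ennreal ?p"
        using nn alpha_pos Zn(2)[OF L] by (simp flip: ennreal_mult)
      then show ?case by (simp add: phi_enn2real mult_ac)
    qed
  qed
  also have "\<dots> = ennreal (\<alpha> / Zn) * (\<integral>\<^sup>+x. F x * phi ((1 + t) * x powr \<alpha>) \<partial>hm)"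
    by (rule nn_integral_cmult) measurable
  finally show ?thesis .
qed

lemma cs_mass:
  assumes L: "Lmean < \<infinity>" and t: "0 \<le> t"
  shows "(\<integral>\<^sup>+x. ennreal (cs t x) \<partial>mm) = 1"
proof -
  have "ennreal \<alpha> * (\<integral>\<^sup>+x. phi ((1 + t) * x powr \<alpha>) \<partial>hm) = (\<integral>\<^sup>+x. phi ((1 + t) * x) \<partial>hm)"
    using alpha_pos by (intro nn_integral_hm_powr[where f="\<lambda>x. phi ((1 + t) * x)"]) auto
  also have "\<dots> = ennreal Zn"
    using nn_integral_hm_scale[of phi "1 + t"] t Zn(1)[OF L] by simp
  finally have 1: "ennreal \<alpha> * (\<integral>\<^sup>+x. phi ((1 + t) * x powr \<alpha>) \<partial>hm) = ennreal Zn" .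
  have "(\<integral>\<^sup>+x. ennreal (cs t x) \<partial>mm) = ennreal (\<alpha> / Zn) * (\<integral>\<^sup>+x. phi ((1 + t) * x powr \<alpha>) \<partial>hm)"
    using nn_integral_cs[OF L, of "\<lambda>_. 1" t] t by simp
  also have "\<dots> = ennreal (1 / Zn) * (ennreal \<alpha> * (\<integral>\<^sup>+x. phi ((1 + t) * x powr \<alpha>) \<partial>hm))"
    using alpha_pos Zn(2)[OF L] by (simp add: mult.assoc[symmetric] flip: ennreal_mult)
  also have "\<dots> = 1" unfolding 1 using Zn(2)[OF L] by (simp flip: ennreal_mult)
  finally show ?thesis .
qed

lemma cs_nonneg: assumes "Lmean < \<infinity>" "0 \<le> t" shows "0 \<le> cs t x"
  using alpha_pos Zn(2)[OF assms(1)] by (auto simp: cs_def us_def)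

lemma DmI:
  assumes [measurable]: "f \<in> borel_measurable borel" and nn: "\<And>x. 0 \<le> f x" and m: "(\<integral>\<^sup>+x. ennreal (f x) \<partial>mm) = 1"
  shows "f \<in> Dm"
proof -
  have i: "integrable mm f" by (rule integrableI_nonneg) (auto simp: nn m)
  have "(\<integral>x. f x \<partial>mm) = 1"
    using m nn by (subst integral_eq_nn_integral) auto
  then show ?thesis using i nn by (auto simp: Dm_def)
qed

lemma cs_Dm: "Lmean < \<infinity> \<Longrightarrow> 0 \<le> t \<Longrightarrow> cs t \<in> Dm"
  by (intro DmI cs_nonneg cs_mass) auto

lemma us_cs: "us = cs 0"
  by (rule ext) (simp add: cs_def)

lemma us_Dm: "Lmean < \<infinity> \<Longrightarrow> us \<in> Dm"
  unfolding us_cs by (rule cs_Dm) auto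

lemma us_pos: assumes "Lmean < \<infinity>" "0 < x" shows "0 < us x"
proof -
  have "0 < ennreal (enn2real (phi (x powr \<alpha>)))" unfolding phi_enn2real using assms(2) by (intro phi_pos) simp
  then show ?thesis using alpha_pos Zn(2)[OF assms(1)] assms(2) by (simp add: us_def)
qed

lemma prob_space_density_Dm:
  assumes "f \<in> Dm" shows "prob_space (density mm (\<lambda>x. ennreal (f x)))"
  using DmD[OF assms] by (intro prob_spaceI) (simp add: emeasure_density)

lemma prob_space_law:
  assumes "c0 \<in> Dm" "0 \<le> t"
  shows "prob_space (distr (jump_space h c0) borel (\<lambda>\<omega>. Yproc \<alpha> \<omega> t))"
proof
  note [measurable] = DmD(1)[OF assms(1)]
  have "emeasure (distr (jump_space h c0) borel (\<lambda>\<omega>. Yproc \<alpha> \<omega> t)) UNIV =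
      (\<integral>\<^sup>+y. 1 \<partial>distr (jump_space h c0) borel (\<lambda>\<omega>. Yproc \<alpha> \<omega> t))" by simp
  also have "\<dots> = (\<integral>\<^sup>+x. ennreal (c0 x) * K t (\<lambda>_. 1) x \<partial>mm)" by (rule law_Yproc) measurable
  also have "\<dots> = (\<integral>\<^sup>+x. ennreal (c0 x) \<partial>mm)" by (simp add: K_def S.emeasure_space_1)
  finally show "emeasure (distr (jump_space h c0) borel (\<lambda>\<omega>. Yproc \<alpha> \<omega> t))
      (space (distr (jump_space h c0) borel (\<lambda>\<omega>. Yproc \<alpha> \<omega> t))) = 1"
    using DmD(3)[OF assms(1)] by simp
qed

lemma cs_law:
  assumes L: "Lmean < \<infinity>" and t: "0 \<le> t"
  shows "distr (jump_space h us) borel (\<lambda>\<omega>. Yproc \<alpha> \<omega> t) = density mm (\<lambda>x. ennreal (cs t x))"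
proof (rule prob_space_eqI_le)
  show "prob_space (distr (jump_space h us) borel (\<lambda>\<omega>. Yproc \<alpha> \<omega> t))"
    by (rule prob_space_law[OF us_Dm[OF L] t])
  show "prob_space (density mm (\<lambda>x. ennreal (cs t x)))"
    by (rule prob_space_density_Dm[OF cs_Dm[OF L t]])
  fix B assume "B \<in> sets (distr (jump_space h us) borel (\<lambda>\<omega>. Yproc \<alpha> \<omega> t))"
  then have [measurable]: "B \<in> sets borel" by simp
  have "emeasure (distr (jump_space h us) borel (\<lambda>\<omega>. Yproc \<alpha> \<omega> t)) B =
      (\<integral>\<^sup>+y. indicator B y \<partial>distr (jump_space h us) borel (\<lambda>\<omega>. Yproc \<alpha> \<omega> t))" by simp
  also have "\<dots> = (\<integral>\<^sup>+x. ennreal (cs 0 x) * K t (indicator B) x \<partial>mm)"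
    unfolding us_cs[symmetric] by (rule law_Yproc) measurable
  also have "\<dots> = ennreal (\<alpha> / Zn) * (\<integral>\<^sup>+x. K t (indicator B) x * phi ((1 + 0) * x powr \<alpha>) \<partial>hm)"
    by (rule nn_integral_cs[OF L]) auto
  also have "\<dots> = ennreal (\<alpha> / Zn) * (\<integral>\<^sup>+x. phi (x powr \<alpha>) * K t (indicator B) x \<partial>hm)"
    by (simp add: mult_ac)
  also have "\<dots> \<le> ennreal (\<alpha> / Zn) * (\<integral>\<^sup>+x. indicator B x * phi ((1 + t) * x powr \<alpha>) \<partial>hm)"
    by (intro mult_left_mono phi_K_le t) auto
  also have "\<dots> = (\<integral>\<^sup>+x. ennreal (cs t x) * indicator B x \<partial>mm)"
    by (rule nn_integral_cs[OF L, symmetric]) (use t in auto)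
  also have "\<dots> = emeasure (density mm (\<lambda>x. ennreal (cs t x))) B"
    by (rule emeasure_density[symmetric]) auto
  finally show "emeasure (distr (jump_space h us) borel (\<lambda>\<omega>. Yproc \<alpha> \<omega> t)) B \<le> emeasure (density mm (\<lambda>x. ennreal (cs t x))) B" .
qed simp

lemma cs_solution: "Lmean < \<infinity> \<Longrightarrow> frag_solution \<alpha> h us cs"
  by (simp add: frag_solution_def cs_Dm cs_law)

lemma us_K:
  assumes L: "Lmean < \<infinity>" and t: "0 \<le> t" and [measurable]: "f \<in> borel_measurable borel"
  shows "(\<integral>\<^sup>+x. ennreal (us x) * K t f x \<partial>mm) = (\<integral>\<^sup>+x. ennreal (cs t x) * f x \<partial>mm)"
  using law_Yproc[of us f t] cs_law[OF L t] by (simp add: nn_integral_density)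

end

text \<open>A cheap substitute for the Lebesgue density theorem: cover the set by a slightly larger open
  set and look at the components of the latter.\<close>
lemma exists_dense_interval:
  fixes B :: "real set"
  assumes B: "B \<in> sets borel" "0 < emeasure lborel B" "emeasure lborel B < \<infinity>" and i: "0 < i" "i < 1"
  shows "\<exists>p w. 0 < w \<and> emeasure lborel ({p..p + w} - B) \<le> ennreal (i * w)"
proof -
  obtain m where m: "emeasure lborel B = ennreal m" "0 < m"
    using B by (cases "emeasure lborel B") auto
  obtain U where U: "open U" "B \<subseteq> U" "emeasure lborel (U - B) < ennreal (i * m)"
    using outer_regular_lborel[OF B(1), of "i * m"] i m by auto
  have op: "open C" if "C \<in> components U" for C using that U(1) by (rule open_components[rotated])
  have cnt: "countable (components U)"
    using op pairwise_disjoint_components[of U]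
    by (intro countable_disjoint_open_subsets) (auto simp: pairwise_def disjnt_def)
  have dis: "disjoint_family_on (\<lambda>C. C) (components U)"
    using pairwise_disjoint_components[of U] by (auto simp: disjoint_family_on_def pairwise_def)
  have dis': "disjoint_family_on (\<lambda>C. C - B) (components U)"
    using dis by (fastforce simp: disjoint_family_on_def)
  have sumU: "emeasure lborel U = (\<integral>\<^sup>+C. emeasure lborel C \<partial>count_space (components U))"
    using emeasure_UN_countable[OF _ cnt dis, of lborel] op by simp
  have "emeasure lborel (\<Union>C\<in>components U. C - B) = (\<integral>\<^sup>+C. emeasure lborel (C - B) \<partial>count_space (components U))"
    using op B(1) by (intro emeasure_UN_countable cnt dis') auto
  moreover have "(\<Union>C\<in>components U. C - B) = U - B" using Union_components[of U] by blast
  ultimately have sumUB: "emeasure lborel (U - B) = (\<integral>\<^sup>+C. emeasure lborel (C - B) \<partial>count_space (components U))" by simp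
  \<comment> \<open>If every component missed \<open>B\<close> by at least the fraction
    \<open>i\<close>, summation over the countably many components would give |U - B| \<ge> i |U|
    \<ge> i |B|, against the choice of \<open>U\<close>.\<close>
  have "\<exists>C\<in>components U. emeasure lborel (C - B) < ennreal i * emeasure lborel C"
  proof (rule ccontr)
    assume "\<not> ?thesis"
    then have "(\<integral>\<^sup>+C. ennreal i * emeasure lborel C \<partial>count_space (components U)) \<le> emeasure lborel (U - B)"
      unfolding sumUB by (intro nn_integral_mono) (auto simp: not_less)
    then have "ennreal i * emeasure lborel U \<le> emeasure lborel (U - B)"
      unfolding sumU by (subst (asm) nn_integral_cmult) auto
    also have "\<dots> < ennreal (i * m)" by (rule U(3))
    also have "\<dots> = ennreal i * emeasure lborel B" using i m by (simp add: ennreal_mult)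
    also have "\<dots> \<le> ennreal i * emeasure lborel U" using U by (intro mult_left_mono emeasure_mono) auto
    finally show False by simp
  qed
  then obtain C where C: "C \<in> components U" "emeasure lborel (C - B) < ennreal i * emeasure lborel C" by auto
  have "emeasure lborel U = emeasure lborel (U - B) + emeasure lborel B"
    using U B by (subst plus_emeasure) (auto simp: Un_absorb2)
  also have "\<dots> < \<infinity>" using U(3) m by (auto simp: less_top[symmetric])
  finally have Ufin: "emeasure lborel U < \<infinity>" .
  have "emeasure lborel C \<le> emeasure lborel U"
    using in_components_subset[OF C(1)] U(1) by (intro emeasure_mono) auto
  then have Cfin: "emeasure lborel C < \<infinity>" using Ufin by (rule order_le_less_trans)
  have Cpos: "0 < emeasure lborel C" using C(2) by (auto simp: zero_less_iff_neq_zero)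
  \<comment> \<open>The unbounded shapes of a connected set are excluded by their infinite measure,
    which leaves a bounded interval.\<close>
  have inf: "emeasure lborel {..(b::real)} = \<infinity>" "emeasure lborel {..<b} = \<infinity>" "emeasure lborel {b..} = \<infinity>" "emeasure lborel {b<..} = \<infinity>" for b :: real
  proof -
    have big: "ennreal (real n) \<le> emeasure lborel D" if "{c..c + real n} \<subseteq> D" "D \<in> sets borel" for n c D
      using emeasure_mono[OF that(1), of lborel] that(2) by simp
    have *: "emeasure lborel D = \<infinity>" if D: "\<And>n. \<exists>c. {c..c + real n} \<subseteq> D" "D \<in> sets borel" for D
    proof (rule ccontr)
      assume "emeasure lborel D \<noteq> \<infinity>"
      then obtain r where r: "emeasure lborel D = ennreal r" "0 \<le> r" by (cases "emeasure lborel D") auto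
      obtain n where "r < real n" using reals_Archimedean2 by blast
      moreover obtain c where "{c..c + real n} \<subseteq> D" using D(1) by blast
      then have "ennreal (real n) \<le> ennreal r" using big[OF _ D(2)] r by auto
      ultimately show False using r by simp
    qed
    show "emeasure lborel {..b} = \<infinity>"
    proof (rule *)
      show "\<exists>c. {c..c + real n} \<subseteq> {..b}" for n by (rule exI[of _ "b - real n"]) auto
    qed simp
    show "emeasure lborel {..<b} = \<infinity>"
    proof (rule *)
      show "\<exists>c. {c..c + real n} \<subseteq> {..<b}" for n by (rule exI[of _ "b - real n - 1"]) auto
    qed simp
    show "emeasure lborel {b..} = \<infinity>"
      by (intro *) (auto intro!: exI[of _ b])
    show "emeasure lborel {b<..} = \<infinity>"
      by (intro *) (auto intro!: exI[of _ "b + 1"])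
  qed
  have "\<And>a b x. a \<in> C \<Longrightarrow> b \<in> C \<Longrightarrow> a \<le> x \<Longrightarrow> x \<le> b \<Longrightarrow> x \<in> C"
    using connected_contains_Icc[OF in_components_connected[OF C(1)]] by (meson atLeastAtMost_iff subsetD)
  then have "\<exists>a b. C = {} \<or> C = UNIV \<or> C = {..<b} \<or> C = {..b} \<or> C = {a<..} \<or> C = {a..} \<or>
    C = {a<..<b} \<or> C = {a<..b} \<or> C = {a..<b} \<or> C = {a..b}"
    by (rule interval_cases)
  then obtain a b where "C = {a<..<b} \<or> C = {a<..b} \<or> C = {a..<b} \<or> C = {a..b}"
    using Cpos Cfin inf by auto
  then have ab: "{a<..<b} \<subseteq> C" "C \<subseteq> {a..b}" by auto
  have "a < b"
  proof (rule ccontr)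
    assume "\<not> a < b"
    have "emeasure lborel C \<le> emeasure lborel {a..b}" by (rule emeasure_mono[OF ab(2)]) simp
    also have "\<dots> = 0" using \<open>\<not> a < b\<close> by (cases "a = b") auto
    finally show False using Cpos by simp
  qed
  have "emeasure lborel ({a..a + (b - a)} - B) \<le> emeasure lborel ((C - B) \<union> {a, b})"
    using ab B(1) op[OF C(1)] by (intro emeasure_mono) auto
  also have "\<dots> \<le> emeasure lborel (C - B) + emeasure lborel {a, b}"
    using B(1) op[OF C(1)] by (intro emeasure_subadditive) auto
  also have "emeasure lborel {a, b} = 0" by (intro emeasure_lborel_countable) auto
  also have "emeasure lborel (C - B) + 0 \<le> ennreal i * emeasure lborel C" using C(2) by simp
  also have "\<dots> \<le> ennreal i * emeasure lborel {a..b}" using ab by (intro mult_left_mono emeasure_mono) auto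
  also have "\<dots> = ennreal (i * (b - a))" using \<open>a < b\<close> i by (simp add: ennreal_mult)
  finally show ?thesis using \<open>a < b\<close> by (intro exI[of _ a] exI[of _ "b - a"]) auto
qed

context fragmentation
begin

subsection \<open>Minorization\<close>

text \<open>The law of -ln \<theta> dominates \<delta> times Lebesgue measure on \<open>B\<close>.
  The form with test functions applies directly to the function z -> K s f (z x).\<close>

abbreviation law_above :: "real \<Rightarrow> real set \<Rightarrow> bool" where
  "law_above \<delta> B \<equiv> \<forall>F\<in>borel_measurable borel. ennreal \<delta> * (\<integral>\<^sup>+v. indicator B v * F (exp (- v)) \<partial>lborel) \<le> (\<integral>\<^sup>+z. F z \<partial>Th)"

abbreviation win :: "real \<Rightarrow> real \<Rightarrow> (real \<Rightarrow> ennreal) \<Rightarrow> ennreal" where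
  "win v w f \<equiv> \<integral>\<^sup>+s. indicator {v..v + w} s * f (exp s) \<partial>lborel"

text \<open>The density \<open>kd\<close> is at least 1 / (n + 1) on some bounded set of positive
  measure, and this set almost fills some interval. The defect 1/20 is small enough for the two
  reflected copies in \<open>overlap_reflected\<close> and for the quarter windows in
  \<open>window_mass\<close>.\<close>

lemma theta_interval:
  "\<exists>\<delta> p w B. 0 < \<delta> \<and> 0 < w \<and> B \<in> sets borel \<and> B \<subseteq> {p..p + w} \<and>
    emeasure lborel ({p..p + w} - B) \<le> ennreal (w / 20) \<and>
    (law_above \<delta> B)"
proof -
  define B where "B n = {v. - real n \<le> v \<and> v \<le> real n \<and> ennreal (1 / real (Suc n)) \<le> kd v}" for n
  have Bm[measurable]: "B n \<in> sets borel" for n unfolding B_def by measurable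
  have "\<exists>n. emeasure lborel (B n) \<noteq> 0"
  proof (rule ccontr)
    assume "\<not> ?thesis"
    then have "AE v in lborel. v \<notin> B n" for n by (intro AE_not_in) (auto simp: null_sets_def)
    then have "AE v in lborel. \<forall>n. v \<notin> B n" by (simp add: AE_all_countable)
    then have "AE v in lborel. kd v = 0"
    proof eventually_elim
      case (elim v)
      show ?case
      proof (rule ccontr)
        assume "kd v \<noteq> 0"
        then have "0 < min 1 (kd v)" by (simp add: zero_less_iff_neq_zero)
        then obtain r' where r': "0 < r'" "r' < min 1 (kd v)" using dense by blast
        then obtain r where "r' = ennreal r" by (cases r') auto
        with r' have r: "0 < r" "ennreal r < min 1 (kd v)" by auto
        obtain n where n: "inverse (real (Suc n)) < r" using reals_Archimedean r(1) by blast
        obtain k where k: "\<bar>v\<bar> \<le> real k" using real_arch_simple by blast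
        define N where "N = max n k"
        have "1 / real (Suc N) \<le> inverse (real (Suc n))" by (simp add: N_def field_simps)
        then have "ennreal (1 / real (Suc N)) \<le> ennreal r" using n by (intro ennreal_leI) simp
        also have "\<dots> \<le> kd v" using r(2) by (simp add: less_imp_le)
        finally have "v \<in> B N" using k by (auto simp: B_def N_def)
        then show False using elim by auto
      qed
    qed
    then have "(\<integral>\<^sup>+v. kd v \<partial>lborel) = 0" by (subst nn_integral_0_iff_AE) auto
    moreover have "(\<integral>\<^sup>+v. kd v \<partial>lborel) = 1"
      using nn_integral_Th_log[of "\<lambda>_. 1"] Th.emeasure_space_1 by simp
    ultimately show False by simp
  qed
  then obtain n where n: "emeasure lborel (B n) \<noteq> 0" by auto
  have "emeasure lborel (B n) \<le> emeasure lborel {- real n..real n}" by (intro emeasure_mono) (auto simp: B_def)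
  then have fin: "emeasure lborel (B n) < \<infinity>" by (rule order_le_less_trans) simp
  obtain p w where pw: "0 < w" "emeasure lborel ({p..p + w} - B n) \<le> ennreal (1 / 20 * w)"
    using exists_dense_interval[OF Bm _ fin, of "1/20"] n by (auto simp: zero_less_iff_neq_zero)
  show ?thesis
  proof (intro exI conjI ballI)
    show "0 < 1 / real (Suc n)" by simp
    show "0 < w" by (rule pw)
    show "B n \<inter> {p..p + w} \<in> sets borel" by measurable
    have "{p..p + w} - B n \<inter> {p..p + w} = {p..p + w} - B n" by auto
    then show "emeasure lborel ({p..p + w} - B n \<inter> {p..p + w}) \<le> ennreal (w / 20)" using pw by simp
    fix F :: "real \<Rightarrow> ennreal" assume [measurable]: "F \<in> borel_measurable borel"
    have "ennreal (1 / real (Suc n)) * (\<integral>\<^sup>+v. indicator (B n \<inter> {p..p + w}) v * F (exp (- v)) \<partial>lborel) =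
      (\<integral>\<^sup>+v. ennreal (1 / real (Suc n)) * (indicator (B n \<inter> {p..p + w}) v * F (exp (- v))) \<partial>lborel)"
      by (rule nn_integral_cmult[symmetric]) measurable
    also have "\<dots> \<le> (\<integral>\<^sup>+v. kd v * F (exp (- v)) \<partial>lborel)"
      by (intro nn_integral_mono) (auto simp: indicator_def B_def intro!: mult_right_mono)
    also have "\<dots> = (\<integral>\<^sup>+z. F z \<partial>Th)" by (rule nn_integral_Th_log[symmetric]) measurable
    finally show "ennreal (1 / real (Suc n)) * (\<integral>\<^sup>+v. indicator (B n \<inter> {p..p + w}) v * F (exp (- v)) \<partial>lborel) \<le> (\<integral>\<^sup>+z. F z \<partial>Th)" .
  qed auto
qed

lemma K_no_jump:
  assumes f: "f \<in> borel_measurable borel" and "0 < x" "0 \<le> t"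
  shows "ennreal (exp (- (t * x powr \<alpha>))) * f x \<le> K t f x"
proof -
  have "K t f x = Hf t f 0 x + A (U t f) 0 x"
    using K_series[OF f, of x 0 t] U_renewal[OF f, of t 0 x] assms by simp
  moreover have "Hf t f 0 x = ennreal (exp (- (t * x powr \<alpha>))) * f x" using assms by (simp add: Hf_def)
  ultimately show ?thesis by (simp add: add_increasing2)
qed

text \<open>The first jump is placed in (0, \<tau>/2], so that at least \<tau>/2 of the time is
  left. In the constant, \<tau>/2 is the length of that interval, exp (\<alpha> a) bounds the jump
  rate exp (\<alpha> x) from below, and the last factor bounds the probability of no earlier
  jump.\<close>

lemma K_jump_lower:
  assumes low: "law_above \<delta> B"
    and B[measurable]: "B \<in> sets borel"
    and f[measurable]: "f \<in> borel_measurable borel" and W[measurable]: "W \<in> borel_measurable borel"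
    and x: "a \<le> x" "x \<le> b" and t: "0 < \<tau>" "\<tau> \<le> t" "t \<le> T"
    and le: "\<And>s v. \<tau> / 2 \<le> s \<Longrightarrow> s \<le> T \<Longrightarrow> v \<in> B \<Longrightarrow> W v \<le> K s f (exp (x - v))"
  shows "ennreal (\<tau> / 2 * (exp (\<alpha> * a) * exp (- (T * exp (\<alpha> * b))))) * (ennreal \<delta> * (\<integral>\<^sup>+v. indicator B v * W v \<partial>lborel)) \<le> K t f (exp x)"
proof -
  let ?D = "ennreal \<delta> * (\<integral>\<^sup>+v. indicator B v * W v \<partial>lborel)"
  let ?c = "exp (\<alpha> * a) * exp (- (T * exp (\<alpha> * b)))"
  have l: "(exp x) powr \<alpha> = exp (\<alpha> * x)" by (simp add: powr_def)
  have "(\<integral>\<^sup>+r. ennreal ?c * ?D * indicator {0<..\<tau> / 2} r \<partial>lborel) = ennreal ?c * ?D * emeasure lborel {0<..\<tau> / 2}"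
    by (rule nn_integral_cmult_indicator) simp
  moreover have "emeasure lborel {0<..\<tau> / 2} = ennreal (\<tau> / 2)" using t by simp
  moreover have "ennreal (\<tau> / 2 * ?c) = ennreal (\<tau> / 2) * ennreal ?c" using t by (intro ennreal_mult) auto
  ultimately have "ennreal (\<tau> / 2 * ?c) * ?D = (\<integral>\<^sup>+r. ennreal ?c * ?D * indicator {0<..\<tau> / 2} r \<partial>lborel)"
    by (simp only: mult_ac)
  also have "\<dots> \<le> (\<integral>\<^sup>+r. indicator {0<..t} r * ennreal ((exp x) powr \<alpha> * exp (- (r * (exp x) powr \<alpha>))) *
      (\<integral>\<^sup>+z. K (t - r) f (z * exp x) \<partial>Th) \<partial>lborel)"
  proof (rule nn_integral_mono)
    fix r :: real
    show "ennreal ?c * ?D * indicator {0<..\<tau> / 2} r \<le> indicator {0<..t} r * ennreal ((exp x) powr \<alpha> * exp (- (r * (exp x) powr \<alpha>))) *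
      (\<integral>\<^sup>+z. K (t - r) f (z * exp x) \<partial>Th)"
    proof (cases "r \<in> {0<..\<tau> / 2}")
      case True
      then have r: "0 < r" "r \<le> \<tau> / 2" by auto
      have "?D \<le> ennreal \<delta> * (\<integral>\<^sup>+v. indicator B v * K (t - r) f (exp (- v) * exp x) \<partial>lborel)"
      proof (rule mult_left_mono, rule nn_integral_mono)
        fix v
        show "indicator B v * W v \<le> indicator B v * K (t - r) f (exp (- v) * exp x)"
          using le[of "t - r" v] r t by (auto simp: indicator_def mult_exp_exp)
      qed auto
      also have "\<dots> \<le> (\<integral>\<^sup>+z. K (t - r) f (z * exp x) \<partial>Th)"
      proof -
        have "(\<lambda>z. K (t - r) f (z * exp x)) \<in> borel_measurable borel" by measurable
        then show ?thesis using bspec[OF low, of "\<lambda>z. K (t - r) f (z * exp x)"] by simp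
      qed
      finally have 1: "?D \<le> (\<integral>\<^sup>+z. K (t - r) f (z * exp x) \<partial>Th)" .
      have "\<alpha> * a \<le> \<alpha> * x" "\<alpha> * x \<le> \<alpha> * b" using x alpha_pos by auto
      then have "r * exp (\<alpha> * x) \<le> T * exp (\<alpha> * b)" using r t by (intro mult_mono) auto
      then have "?c \<le> exp (\<alpha> * x) * exp (- (r * exp (\<alpha> * x)))" using \<open>\<alpha> * a \<le> \<alpha> * x\<close> by (intro mult_mono) auto
      then have "ennreal ?c * ?D \<le> ennreal ((exp x) powr \<alpha> * exp (- (r * (exp x) powr \<alpha>))) * (\<integral>\<^sup>+z. K (t - r) f (z * exp x) \<partial>Th)"
        unfolding l by (intro mult_mono[OF ennreal_leI 1]) simp_all
      then show ?thesis using r t by (simp add: indicator_def)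
    qed simp
  qed
  also have "\<dots> \<le> K t f (exp x)" using t by (intro K_first_jump f) auto
  finally show ?thesis .
qed

abbreviation minorizes :: "real \<Rightarrow> real \<Rightarrow> real \<Rightarrow> real \<Rightarrow> real \<Rightarrow> real \<Rightarrow> bool" where
  "minorizes y L v w \<tau> T \<equiv> \<exists>c>0. \<forall>x\<in>{y..y + L}. \<forall>t\<in>{\<tau>..T}. \<forall>f\<in>borel_measurable borel.
     ennreal c * win v w f \<le> K t f (exp x)"

text \<open>Started anywhere in a logarithmic interval of length \<open>L\<close>, the process has a common minorant, uniformly
  over compact time intervals.\<close>
definition Good :: "real \<Rightarrow> bool" where
  "Good L \<longleftrightarrow> (\<forall>y. \<exists>v w. 0 < w \<and> (\<forall>\<tau> T. 0 < \<tau> \<longrightarrow> \<tau> \<le> T \<longrightarrow> (minorizes y L v w \<tau> T)))"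

text \<open>The interval I = [p, p + w] and its reflection s - I meet in length w - |s - 2 p - w|
  \<ge> w / 5. Two defects of at most w / 20 each are removed, which leaves w / 10.\<close>

lemma overlap_reflected:
  fixes B :: "real set"
  assumes B[measurable]: "B \<in> sets borel" and sub: "B \<subseteq> {p..p + w}" and sm: "emeasure lborel ({p..p + w} - B) \<le> ennreal (w / 20)"
    and w: "0 < w" and s: "2 * p + w / 5 \<le> s" "s \<le> 2 * p + 9 * w / 5"
  shows "ennreal (w / 10) \<le> emeasure lborel {v \<in> B. s - v \<in> B}"
proof -
  let ?I = "{p..p + w}"
  have refl: "emeasure lborel {v. s - v \<in> ?I - B} = emeasure lborel (?I - B)"
  proof -
    have "emeasure lborel {v. s - v \<in> ?I - B} = (\<integral>\<^sup>+v. indicator (?I - B) (s - v) \<partial>lborel)"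
    proof -
      have "{v. s - v \<in> ?I - B} \<in> sets borel" by measurable
      then have "emeasure lborel {v. s - v \<in> ?I - B} = (\<integral>\<^sup>+v. indicator {v. s - v \<in> ?I - B} v \<partial>lborel)" by simp
      also have "\<dots> = (\<integral>\<^sup>+v. indicator (?I - B) (s - v) \<partial>lborel)" by (intro nn_integral_cong) (auto simp: indicator_def)
      finally show ?thesis .
    qed
    also have "\<dots> = (\<integral>\<^sup>+v. indicator (?I - B) v \<partial>lborel)"
      using nn_integral_real_affine[of "indicator (?I - B)" "-1" s] by simp
    finally show ?thesis by simp
  qed
  define l where "l = max p (s - p - w)"
  define u where "u = min (p + w) (s - p)"
  have lu: "w / 5 \<le> u - l" using s w unfolding l_def u_def by linarith
  have "ennreal (w / 5) \<le> emeasure lborel {l..u}" using lu w by (simp add: ennreal_leI)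
  also have "\<dots> \<le> emeasure lborel ({v \<in> B. s - v \<in> B} \<union> ((?I - B) \<union> {v. s - v \<in> ?I - B}))"
    by (intro emeasure_mono) (auto simp: l_def u_def)
  also have "\<dots> \<le> emeasure lborel {v \<in> B. s - v \<in> B} + emeasure lborel ((?I - B) \<union> {v. s - v \<in> ?I - B})"
    by (intro emeasure_subadditive) auto
  also have "\<dots> \<le> emeasure lborel {v \<in> B. s - v \<in> B} + (emeasure lborel (?I - B) + emeasure lborel {v. s - v \<in> ?I - B})"
    by (intro add_left_mono emeasure_subadditive) auto
  also have "\<dots> \<le> emeasure lborel {v \<in> B. s - v \<in> B} + (ennreal (w / 20) + ennreal (w / 20))"
    unfolding refl using sm by (intro add_left_mono add_mono) auto
  also have "ennreal (w / 20) + ennreal (w / 20) = ennreal (w / 10)" using w by (simp flip: ennreal_plus)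
  finally have "ennreal (w / 10) + ennreal (w / 10) \<le> emeasure lborel {v \<in> B. s - v \<in> B} + ennreal (w / 10)"
    using w by (simp flip: ennreal_plus)
  then show ?thesis by (simp add: add.commute[of "emeasure lborel _"] ennreal_add_left_cancel_le)
qed

text \<open>Two jumps are made, since the sum of two increments from \<open>B\<close> has a density
  bounded below on an interval even when \<open>B\<close> has empty interior.
  \<open>overlap_reflected\<close> provides the bound on this convolution.\<close>

lemma Good_base:
  assumes low: "law_above \<delta> B"
    and B[measurable]: "B \<in> sets borel" and sub: "B \<subseteq> {p..p + w}" and sm: "emeasure lborel ({p..p + w} - B) \<le> ennreal (w / 20)"
    and w: "0 < w" and \<delta>: "0 < \<delta>"
  shows "Good w"
  unfolding Good_def
proof (intro allI, rule exI, rule exI, intro conjI allI impI)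
  fix y :: real
  \<comment> \<open>The points s for which x - s meets the range of \<open>overlap_reflected\<close>
    for all x in [y, y + w] form [y - 2 p - 4 w / 5, y - 2 p - w / 5]. The window starts at the left
    end, and its width w / 2 fits into the length 3 w / 5.\<close>
  let ?v = "y - 2 * p - 4 * w / 5"
  show "0 < w / 2" using w by simp
  fix \<tau> T :: real assume t: "0 < \<tau>" "\<tau> \<le> T"
  \<comment> \<open>\<open>c1\<close> and \<open>c2\<close> are the constants of
    \<open>K_jump_lower\<close> for the first jump from x and the second from x - v, the latter with
    \<tau>/2 as available time; \<open>c3\<close> bounds the probability of no further jump.\<close>
  define c1 where "c1 = \<tau> / 2 * (exp (\<alpha> * y) * exp (- (T * exp (\<alpha> * (y + w)))))"
  define c2 where "c2 = \<tau> / 2 / 2 * (exp (\<alpha> * (y - p - w)) * exp (- (T * exp (\<alpha> * (y + w - p)))))"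
  define c3 where "c3 = exp (- (T * exp (\<alpha> * (y + w - 2 * p))))"
  have pos: "0 < c1" "0 < c2" "0 < c3" using t by (auto simp: c1_def c2_def c3_def)
  show "minorizes y w ?v (w / 2) \<tau> T"
  proof (intro exI conjI ballI)
    show "0 < c1 * \<delta> * c2 * \<delta> * c3 * (w / 10)" using pos \<delta> w by simp
    fix x t' and f :: "real \<Rightarrow> ennreal"
    assume x: "x \<in> {y..y + w}" and t': "t' \<in> {\<tau>..T}" and f[measurable]: "f \<in> borel_measurable borel"
    have 1: "ennreal c2 * (ennreal \<delta> * (\<integral>\<^sup>+v'. indicator B v' * (ennreal c3 * f (exp (x - v - v'))) \<partial>lborel)) \<le> K s f (exp (x - v))"
      if s: "\<tau> / 2 \<le> s" "s \<le> T" and v: "v \<in> B" for s v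
      unfolding c2_def
    proof (rule K_jump_lower[OF low B f])
      show "y - p - w \<le> x - v" "x - v \<le> y + w - p" using x v sub by auto
      show "0 < \<tau> / 2" "\<tau> / 2 \<le> s" "s \<le> T" using t s by auto
      fix s' v' assume s': "\<tau> / 2 / 2 \<le> s'" "s' \<le> T" and v': "v' \<in> B"
      have "exp (x - v - v') powr \<alpha> = exp (\<alpha> * (x - v - v'))" by (simp add: powr_def)
      also have "\<dots> \<le> exp (\<alpha> * (y + w - 2 * p))"
      proof -
        have "p \<le> v" "p \<le> v'" using v v' sub by auto
        then have "x - v - v' \<le> y + w - 2 * p" using x by auto
        then show ?thesis using alpha_pos by simp
      qed
      finally have "s' * exp (x - v - v') powr \<alpha> \<le> T * exp (\<alpha> * (y + w - 2 * p))"
        using s' t by (intro mult_mono) auto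
      then have "ennreal c3 * f (exp (x - v - v')) \<le> ennreal (exp (- (s' * exp (x - v - v') powr \<alpha>))) * f (exp (x - v - v'))"
        unfolding c3_def by (intro mult_right_mono ennreal_leI) auto
      also have "\<dots> \<le> K s' f (exp (x - v - v'))" using s' t by (intro K_no_jump f) auto
      finally show "ennreal c3 * f (exp (x - v - v')) \<le> K s' f (exp (x - v - v'))" .
    qed measurable
    have 2: "ennreal c1 * (ennreal \<delta> * (\<integral>\<^sup>+v. indicator B v * (ennreal c2 * (ennreal \<delta> * (\<integral>\<^sup>+v'. indicator B v' * (ennreal c3 * f (exp (x - v - v'))) \<partial>lborel))) \<partial>lborel)) \<le> K t' f (exp x)"
      unfolding c1_def
    proof (rule K_jump_lower[OF low B f])
      show "y \<le> x" "x \<le> y + w" "0 < \<tau>" "\<tau> \<le> t'" "t' \<le> T" using x t t' by auto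
    qed (use 1 in auto)
    have conv: "(\<integral>\<^sup>+v. indicator B v * (\<integral>\<^sup>+v'. indicator B v' * f (exp (x - v - v')) \<partial>lborel) \<partial>lborel) =
       (\<integral>\<^sup>+s. f (exp s) * emeasure lborel {v \<in> B. (x - s) - v \<in> B} \<partial>lborel)"
    proof -
      have "(\<integral>\<^sup>+v. indicator B v * (\<integral>\<^sup>+v'. indicator B v' * f (exp (x - v - v')) \<partial>lborel) \<partial>lborel) =
         (\<integral>\<^sup>+v. indicator B v * (\<integral>\<^sup>+s. indicator B (x - v - s) * f (exp s) \<partial>lborel) \<partial>lborel)"
      proof (rule nn_integral_cong)
        fix v
        show "indicator B v * (\<integral>\<^sup>+v'. indicator B v' * f (exp (x - v - v')) \<partial>lborel) = indicator B v * (\<integral>\<^sup>+s. indicator B (x - v - s) * f (exp s) \<partial>lborel)"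
          using nn_integral_real_affine[of "\<lambda>v'. indicator B v' * f (exp (x - v - v'))" "-1" "x - v"] by simp
      qed
      also have "\<dots> = (\<integral>\<^sup>+v. \<integral>\<^sup>+s. indicator B v * (indicator B (x - v - s) * f (exp s)) \<partial>lborel \<partial>lborel)"
        by (intro nn_integral_cong nn_integral_cmult[symmetric]) measurable
      also have "\<dots> = (\<integral>\<^sup>+s. \<integral>\<^sup>+v. indicator B v * (indicator B (x - v - s) * f (exp s)) \<partial>lborel \<partial>lborel)"
        by (rule lborel_pair.Fubini') measurable
      also have "\<dots> = (\<integral>\<^sup>+s. \<integral>\<^sup>+v. f (exp s) * indicator {v \<in> B. (x - s) - v \<in> B} v \<partial>lborel \<partial>lborel)"
        by (intro nn_integral_cong) (auto simp: indicator_def algebra_simps)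
      also have "\<dots> = (\<integral>\<^sup>+s. f (exp s) * emeasure lborel {v \<in> B. (x - s) - v \<in> B} \<partial>lborel)"
        by (intro nn_integral_cong nn_integral_cmult_indicator) measurable
      finally show ?thesis .
    qed
    have "ennreal (w / 10) * win ?v (w / 2) f =
       (\<integral>\<^sup>+s. ennreal (w / 10) * (indicator {?v..?v + w / 2} s * f (exp s)) \<partial>lborel)"
      by (rule nn_integral_cmult[symmetric]) measurable
    also have "\<dots> \<le> (\<integral>\<^sup>+s. f (exp s) * emeasure lborel {v \<in> B. (x - s) - v \<in> B} \<partial>lborel)"
    proof (rule nn_integral_mono)
      fix s
      show "ennreal (w / 10) * (indicator {?v..?v + w / 2} s * f (exp s)) \<le> f (exp s) * emeasure lborel {v \<in> B. (x - s) - v \<in> B}"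
      proof (cases "s \<in> {?v..?v + w / 2}")
        case True
        then have "2 * p + w / 5 \<le> x - s" "x - s \<le> 2 * p + 9 * w / 5" using x w by auto
        then have "ennreal (w / 10) \<le> emeasure lborel {v \<in> B. (x - s) - v \<in> B}"
          by (rule overlap_reflected[OF B sub sm w])
        then have "f (exp s) * ennreal (w / 10) \<le> f (exp s) * emeasure lborel {v \<in> B. (x - s) - v \<in> B}" by (rule mult_left_mono) simp
        then show ?thesis using True by (simp add: mult_ac)
      qed simp
    qed
    finally have 3: "ennreal (w / 10) * win ?v (w / 2) f \<le>
      (\<integral>\<^sup>+v. indicator B v * (\<integral>\<^sup>+v'. indicator B v' * f (exp (x - v - v')) \<partial>lborel) \<partial>lborel)" unfolding conv .
    have 4: "(\<integral>\<^sup>+v. indicator B v * (ennreal c2 * (ennreal \<delta> * (\<integral>\<^sup>+v'. indicator B v' * (ennreal c3 * f (exp (x - v - v'))) \<partial>lborel))) \<partial>lborel)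
      = ennreal c2 * (ennreal \<delta> * (ennreal c3 * (\<integral>\<^sup>+v. indicator B v * (\<integral>\<^sup>+v'. indicator B v' * f (exp (x - v - v')) \<partial>lborel) \<partial>lborel)))"
    proof -
      have "(\<integral>\<^sup>+v'. indicator B v' * (ennreal c3 * f (exp (x - v - v'))) \<partial>lborel) = ennreal c3 * (\<integral>\<^sup>+v'. indicator B v' * f (exp (x - v - v')) \<partial>lborel)" for v
        by (subst nn_integral_cmult[symmetric]) (auto simp: mult_ac)
      then have "(\<integral>\<^sup>+v. indicator B v * (ennreal c2 * (ennreal \<delta> * (\<integral>\<^sup>+v'. indicator B v' * (ennreal c3 * f (exp (x - v - v'))) \<partial>lborel))) \<partial>lborel)
        = (\<integral>\<^sup>+v. ennreal c2 * ennreal \<delta> * ennreal c3 * (indicator B v * (\<integral>\<^sup>+v'. indicator B v' * f (exp (x - v - v')) \<partial>lborel)) \<partial>lborel)"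
        by (intro nn_integral_cong) (simp add: mult_ac)
      also have "\<dots> = ennreal c2 * ennreal \<delta> * ennreal c3 * (\<integral>\<^sup>+v. indicator B v * (\<integral>\<^sup>+v'. indicator B v' * f (exp (x - v - v')) \<partial>lborel) \<partial>lborel)"
        by (rule nn_integral_cmult) measurable
      finally show ?thesis by (simp add: mult.assoc)
    qed
    have "ennreal (c1 * \<delta> * c2 * \<delta> * c3 * (w / 10)) * win ?v (w / 2) f =
      ennreal c1 * (ennreal \<delta> * (ennreal c2 * (ennreal \<delta> * (ennreal c3 * (ennreal (w / 10) * win ?v (w / 2) f)))))"
    proof -
      have "ennreal (c1 * \<delta> * c2 * \<delta> * c3 * (w / 10)) = ennreal c1 * ennreal \<delta> * ennreal c2 * ennreal \<delta> * ennreal c3 * ennreal (w / 10)"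
        using pos \<delta> w by (subst ennreal_mult, simp, simp)+ simp
      then show ?thesis by (simp only: mult.assoc)
    qed
    also have "\<dots> \<le> ennreal c1 * (ennreal \<delta> * (ennreal c2 * (ennreal \<delta> * (ennreal c3 *
      (\<integral>\<^sup>+v. indicator B v * (\<integral>\<^sup>+v'. indicator B v' * f (exp (x - v - v')) \<partial>lborel) \<partial>lborel)))))"
      by (intro mult_left_mono 3) auto
    also have "\<dots> \<le> K t' f (exp x)" using 2 unfolding 4 .
    finally show "ennreal (c1 * \<delta> * c2 * \<delta> * c3 * (w / 10)) * win ?v (w / 2) f \<le> K t' f (exp x)" .
  qed
qed

text \<open>The worst case is that all of the defect w / 20 falls into the given quarter, and w / 4
  - w / 20 = w / 5.\<close>

lemma window_mass:
  assumes B[measurable]: "B \<in> sets borel" and sm: "emeasure lborel ({p..p + w} - B) \<le> ennreal (w / 20)"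
    and w: "0 < w" and J: "p \<le> q" "q + w / 4 \<le> p + w"
  shows "ennreal (w / 5) \<le> emeasure lborel (B \<inter> {q..q + w / 4})"
proof -
  have "ennreal (w / 4) = emeasure lborel {q..q + w / 4}" using w by simp
  also have "\<dots> \<le> emeasure lborel ((B \<inter> {q..q + w / 4}) \<union> ({p..p + w} - B))"
    using J by (intro emeasure_mono) auto
  also have "\<dots> \<le> emeasure lborel (B \<inter> {q..q + w / 4}) + emeasure lborel ({p..p + w} - B)"
    by (intro emeasure_subadditive) auto
  also have "\<dots> \<le> emeasure lborel (B \<inter> {q..q + w / 4}) + ennreal (w / 20)" using sm by (intro add_left_mono)
  finally have "ennreal (w / 20) + ennreal (w / 5) \<le> ennreal (w / 20) + emeasure lborel (B \<inter> {q..q + w / 4})"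
    using w by (simp add: add.commute flip: ennreal_plus)
  then show ?thesis by (simp add: ennreal_add_left_cancel_le)
qed

text \<open>One more jump carries the longer interval into the shorter one. Points up to y0 + L - w
  / 4 use increments in [p, p + w / 4], the remaining ones, a stretch of length w / 2, use
  [p + w / 2, p + 3 w / 4]; w \<le> L keeps their images above \<open>y\<close>.\<close>

lemma Good_step:
  assumes low: "law_above \<delta> B"
    and B[measurable]: "B \<in> sets borel" and sm: "emeasure lborel ({p..p + w} - B) \<le> ennreal (w / 20)"
    and w: "0 < w" and \<delta>: "0 < \<delta>" and G: "Good L" and L: "w \<le> L"
  shows "Good (L + w / 4)"
  unfolding Good_def
proof (intro allI)
  fix y0 :: real
  define y where "y = y0 - p - w / 4"
  have "\<exists>v w. 0 < w \<and> (\<forall>\<tau> T. 0 < \<tau> \<longrightarrow> \<tau> \<le> T \<longrightarrow> (minorizes y L v w \<tau> T))"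
    using G unfolding Good_def by (rule spec)
  then obtain v w' where w': "0 < w'" and minor: "\<forall>\<tau> T. 0 < \<tau> \<longrightarrow> \<tau> \<le> T \<longrightarrow> (minorizes y L v w' \<tau> T)"
    by (elim exE conjE)
  have "minorizes y0 (L + w / 4) v w' \<tau> T" if t: "0 < \<tau>" "\<tau> \<le> T" for \<tau> T
  proof -
    obtain c where c: "0 < c" and cK: "\<And>x t f. x \<in> {y..y + L} \<Longrightarrow> t \<in> {\<tau> / 2..T} \<Longrightarrow> f \<in> borel_measurable borel \<Longrightarrow>
      ennreal c * win v w' f \<le> K t f (exp x)"
      using minor[rule_format, of "\<tau> / 2" T] t by auto
    define c1 where "c1 = \<tau> / 2 * (exp (\<alpha> * y0) * exp (- (T * exp (\<alpha> * (y0 + (L + w / 4))))))"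
    have c1: "0 < c1" using t by (simp add: c1_def)
    show ?thesis
    proof (intro exI conjI ballI)
      show "0 < c1 * \<delta> * c * (w / 5)" using c c1 \<delta> w by simp
      fix x t' and f :: "real \<Rightarrow> ennreal"
      assume x: "x \<in> {y0..y0 + (L + w / 4)}" and t': "t' \<in> {\<tau>..T}" and f[measurable]: "f \<in> borel_measurable borel"
      define X where "X = win v w' f"
      obtain q where q: "p \<le> q" "q + w / 4 \<le> p + w" and xq: "\<And>r. r \<in> {q..q + w / 4} \<Longrightarrow> x - r \<in> {y..y + L}"
      proof (cases "x \<le> y0 + L - w / 4")
        case True
        show ?thesis
        proof (rule that[of p])
          show "x - r \<in> {y..y + L}" if "r \<in> {p..p + w / 4}" for r using that True x by (simp add: y_def)
        qed (use w in auto)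
      next
        case False
        show ?thesis
        proof (rule that[of "p + w / 2"])
          show "x - r \<in> {y..y + L}" if "r \<in> {p + w / 2..p + w / 2 + w / 4}" for r using that False x L w by (simp add: y_def)
        qed (use w in auto)
      qed
      have k1: "ennreal c1 * (ennreal \<delta> * (\<integral>\<^sup>+r. indicator B r * (indicator {q..q + w / 4} r * (ennreal c * X)) \<partial>lborel)) \<le> K t' f (exp x)"
        unfolding c1_def
      proof (rule K_jump_lower[OF low B f])
        show "y0 \<le> x" "x \<le> y0 + (L + w / 4)" "0 < \<tau>" "\<tau> \<le> t'" "t' \<le> T" using x t t' by auto
        fix s r assume s: "\<tau> / 2 \<le> s" "s \<le> T" and "r \<in> B"
        show "indicator {q..q + w / 4} r * (ennreal c * X) \<le> K s f (exp (x - r))"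
        proof (cases "r \<in> {q..q + w / 4}")
          case True
          then show ?thesis using cK[OF xq[OF True] _ f, of s] s by (simp add: X_def)
        qed simp
      qed measurable
      have k2: "(\<integral>\<^sup>+r. indicator B r * (indicator {q..q + w / 4} r * (ennreal c * X)) \<partial>lborel) = ennreal c * X * emeasure lborel (B \<inter> {q..q + w / 4})"
      proof -
        have "(\<integral>\<^sup>+r. indicator B r * (indicator {q..q + w / 4} r * (ennreal c * X)) \<partial>lborel) = (\<integral>\<^sup>+r. ennreal c * X * indicator (B \<inter> {q..q + w / 4}) r \<partial>lborel)"
          by (intro nn_integral_cong) (auto simp: indicator_def)
        also have "\<dots> = ennreal c * X * emeasure lborel (B \<inter> {q..q + w / 4})" by (rule nn_integral_cmult_indicator) measurable
        finally show ?thesis .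
      qed
      have k3: "ennreal (c1 * \<delta> * c * (w / 5)) * X \<le> ennreal c1 * (ennreal \<delta> * (ennreal c * X * emeasure lborel (B \<inter> {q..q + w / 4})))"
      proof -
        have "ennreal (c1 * \<delta> * c * (w / 5)) * X = ennreal c1 * (ennreal \<delta> * (ennreal c * X * ennreal (w / 5)))"
        proof -
          have "ennreal (c1 * \<delta> * c * (w / 5)) = ennreal c1 * ennreal \<delta> * ennreal c * ennreal (w / 5)"
            using c c1 \<delta> w by (subst ennreal_mult, simp, simp)+ simp
          then show ?thesis by (simp only: mult_ac)
        qed
        also have "\<dots> \<le> ennreal c1 * (ennreal \<delta> * (ennreal c * X * emeasure lborel (B \<inter> {q..q + w / 4})))"
          by (intro mult_left_mono window_mass[OF B sm w q]) auto
        finally show ?thesis .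
      qed
      show "ennreal (c1 * \<delta> * c * (w / 5)) * win v w' f \<le> K t' f (exp x)"
        unfolding X_def[symmetric] by (rule order_trans[OF k3 k1[unfolded k2]])
    qed
  qed
  then show "\<exists>v w'. 0 < w' \<and> (\<forall>\<tau> T. 0 < \<tau> \<longrightarrow> \<tau> \<le> T \<longrightarrow> (minorizes y0 (L + w / 4) v w' \<tau> T))"
    using w' by blast
qed

text \<open>The lengths w + n w / 4 are all good, and one of them covers [ln a, ln b]. Only t = 1 is
  retained; the time ranges in \<open>Good\<close> serve the induction, where part of the time is
  spent on the additional jump.\<close>

lemma minorization:
  assumes ab: "0 < a" "a \<le> b"
  shows "\<exists>v w c. 0 < w \<and> 0 < c \<and> (\<forall>x\<in>{a..b}. \<forall>f\<in>borel_measurable borel.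
     ennreal c * win v w f \<le> K 1 f x)"
proof -
  obtain \<delta> p w B where h: "0 < \<delta>" "0 < w" "B \<in> sets borel" "B \<subseteq> {p..p + w}"
    "emeasure lborel ({p..p + w} - B) \<le> ennreal (w / 20)"
    "law_above \<delta> B"
    using theta_interval by blast
  have G: "Good (w + real n * (w / 4))" for n
  proof (induction n)
    case 0 then show ?case using Good_base[OF h(6,3,4,5,2,1)] by simp
  next
    case (Suc n)
    have "Good (w + real n * (w / 4) + w / 4)" using h(2) by (intro Good_step[OF h(6,3,5,2,1) Suc]) simp
    moreover have "w + real n * (w / 4) + w / 4 = w + real (Suc n) * (w / 4)" by (simp add: field_simps)
    ultimately show ?case by (simp only:)
  qed
  obtain n where n: "(ln b - ln a) / (w / 4) \<le> real n" using real_arch_simple by blast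
  then have n': "ln b - ln a \<le> w + real n * (w / 4)" using h(2) by (simp add: field_simps)
  have "\<exists>v w'. 0 < w' \<and> (\<forall>\<tau> T. 0 < \<tau> \<longrightarrow> \<tau> \<le> T \<longrightarrow> (minorizes (ln a) (w + real n * (w / 4)) v w' \<tau> T))"
    using G[of n] unfolding Good_def by (rule spec)
  then obtain v w' where w': "0 < w'" and m: "\<forall>\<tau> T. 0 < \<tau> \<longrightarrow> \<tau> \<le> T \<longrightarrow> (minorizes (ln a) (w + real n * (w / 4)) v w' \<tau> T)"
    by (elim exE conjE)
  obtain c where c: "0 < c" and cK: "\<forall>x\<in>{ln a..ln a + (w + real n * (w / 4))}. \<forall>t\<in>{1..1}. \<forall>f\<in>borel_measurable borel.
     ennreal c * win v w' f \<le> K t f (exp x)"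
    using m[rule_format, of 1 1] by auto
  have "ennreal c * win v w' f \<le> K 1 f x"
    if x: "x \<in> {a..b}" and f: "f \<in> borel_measurable borel" for x f
  proof -
    have "ln a \<le> ln x" "ln x \<le> ln b" using x ab by auto
    then have "ln x \<in> {ln a..ln a + (w + real n * (w / 4))}" using n' by auto
    then have "ennreal c * win v w' f \<le> K 1 f (exp (ln x))" using cK f by auto
    then show ?thesis using x ab by simp
  qed
  then show ?thesis using w' c by blast
qed


subsection \<open>Contraction\<close>

definition c2 :: real where
  "c2 = 2 powr (1 / \<alpha>)"

lemma c2: "1 \<le> c2" "0 < c2" "c2 powr \<alpha> = 2"
  using alpha_pos by (auto simp: c2_def powr_powr ge_one_powr_ge_zero)

text \<open>One step of the rescaled process: the time span from \<open>1 + t = 2\<^sup>k\<close> to \<open>1 + t = 2\<^sup>k\<^sup>+\<^sup>1\<close>, with the state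
  multiplied by \<open>(1 + t)\<^sup>1\<^sup>/\<^sup>\<alpha>\<close>.\<close>
definition Q :: "(real \<Rightarrow> ennreal) \<Rightarrow> real \<Rightarrow> ennreal" where
  "Q F x = K 1 (\<lambda>y. F (c2 * y)) x"

lemma measurable_Q [measurable]:
  assumes [measurable]: "F \<in> borel_measurable borel"
  shows "Q F \<in> borel_measurable borel"
  unfolding Q_def[abs_def] by measurable

lemma measurable_Q_pow [measurable]: "F \<in> borel_measurable borel \<Longrightarrow> (Q ^^ k) F \<in> borel_measurable borel"
  by (induction k) auto

lemma Q_le_1: "(\<And>y. F y \<le> 1) \<Longrightarrow> Q F x \<le> 1"
  unfolding Q_def by (rule K_le_1) simp

lemma Q_pow_le_1: "(\<And>y. F y \<le> 1) \<Longrightarrow> (Q ^^ k) F x \<le> 1"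
  by (induction k arbitrary: x) (auto intro: Q_le_1)

lemma K_0: assumes "0 < x" shows "K 0 f x = f x"
proof -
  have "AE \<omega> in S. Yproc \<alpha> (x, \<omega>) 0 = x"
    using AE_S
  proof eventually_elim
    case (elim \<omega>)
    have "0 < jtime \<alpha> (x, \<omega>) (Suc 0)" using elim assms by (simp add: jtime_def htime_def)
    then have "(LEAST n. 0 < jtime \<alpha> (x, \<omega>) (Suc n)) = 0" "\<exists>n. 0 < jtime \<alpha> (x, \<omega>) (Suc n)"
      by (auto intro: Least_eq_0)
    then show ?case by (simp add: Yproc_def)
  qed
  then have "K 0 f x = (\<integral>\<^sup>+\<omega>. f x \<partial>S)" unfolding K_def
    by (intro nn_integral_cong_AE) (auto elim!: eventually_mono)
  then show ?thesis by (simp add: S.emeasure_space_1)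
qed

text \<open>After the first step, scaling converts the remaining \<open>k\<close> steps into time 2
  (2^k - 1) of the original clock. The semigroup law joins the pieces, as 1 + 2 (2^k - 1) = 2^(k+1)
  - 1.\<close>

lemma Q_pow:
  assumes F[measurable]: "F \<in> borel_measurable borel" and F1: "\<And>y. F y \<le> 1" and "0 < x"
  shows "(Q ^^ k) F x = K (2 ^ k - 1) (\<lambda>y. F (c2 ^ k * y)) x"
  using \<open>0 < x\<close>
proof (induction k arbitrary: x)
  case 0
  then show ?case by (simp add: K_0)
next
  case (Suc k)
  have "(Q ^^ Suc k) F x = K 1 (\<lambda>y. (Q ^^ k) F (c2 * y)) x" by (simp add: Q_def)
  also have "\<dots> = K 1 (K (2 * (2 ^ k - 1)) (\<lambda>y. F (c2 ^ Suc k * y))) x"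
  proof (rule K_cong)
    fix y :: real assume y: "0 < y"
    have "(Q ^^ k) F (c2 * y) = K (2 * (2 ^ k - 1) / c2 powr \<alpha>) (\<lambda>y. F (c2 ^ k * y)) (c2 * y)"
    proof -
      have "2 * (2 ^ k - 1) / c2 powr \<alpha> = 2 ^ k - 1" unfolding c2(3) by (rule nonzero_mult_div_cancel_left) simp
      then show ?thesis using Suc.IH[of "c2 * y"] y c2(2) by simp
    qed
    also have "\<dots> = K (2 * (2 ^ k - 1)) (\<lambda>y. F (c2 ^ k * (c2 * y))) y"
      by (rule K_scale[symmetric, OF c2(2) y])
    finally show "(Q ^^ k) F (c2 * y) = K (2 * (2 ^ k - 1)) (\<lambda>y. F (c2 ^ Suc k * y)) y"
      by (simp add: mult_ac)
  qed (use Suc in auto)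
  also have "\<dots> = K (1 + 2 * (2 ^ k - 1)) (\<lambda>y. F (c2 ^ Suc k * y)) x"
    using Suc F1 by (intro K_semigroup[symmetric]) auto
  finally show ?case by simp
qed

text \<open>Relative to this law, being dominated by a multiple of the profile means being bounded
  by a constant.\<close>

definition N :: "real measure" where
  "N = density mm (\<lambda>x. ennreal (us x))"

lemma sets_N [measurable_cong, simp]: "sets N = sets borel" and space_N [simp]: "space N = UNIV"
  by (simp_all add: N_def)

abbreviation pairing :: "(real \<Rightarrow> ennreal) \<Rightarrow> (real \<Rightarrow> ennreal) \<Rightarrow> ennreal" ("\<langle>_, _\<rangle>") where
  "\<langle>f, F\<rangle> \<equiv> \<integral>\<^sup>+x. f x * F x \<partial>N"

abbreviation mass :: "(real \<Rightarrow> ennreal) \<Rightarrow> ennreal" where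
  "mass f \<equiv> \<integral>\<^sup>+x. f x \<partial>N"

text \<open>The action of one rescaled step on densities, specified by duality with
  \<open>Q\<close>; this determines \<open>g\<close> up to null sets.\<close>

abbreviation pushes :: "(real \<Rightarrow> ennreal) \<Rightarrow> (real \<Rightarrow> ennreal) \<Rightarrow> bool" where
  "pushes f g \<equiv> \<forall>F\<in>borel_measurable borel. \<langle>g, F\<rangle> = \<langle>f, Q F\<rangle>"

text \<open>Equivalent to f \<le> C almost everywhere. Tested against functions, the bound passes
  through \<open>Q\<close> at once, by invariance of \<open>N\<close>.\<close>

definition dominated :: "real \<Rightarrow> (real \<Rightarrow> ennreal) \<Rightarrow> bool" where
  "dominated C f \<longleftrightarrow> f \<in> borel_measurable borel \<and>
     (\<forall>F\<in>borel_measurable borel. \<langle>f, F\<rangle> \<le> ennreal C * (\<integral>\<^sup>+x. F x \<partial>N))"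

lemma dominatedD:
  assumes "dominated C f" "F \<in> borel_measurable borel"
  shows "\<langle>f, F\<rangle> \<le> ennreal C * (\<integral>\<^sup>+x. F x \<partial>N)"
  using assms by (auto simp: dominated_def)

lemma nn_integral_mult_le:
  "(\<And>x. F x \<le> (1::ennreal)) \<Longrightarrow> (\<integral>\<^sup>+x. f x * F x \<partial>M) \<le> (\<integral>\<^sup>+x. f x \<partial>M)"
  by (intro nn_integral_mono) (simp add: mult_left_le)

context
  assumes L: "Lmean < \<infinity>"
begin

interpretation N: prob_space N
  unfolding N_def by (rule prob_space_density_Dm[OF us_Dm[OF L]])

lemma nn_integral_N:
  "f \<in> borel_measurable borel \<Longrightarrow> mass f = (\<integral>\<^sup>+x. ennreal (us x) * f x \<partial>mm)"
  unfolding N_def by (rule nn_integral_density) auto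

lemma AE_N: "AE x in N. 0 < x"
  unfolding N_def using AE_mm by (subst AE_density) (auto elim: eventually_mono)

text \<open>Invariance of the profile: during unit time it contracts by the factor
  \<open>c2\<close>, and the dilation in \<open>Q\<close> undoes this.\<close>

lemma nn_integral_Q:
  assumes [measurable]: "F \<in> borel_measurable borel"
  shows "(\<integral>\<^sup>+x. Q F x \<partial>N) = (\<integral>\<^sup>+x. F x \<partial>N)"
proof -
  have "(\<integral>\<^sup>+x. Q F x \<partial>N) = (\<integral>\<^sup>+x. ennreal (us x) * K 1 (\<lambda>y. F (c2 * y)) x \<partial>mm)"
    by (subst nn_integral_N) (auto simp: Q_def)
  also have "\<dots> = (\<integral>\<^sup>+x. ennreal (cs 1 x) * F (c2 * x) \<partial>mm)" by (rule us_K[OF L]) auto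
  also have "\<dots> = (\<integral>\<^sup>+x. ennreal (c2\<^sup>2) * (ennreal (us (c2 * x)) * F (c2 * x)) \<partial>mm)"
    by (intro nn_integral_cong) (simp add: cs_def c2_def[symmetric] ennreal_mult' mult.assoc)
  also have "\<dots> = (\<integral>\<^sup>+x. ennreal (us x) * F x \<partial>mm)"
    using c2 by (intro nn_integral_mm_scale[where f="\<lambda>x. ennreal (us x) * F x"]) auto
  also have "\<dots> = (\<integral>\<^sup>+x. F x \<partial>N)" by (rule nn_integral_N[symmetric]) measurable
  finally show ?thesis .
qed

text \<open>By invariance the image measure is at most C times \<open>N\<close>, hence absolutely
  continuous, and its Radon-Nikodym derivative serves as \<open>g\<close>.\<close>

lemma push_forward:
  assumes f: "dominated C f"
  shows "\<exists>g. dominated C g \<and> (pushes f g)"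
proof -
  have [measurable]: "f \<in> borel_measurable borel" using f by (simp add: dominated_def)
  define M where "M = distr (density N f \<Otimes>\<^sub>M S) borel (\<lambda>p. c2 * Yproc \<alpha> p 1)"
  have sj: "sets (density N f \<Otimes>\<^sub>M S) = sets (borel \<Otimes>\<^sub>M S)"
    by (intro sets_pair_measure_cong) auto
  have "(\<lambda>p. c2 * Yproc \<alpha> p 1) \<in> borel_measurable (borel \<Otimes>\<^sub>M S)" by measurable
  then have Y: "(\<lambda>p. c2 * Yproc \<alpha> p 1) \<in> borel_measurable (density N f \<Otimes>\<^sub>M S)"
    by (simp add: sj cong: measurable_cong_sets)
  have M: "(\<integral>\<^sup>+x. F x \<partial>M) = \<langle>f, Q F\<rangle>" if F[measurable]: "F \<in> borel_measurable borel" for F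
  proof -
    have FY: "(\<lambda>p. F (c2 * Yproc \<alpha> p 1)) \<in> borel_measurable (density N f \<Otimes>\<^sub>M S)"
      using measurable_compose[OF Y F] .
    have "(\<integral>\<^sup>+x. F x \<partial>M) = (\<integral>\<^sup>+p. F (c2 * Yproc \<alpha> p 1) \<partial>(density N f \<Otimes>\<^sub>M S))"
      unfolding M_def by (rule nn_integral_distr[OF Y]) simp
    also have "\<dots> = (\<integral>\<^sup>+x. Q F x \<partial>density N f)"
      using S.nn_integral_fst[OF FY] by (simp add: Q_def K_def)
    also have "\<dots> = \<langle>f, Q F\<rangle>" by (rule nn_integral_density) measurable
    finally show ?thesis .
  qed
  have dom: "(\<integral>\<^sup>+x. F x \<partial>M) \<le> ennreal C * (\<integral>\<^sup>+x. F x \<partial>N)" if [measurable]: "F \<in> borel_measurable borel" for F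
  proof -
    have "(\<integral>\<^sup>+x. F x \<partial>M) \<le> ennreal C * (\<integral>\<^sup>+x. Q F x \<partial>N)"
      unfolding M[OF that] by (rule dominatedD[OF f]) measurable
    then show ?thesis by (simp add: nn_integral_Q)
  qed
  have sM: "sets M = sets N" by (simp add: M_def)
  have "absolutely_continuous N M"
    unfolding absolutely_continuous_def
  proof
    fix B assume B: "B \<in> null_sets N"
    then have [measurable]: "B \<in> sets borel" by (auto simp: null_sets_def)
    have "emeasure M B = (\<integral>\<^sup>+x. indicator B x \<partial>M)" by (simp add: M_def)
    also have "\<dots> \<le> ennreal C * (\<integral>\<^sup>+x. indicator B x \<partial>N)" by (rule dom) measurable
    also have "\<dots> = 0" using B by (simp add: null_sets_def)
    finally show "B \<in> null_sets M" by (auto simp: null_sets_def M_def)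
  qed
  from N.Radon_Nikodym[OF this sM] obtain g where g[measurable]: "g \<in> borel_measurable N" "density N g = M" by blast
  have [measurable]: "g \<in> borel_measurable borel" using g(1) by (simp cong: measurable_cong_sets)
  have gM: "\<langle>g, F\<rangle> = (\<integral>\<^sup>+x. F x \<partial>M)" if [measurable]: "F \<in> borel_measurable borel" for F
    unfolding g(2)[symmetric] by (subst nn_integral_density) auto
  show ?thesis
  proof (intro exI[of _ g] conjI ballI)
    show "dominated C g" by (auto simp: dominated_def gM dom)
    show "\<langle>g, F\<rangle> = \<langle>f, Q F\<rangle>" if "F \<in> borel_measurable borel" for F
      using gM[OF that] M[OF that] by simp
  qed
qed

lemma tight:
  assumes "0 < e"
  shows "\<exists>a b. 0 < a \<and> a \<le> b \<and> emeasure N (- {a..b}) \<le> ennreal e"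
proof -
  let ?B = "\<lambda>n. {1 / real (Suc n)..real (Suc n)}"
  have "(\<lambda>n. measure N (?B n)) \<longlonglongrightarrow> measure N (\<Union>n. ?B n)"
  proof (rule N.finite_Lim_measure_incseq)
    show "incseq ?B"
    proof (rule incseq_SucI)
      fix n
      have "1 / real (Suc (Suc n)) \<le> 1 / real (Suc n)" by (simp add: frac_le)
      then show "?B n \<le> ?B (Suc n)" unfolding atLeastatMost_subset_iff by auto
    qed
  qed auto
  moreover have "measure N (\<Union>n. ?B n) = 1"
  proof -
    have "AE x in N. x \<in> (\<Union>n. ?B n)"
      using AE_N
    proof eventually_elim
      case (elim x)
      obtain n where n: "inverse (real (Suc n)) < x" using reals_Archimedean elim by blast
      obtain m where m: "x \<le> real m" using real_arch_simple by blast
      have "1 / real (Suc (max n m)) \<le> 1 / real (Suc n)" by (simp add: frac_le)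
      then have "x \<in> ?B (max n m)" using n m by (auto simp: inverse_eq_divide)
      then show ?case by blast
    qed
    then show ?thesis by (intro N.prob_eq_1[THEN iffD2]) auto
  qed
  ultimately have "(\<lambda>n. measure N (?B n)) \<longlonglongrightarrow> 1" by simp
  then have "\<forall>\<^sub>F n in sequentially. 1 - e < measure N (?B n)" using assms by (intro order_tendstoD(1)) auto
  then obtain n where n: "1 - e < measure N (?B n)" by (auto dest: eventually_happens)
  have "measure N (space N - ?B n) = 1 - measure N (?B n)" by (rule N.prob_compl) simp
  then have "measure N (- ?B n) \<le> e" using n by (simp add: Compl_eq_Diff_UNIV)
  then have "emeasure N (- ?B n) \<le> ennreal e" by (simp add: N.emeasure_eq_measure ennreal_leI)
  moreover have "1 / real (Suc n) \<le> 1" "1 \<le> real (Suc n)" by auto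
  then have "1 / real (Suc n) \<le> real (Suc n)" by linarith
  ultimately show ?thesis by (intro exI[of _ "1 / real (Suc n)"] exI[of _ "real (Suc n)"]) auto
qed

text \<open>Two functions of mass at least \<open>\<delta>\<close> dominated by \<open>C\<close> both put mass at least \<open>\<delta> / 2\<close> on a compact
  set, from which \<open>Q\<close> has a common minorant.\<close>
lemma overlap:
  assumes C: "0 < C" and d: "0 < \<delta>"
  shows "\<exists>\<eta>>0. \<forall>f1 f2 g1 g2. dominated C f1 \<longrightarrow> dominated C f2 \<longrightarrow> ennreal \<delta> \<le> mass f1 \<longrightarrow> ennreal \<delta> \<le> mass f2 \<longrightarrow>
    g1 \<in> borel_measurable borel \<longrightarrow> g2 \<in> borel_measurable borel \<longrightarrow>
    (pushes f1 g1) \<longrightarrow>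
    (pushes f2 g2) \<longrightarrow>
    ennreal \<eta> \<le> (\<integral>\<^sup>+x. min (g1 x) (g2 x) \<partial>N)"
proof -
  \<comment> \<open>A function dominated by \<open>C\<close> has mass at most C \<delta> / (2 C) =
    \<delta> / 2 outside the compact set.\<close>
  obtain a b where ab: "0 < a" "a \<le> b" "emeasure N (- {a..b}) \<le> ennreal (\<delta> / (2 * C))"
    using tight[of "\<delta> / (2 * C)"] C d by auto
  obtain v w c where w: "0 < w" and c: "0 < c" and minor: "\<forall>x\<in>{a..b}. \<forall>f\<in>borel_measurable borel.
     ennreal c * (\<integral>\<^sup>+s. indicator {v..v + w} s * f (exp s) \<partial>lborel) \<le> K 1 f x"
    using minorization[OF ab(1,2)] by blast
  define \<Lambda> where "\<Lambda> F = (\<integral>\<^sup>+s. indicator {v..v + w} s * F (c2 * exp s) \<partial>lborel)" for F :: "real \<Rightarrow> ennreal"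
  have low: "ennreal (c * (\<delta> / 2)) * \<Lambda> F \<le> \<langle>f, Q F\<rangle>"
    if f: "dominated C f" "ennreal \<delta> \<le> mass f" and F[measurable]: "F \<in> borel_measurable borel" for f F
  proof -
    have [measurable]: "f \<in> borel_measurable borel" using f by (simp add: dominated_def)
    have "\<langle>f, indicator (- {a..b})\<rangle> \<le> ennreal C * (\<integral>\<^sup>+x. indicator (- {a..b}) x \<partial>N)"
      by (rule dominatedD[OF f(1)]) measurable
    also have "\<dots> \<le> ennreal C * ennreal (\<delta> / (2 * C))" using ab(3) by (intro mult_left_mono) auto
    also have "\<dots> = ennreal (\<delta> / 2)" using C d by (simp flip: ennreal_mult)
    finally have out: "\<langle>f, indicator (- {a..b})\<rangle> \<le> ennreal (\<delta> / 2)" .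
    have "ennreal (\<delta> / 2) + ennreal (\<delta> / 2) = ennreal \<delta>" using d by (simp flip: ennreal_plus)
    also have "\<dots> \<le> mass f" by (rule f(2))
    also have "\<dots> = (\<integral>\<^sup>+x. f x * indicator (- {a..b}) x + f x * indicator {a..b} x \<partial>N)"
      by (intro nn_integral_cong) (auto simp: indicator_def)
    also have "\<dots> = \<langle>f, indicator (- {a..b})\<rangle> + \<langle>f, indicator {a..b}\<rangle>"
      by (rule nn_integral_add) measurable
    also have "\<dots> \<le> ennreal (\<delta> / 2) + \<langle>f, indicator {a..b}\<rangle>" using out by (rule add_right_mono)
    finally have inK: "ennreal (\<delta> / 2) \<le> \<langle>f, indicator {a..b}\<rangle>" by (simp add: ennreal_add_left_cancel_le)
    have "ennreal (c * (\<delta> / 2)) = ennreal c * ennreal (\<delta> / 2)" using c d by (intro ennreal_mult) auto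
    then have "ennreal (c * (\<delta> / 2)) * \<Lambda> F = ennreal c * \<Lambda> F * ennreal (\<delta> / 2)" by (simp only: mult_ac)
    also have "\<dots> \<le> ennreal c * \<Lambda> F * \<langle>f, indicator {a..b}\<rangle>" using inK by (rule mult_left_mono) simp
    also have "\<dots> = (\<integral>\<^sup>+x. ennreal c * \<Lambda> F * (f x * indicator {a..b} x) \<partial>N)" by (rule nn_integral_cmult[symmetric]) measurable
    also have "\<dots> \<le> \<langle>f, Q F\<rangle>"
    proof (rule nn_integral_mono)
      fix x
      show "ennreal c * \<Lambda> F * (f x * indicator {a..b} x) \<le> f x * Q F x"
      proof (cases "x \<in> {a..b}")
        case True
        have "(\<lambda>y. F (c2 * y)) \<in> borel_measurable borel" by measurable
        then have "ennreal c * \<Lambda> F \<le> Q F x"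
          using bspec[OF bspec[OF minor True], of "\<lambda>y. F (c2 * y)"] by (simp add: \<Lambda>_def Q_def)
        then have "f x * (ennreal c * \<Lambda> F) \<le> f x * Q F x" by (rule mult_left_mono) simp
        then show ?thesis using True by (simp add: mult_ac)
      qed simp
    qed
    finally show ?thesis .
  qed
  show ?thesis
  proof (intro exI conjI allI impI)
    \<comment> \<open>Mass \<delta> / 2 on the compact set, the minorization constant
      \<open>c\<close> and the length \<open>w\<close> of the window.\<close>
    show "0 < c * (\<delta> / 2) * w" using c d w by simp
    fix f1 f2 g1 g2 :: "real \<Rightarrow> ennreal"
    assume f: "dominated C f1" "dominated C f2" "ennreal \<delta> \<le> mass f1" "ennreal \<delta> \<le> mass f2"
      and [measurable]: "g1 \<in> borel_measurable borel" "g2 \<in> borel_measurable borel"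
      and g: "pushes f1 g1"
        "pushes f2 g2"
    \<comment> \<open>The minimum is \<open>g1\<close> on \<open>B\<close> and \<open>g2\<close> off
      \<open>B\<close>. Splitting the common minorant along \<open>B\<close>, the two lower bounds
      add up to its full mass.\<close>
    define B where "B = {x. g1 x \<le> g2 x}"
    have [measurable]: "B \<in> sets borel" unfolding B_def by measurable
    have "\<Lambda> (indicator B) + \<Lambda> (indicator (- B)) = (\<integral>\<^sup>+s. indicator {v..v + w} s * indicator B (c2 * exp s) + indicator {v..v + w} s * indicator (- B) (c2 * exp s) \<partial>lborel)"
      unfolding \<Lambda>_def by (rule nn_integral_add[symmetric]) measurable
    also have "\<dots> = (\<integral>\<^sup>+s. indicator {v..v + w} s \<partial>lborel)"
      by (intro nn_integral_cong) (auto simp: indicator_def)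
    also have "\<dots> = ennreal w" using w by (subst nn_integral_indicator) auto
    finally have sum: "\<Lambda> (indicator B) + \<Lambda> (indicator (- B)) = ennreal w" .
    have "ennreal (c * (\<delta> / 2) * w) = ennreal (c * (\<delta> / 2)) * ennreal w" using c d w by (intro ennreal_mult) auto
    also have "\<dots> = ennreal (c * (\<delta> / 2)) * \<Lambda> (indicator B) + ennreal (c * (\<delta> / 2)) * \<Lambda> (indicator (- B))"
      unfolding sum[symmetric] by (rule distrib_left)
    also have "\<dots> \<le> \<langle>f1, Q (indicator B)\<rangle> + \<langle>f2, Q (indicator (- B))\<rangle>"
      by (intro add_mono low f) measurable
    also have "\<dots> = \<langle>g1, indicator B\<rangle> + \<langle>g2, indicator (- B)\<rangle>"
      using g(1)[THEN bspec, of "indicator B"] g(2)[THEN bspec, of "indicator (- B)"] by simp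
    also have "\<dots> = (\<integral>\<^sup>+x. g1 x * indicator B x + g2 x * indicator (- B) x \<partial>N)"
      by (rule nn_integral_add[symmetric]) measurable
    also have "\<dots> = (\<integral>\<^sup>+x. min (g1 x) (g2 x) \<partial>N)"
      by (intro nn_integral_cong) (auto simp: B_def indicator_def min_def)
    finally show "ennreal (c * (\<delta> / 2) * w) \<le> (\<integral>\<^sup>+x. min (g1 x) (g2 x) \<partial>N)" .
  qed
qed

lemma dominated_diff:
  assumes "dominated C g" "m \<in> borel_measurable borel"
  shows "dominated C (\<lambda>x. g x - m x)"
proof -
  note [measurable] = assms(2)
  have [measurable]: "g \<in> borel_measurable borel" using assms(1) by (simp add: dominated_def)
  have "(\<integral>\<^sup>+x. (g x - m x) * F x \<partial>N) \<le> ennreal C * (\<integral>\<^sup>+x. F x \<partial>N)" if "F \<in> borel_measurable borel" for F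
  proof -
    have "(\<integral>\<^sup>+x. (g x - m x) * F x \<partial>N) \<le> \<langle>g, F\<rangle>"
      by (intro nn_integral_mono mult_right_mono) (auto simp: diff_le_self_ennreal)
    also have "\<dots> \<le> ennreal C * (\<integral>\<^sup>+x. F x \<partial>N)" using assms(1) that by (auto simp: dominated_def)
    finally show ?thesis .
  qed
  then show ?thesis unfolding dominated_def by auto
qed

text \<open>The number of steps is uniform in \<open>f1\<close>, \<open>f2\<close> and
  \<open>F\<close>, because \<open>F\<close> will contain all of the later evolution. The induction
  therefore runs over \<open>k\<close> under the mass bound \<delta> + k \<eta>: a mass above
  \<delta> loses at least \<eta> in each step.\<close>

lemma contraction:
  assumes C: "0 < C" and d: "0 < \<delta>"
  shows "\<exists>k. \<forall>f1 f2 (F :: real \<Rightarrow> ennreal). dominated C f1 \<longrightarrow> dominated C f2 \<longrightarrow> mass f1 = mass f2 \<longrightarrow> mass f1 \<le> 1 \<longrightarrow>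
    F \<in> borel_measurable borel \<longrightarrow> (\<forall>y. F y \<le> 1) \<longrightarrow>
    \<langle>f1, (Q ^^ k) F\<rangle> \<le> \<langle>f2, (Q ^^ k) F\<rangle> + ennreal \<delta>"
proof -
  obtain \<eta> where \<eta>: "0 < \<eta>" and ov: "\<And>f1 f2 g1 g2. dominated C f1 \<Longrightarrow> dominated C f2 \<Longrightarrow> ennreal \<delta> \<le> mass f1 \<Longrightarrow> ennreal \<delta> \<le> mass f2 \<Longrightarrow>
    g1 \<in> borel_measurable borel \<Longrightarrow> g2 \<in> borel_measurable borel \<Longrightarrow>
    (pushes f1 g1) \<Longrightarrow>
    (pushes f2 g2) \<Longrightarrow>
    ennreal \<eta> \<le> (\<integral>\<^sup>+x. min (g1 x) (g2 x) \<partial>N)"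
    using overlap[OF C d] by auto
  have main: "\<langle>f1, (Q ^^ k) F\<rangle> \<le> \<langle>f2, (Q ^^ k) F\<rangle> + ennreal \<delta>"
    if "dominated C f1" "dominated C f2" "mass f1 = ennreal p" "mass f2 = ennreal p" "0 \<le> p" "p \<le> \<delta> + real k * \<eta>"
      and F: "F \<in> borel_measurable borel" "\<And>y. F y \<le> 1" for f1 f2 k p and F :: "real \<Rightarrow> ennreal"
    using that(1-6)
  proof (induction k arbitrary: f1 f2 p)
    case 0
    have "\<langle>f1, (Q ^^ 0) F\<rangle> \<le> mass f1" by (rule nn_integral_mult_le) (rule Q_pow_le_1, rule F(2))
    also have "\<dots> \<le> ennreal \<delta>" using 0 by (simp add: ennreal_leI)
    finally show ?case by (rule order_trans) simp
  next
    case (Suc k)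
    show ?case
    \<comment> \<open>Below \<delta> the left side is at most the total mass, hence at most
      \<delta>; above \<delta> the overlap estimate applies.\<close>
    proof (cases "p \<le> \<delta>")
      case True
      have "\<langle>f1, (Q ^^ Suc k) F\<rangle> \<le> mass f1" by (rule nn_integral_mult_le) (rule Q_pow_le_1, rule F(2))
      also have "\<dots> \<le> ennreal \<delta>" using Suc True by (simp add: ennreal_leI)
      finally show ?thesis by (rule order_trans) simp
    next
      case False
      obtain g1 where g1: "dominated C g1" "pushes f1 g1"
        using push_forward[OF Suc.prems(1)] by blast
      obtain g2 where g2: "dominated C g2" "pushes f2 g2"
        using push_forward[OF Suc.prems(2)] by blast
      have [measurable]: "g1 \<in> borel_measurable borel" "g2 \<in> borel_measurable borel" using g1 g2 by (auto simp: dominated_def)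
      note [measurable] = F(1)
      define m where "m x = min (g1 x) (g2 x)" for x
      have [measurable]: "m \<in> borel_measurable borel" unfolding m_def[abs_def] by measurable
      have Q1: "Q (\<lambda>_. 1) x = 1" for x unfolding Q_def K_def by (simp add: S.emeasure_space_1)
      have mass_g: "mass g1 = ennreal p" "mass g2 = ennreal p"
        using g1(2)[THEN bspec, of "\<lambda>_. 1"] g2(2)[THEN bspec, of "\<lambda>_. 1"] Suc.prems by (auto simp: Q1)
      have \<eta>m: "ennreal \<eta> \<le> mass m"
        unfolding m_def using Suc.prems False by (intro ov[OF Suc.prems(1,2) _ _ _ _ g1(2) g2(2)]) (auto intro: ennreal_leI)
      have split: "g1 x = (g1 x - m x) + m x" "g2 x = (g2 x - m x) + m x" for x
        by (auto simp: m_def diff_add_cancel_ennreal)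
      have ints: "\<langle>g1, G\<rangle> = \<langle>(\<lambda>x. g1 x - m x), G\<rangle> + \<langle>m, G\<rangle>"
        "\<langle>g2, G\<rangle> = \<langle>(\<lambda>x. g2 x - m x), G\<rangle> + \<langle>m, G\<rangle>"
        if [measurable]: "G \<in> borel_measurable borel" for G
      proof -
        have "\<langle>g1, G\<rangle> = (\<integral>\<^sup>+x. (g1 x - m x) * G x + m x * G x \<partial>N)"
          by (intro nn_integral_cong) (subst split(1), simp only: distrib_right)
        then show "\<langle>g1, G\<rangle> = \<langle>(\<lambda>x. g1 x - m x), G\<rangle> + \<langle>m, G\<rangle>"
          by (subst (asm) nn_integral_add) auto
        have "\<langle>g2, G\<rangle> = (\<integral>\<^sup>+x. (g2 x - m x) * G x + m x * G x \<partial>N)"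
          by (intro nn_integral_cong) (subst split(2), simp only: distrib_right)
        then show "\<langle>g2, G\<rangle> = \<langle>(\<lambda>x. g2 x - m x), G\<rangle> + \<langle>m, G\<rangle>"
          by (subst (asm) nn_integral_add) auto
      qed
      have "mass m \<le> mass g1" by (intro nn_integral_mono) (auto simp: m_def)
      then have mle: "mass m \<le> ennreal p" unfolding mass_g .
      then have "mass m < top" by (rule order_le_less_trans) simp
      then obtain q where q: "mass m = ennreal q" "0 \<le> q" by (cases "\<integral>\<^sup>+x. m x \<partial>N") auto
      have qp: "q \<le> p" using mle q Suc.prems(5) by simp
      have q\<eta>: "\<eta> \<le> q" using \<eta>m q by simp
      have cancel: "X = ennreal (p - q)" if "ennreal p = X + ennreal q" for X
      proof -
        have "ennreal q + X = ennreal q + ennreal (p - q)" using that q(2) qp by (simp add: add.commute flip: ennreal_plus)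
        then show ?thesis by (simp add: ennreal_add_left_cancel)
      qed
      have mass_diff: "(\<integral>\<^sup>+x. g1 x - m x \<partial>N) = ennreal (p - q)" "(\<integral>\<^sup>+x. g2 x - m x \<partial>N) = ennreal (p - q)"
        using ints[of "\<lambda>_. 1"] mass_g q by (auto intro!: cancel)
      \<comment> \<open>From now on the common part \<open>m\<close> contributes equally to both
        sides, so only the remainders, of equal mass p - q \<le> \<delta> + k \<eta>, have to be
        compared.\<close>
      have IH: "\<langle>(\<lambda>x. g1 x - m x), (Q ^^ k) F\<rangle> \<le> \<langle>(\<lambda>x. g2 x - m x), (Q ^^ k) F\<rangle> + ennreal \<delta>"
      proof (rule Suc.IH[OF _ _ mass_diff])
        show "p - q \<le> \<delta> + real k * \<eta>" using Suc.prems(6) q\<eta> by (simp add: algebra_simps)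
      qed (use qp g1 g2 in \<open>auto intro: dominated_diff\<close>)
      have "\<langle>f1, (Q ^^ Suc k) F\<rangle> = \<langle>g1, (Q ^^ k) F\<rangle>"
        using g1(2)[THEN bspec, of "(Q ^^ k) F"] by simp
      also have "\<dots> = \<langle>(\<lambda>x. g1 x - m x), (Q ^^ k) F\<rangle> + \<langle>m, (Q ^^ k) F\<rangle>"
        by (rule ints) measurable
      also have "\<dots> \<le> (\<langle>(\<lambda>x. g2 x - m x), (Q ^^ k) F\<rangle> + ennreal \<delta>) + \<langle>m, (Q ^^ k) F\<rangle>"
        using IH by (rule add_right_mono)
      also have "\<dots> = (\<langle>(\<lambda>x. g2 x - m x), (Q ^^ k) F\<rangle> + \<langle>m, (Q ^^ k) F\<rangle>) + ennreal \<delta>"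
        by (simp only: add_ac)
      also have "\<langle>(\<lambda>x. g2 x - m x), (Q ^^ k) F\<rangle> + \<langle>m, (Q ^^ k) F\<rangle> = \<langle>g2, (Q ^^ k) F\<rangle>"
        by (rule ints(2)[symmetric]) measurable
      also have "\<dots> = \<langle>f2, (Q ^^ Suc k) F\<rangle>"
        using g2(2)[THEN bspec, of "(Q ^^ k) F"] by simp
      finally show ?thesis .
    qed
  qed
  obtain k where k: "1 / \<eta> \<le> real k" using real_arch_simple by blast
  have k': "1 \<le> \<delta> + real k * \<eta>" using k \<eta> d by (simp add: field_simps)
  show ?thesis
  proof (intro exI[of _ k] allI impI)
    fix f1 f2 F :: "real \<Rightarrow> ennreal" assume a: "dominated C f1" "dominated C f2" "mass f1 = mass f2" "mass f1 \<le> 1"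
      and F: "F \<in> borel_measurable borel" "\<forall>y. F y \<le> (1::ennreal)"
    obtain p where p: "mass f1 = ennreal p" "0 \<le> p" using a(4) by (cases "\<integral>\<^sup>+x. f1 x \<partial>N") (auto simp: top_unique)
    have "p \<le> 1" using a(4) p by simp
    then show "\<langle>f1, (Q ^^ k) F\<rangle> \<le> \<langle>f2, (Q ^^ k) F\<rangle> + ennreal \<delta>"
      using k' a(3) p(1) F(2) by (intro main[OF a(1,2) p(1) _ p(2) _ F(1)]) auto
  qed
qed

end


subsection \<open>Convergence\<close>

text \<open>For densities of equal mass the L1 distance is twice the integral of f - g over the set
  where f > g. Hence a one-sided estimate on this single set controls the distance.\<close>

lemma Dm_L1_le:
  assumes f: "f \<in> Dm" and g: "g \<in> Dm" and e: "0 \<le> e"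
    and le: "(\<integral>\<^sup>+x. ennreal (f x) * indicator {x. g x < f x} x \<partial>mm) \<le> (\<integral>\<^sup>+x. ennreal (g x) * indicator {x. g x < f x} x \<partial>mm) + ennreal e"
  shows "(\<integral>x. \<bar>f x - g x\<bar> \<partial>mm) \<le> 2 * e"
proof -
  note [measurable] = DmD(1)[OF f] DmD(1)[OF g]
  define B where "B = {x. g x < f x}"
  have [measurable]: "B \<in> sets borel" unfolding B_def by measurable
  have i[simp]: "integrable mm f" "integrable mm g" using DmD(4) f g by auto
  have iB[simp]: "integrable mm (\<lambda>x. f x * indicator B x)" "integrable mm (\<lambda>x. g x * indicator B x)"
    by (intro integrable_real_mult_indicator; simp)+
  have tot: "(\<integral>x. u x \<partial>mm) = 1" if "u \<in> Dm" for u
  proof -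
    have "(\<integral>x. u x \<partial>mm) = (\<integral>x. \<bar>u x\<bar> \<partial>mm)"
      using that by (intro integral_cong_AE) (auto simp: Dm_def elim!: eventually_mono)
    then show ?thesis using that by (simp add: Dm_def)
  qed
  have conv: "(\<integral>\<^sup>+x. ennreal (u x) * indicator B x \<partial>mm) = ennreal (\<integral>x. u x * indicator B x \<partial>mm)"
    if u: "u \<in> Dm" "integrable mm (\<lambda>x. u x * indicator B x)" for u
  proof -
    have "AE x in mm. 0 \<le> u x * indicator B x" using DmD(2)[OF u(1)] by eventually_elim auto
    from nn_integral_eq_integral[OF u(2) this]
    have "(\<integral>\<^sup>+x. ennreal (u x * indicator B x) \<partial>mm) = ennreal (\<integral>x. u x * indicator B x \<partial>mm)" .
    moreover have "(\<integral>\<^sup>+x. ennreal (u x * indicator B x) \<partial>mm) = (\<integral>\<^sup>+x. ennreal (u x) * indicator B x \<partial>mm)"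
      by (intro nn_integral_cong) (auto simp: indicator_def)
    ultimately show ?thesis by simp
  qed
  have nn: "0 \<le> (\<integral>x. g x * indicator B x \<partial>mm)"
    using DmD(2)[OF g] by (intro integral_nonneg_AE) (auto elim!: eventually_mono)
  have "ennreal (\<integral>x. f x * indicator B x \<partial>mm) \<le> ennreal (\<integral>x. g x * indicator B x \<partial>mm) + ennreal e"
    using le unfolding B_def[symmetric] conv[OF f iB(1)] conv[OF g iB(2)] .
  then have 1: "(\<integral>x. f x * indicator B x \<partial>mm) \<le> (\<integral>x. g x * indicator B x \<partial>mm) + e"
    using nn e by (simp flip: ennreal_plus)
  have "(\<integral>x. \<bar>f x - g x\<bar> \<partial>mm) = (\<integral>x. 2 * (f x * indicator B x - g x * indicator B x) - (f x - g x) \<partial>mm)"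
    by (intro Bochner_Integration.integral_cong) (auto simp: B_def indicator_def)
  also have "\<dots> = 2 * ((\<integral>x. f x * indicator B x \<partial>mm) - (\<integral>x. g x * indicator B x \<partial>mm)) - ((\<integral>x. f x \<partial>mm) - (\<integral>x. g x \<partial>mm))"
    by simp
  also have "\<dots> = 2 * ((\<integral>x. f x * indicator B x \<partial>mm) - (\<integral>x. g x * indicator B x \<partial>mm))"
    using tot f g by simp
  finally show ?thesis using 1 by simp
qed

text \<open>The approximant is \<open>c0 / us\<close> cut off at height \<open>n\<close>; this works because \<open>us\<close> is strictly positive.\<close>
lemma truncation:
  assumes L: "Lmean < \<infinity>" and c0: "c0 \<in> Dm" and e: "0 < e"
  shows "\<exists>n f. 1 \<le> real n \<and> dominated (real n) f \<and> mass f \<le> 1 \<and>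
    (\<forall>G\<in>borel_measurable borel. (\<forall>y. G y \<le> 1) \<longrightarrow> (\<integral>\<^sup>+x. ennreal (c0 x) * G x \<partial>mm) \<le> \<langle>f, G\<rangle> + ennreal e)"
proof -
  note [measurable] = DmD(1)[OF c0]
  note c01 = DmD(3)[OF c0]
  define f where "f n x = min (ennreal (c0 x / us x)) (ennreal (real n))" for n :: nat and x
  have [measurable]: "f n \<in> borel_measurable borel" for n unfolding f_def[abs_def] by measurable
  define D where "D n x = ennreal (us x) * f n x" for n x
  have [measurable]: "D n \<in> borel_measurable borel" for n unfolding D_def[abs_def] by measurable
  have full: "ennreal (us x) * ennreal (c0 x / us x) = ennreal (c0 x)" if "0 < x" for x
    using us_pos[OF L that] by (simp flip: ennreal_mult')
  have Dle: "D n x \<le> ennreal (c0 x)" if "0 < x" for n x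
    unfolding full[OF that, symmetric] D_def f_def by (intro mult_left_mono) auto
  have "(\<lambda>n. \<integral>\<^sup>+x. D n x \<partial>mm) \<longlonglongrightarrow> (\<integral>\<^sup>+x. (if 0 < x then ennreal (c0 x) else 0) \<partial>mm)"
  proof (rule nn_integral_LIMSEQ)
    show "incseq D" unfolding incseq_def le_fun_def D_def f_def
      by (intro allI impI mult_left_mono min.mono) auto
    show "(\<lambda>n. D n x) \<longlonglongrightarrow> (if 0 < x then ennreal (c0 x) else 0)" for x
    proof (cases "0 < x")
      case True
      obtain m where m: "c0 x / us x \<le> real m" using real_arch_simple by blast
      have "D n x = ennreal (c0 x)" if "m \<le> n" for n
      proof -
        have "f n x = ennreal (c0 x / us x)" unfolding f_def using m that by (intro min_absorb1 ennreal_leI) linarith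
        then show ?thesis using full[OF True] by (simp add: D_def)
      qed
      then have "\<forall>\<^sub>F n in sequentially. D n x = ennreal (c0 x)" by (auto simp: eventually_sequentially)
      then show ?thesis using True by (simp add: tendsto_eventually)
    qed (simp add: D_def us_def)
  qed measurable
  moreover have "(\<integral>\<^sup>+x. (if 0 < x then ennreal (c0 x) else 0) \<partial>mm) = 1"
    unfolding c01[symmetric] using AE_mm by (intro nn_integral_cong_AE) (auto elim!: eventually_mono)
  ultimately have "(\<lambda>n. \<integral>\<^sup>+x. D n x \<partial>mm) \<longlonglongrightarrow> 1" by simp
  moreover have "ennreal (1 - e) < 1" using e by (simp add: ennreal_less_one_iff)
  ultimately have "\<forall>\<^sub>F n in sequentially. ennreal (1 - e) < (\<integral>\<^sup>+x. D n x \<partial>mm)" by (rule order_tendstoD(1))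
  then have "\<forall>\<^sub>F n in sequentially. 1 \<le> n \<and> ennreal (1 - e) < (\<integral>\<^sup>+x. D n x \<partial>mm)"
    using eventually_ge_at_top[of 1] by eventually_elim auto
  then obtain n where n: "1 \<le> n" "ennreal (1 - e) < (\<integral>\<^sup>+x. D n x \<partial>mm)"
    by (auto dest: eventually_happens)
  have fD: "\<langle>f n, G\<rangle> = (\<integral>\<^sup>+x. D n x * G x \<partial>mm)" if [measurable]: "G \<in> borel_measurable borel" for G
    by (subst nn_integral_N[OF L]) (auto simp: D_def mult_ac)
  define d where "d x = ennreal (c0 x) - D n x" for x
  have [measurable]: "d \<in> borel_measurable borel" unfolding d_def[abs_def] by measurable
  have dD: "AE x in mm. ennreal (c0 x) = D n x + d x"
    using AE_mm by eventually_elim (simp add: d_def add_diff_inverse_ennreal Dle)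
  have sum: "(\<integral>\<^sup>+x. ennreal (c0 x) * G x \<partial>mm) = (\<integral>\<^sup>+x. D n x * G x \<partial>mm) + (\<integral>\<^sup>+x. d x * G x \<partial>mm)"
    if [measurable]: "G \<in> borel_measurable borel" for G
  proof -
    have "(\<integral>\<^sup>+x. ennreal (c0 x) * G x \<partial>mm) = (\<integral>\<^sup>+x. D n x * G x + d x * G x \<partial>mm)"
      using dD by (intro nn_integral_cong_AE) (auto elim!: eventually_mono simp: distrib_right)
    then show ?thesis by (simp add: nn_integral_add)
  qed
  have sum1: "(\<integral>\<^sup>+x. D n x \<partial>mm) + (\<integral>\<^sup>+x. d x \<partial>mm) = 1" using sum[of "\<lambda>_. 1"] c01 by simp
  have de: "(\<integral>\<^sup>+x. d x \<partial>mm) \<le> ennreal e"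
  proof (rule ccontr)
    assume "\<not> ?thesis"
    then have "ennreal (1 - e) + ennreal e < (\<integral>\<^sup>+x. D n x \<partial>mm) + (\<integral>\<^sup>+x. d x \<partial>mm)"
      using n(2) by (intro add_strict_mono) (auto simp: not_le)
    moreover have "1 \<le> ennreal (1 - e) + ennreal e"
    proof (cases "e \<le> 1")
      case True then show ?thesis using e by (simp flip: ennreal_plus)
    next
      case False
      then have "1 \<le> ennreal e" by simp
      then show ?thesis by (rule order_trans) simp
    qed
    ultimately show False using sum1 by (metis leD)
  qed
  show ?thesis
  proof (intro exI conjI ballI impI)
    show "1 \<le> real n" using n by simp
    have "\<langle>f n, G\<rangle> \<le> ennreal (real n) * mass G" if [measurable]: "G \<in> borel_measurable borel" for G
    proof -
      have "\<langle>f n, G\<rangle> \<le> (\<integral>\<^sup>+x. ennreal (real n) * G x \<partial>N)"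
        by (intro nn_integral_mono mult_right_mono) (auto simp: f_def)
      also have "\<dots> = ennreal (real n) * mass G"
        by (rule nn_integral_cmult) measurable
      finally show ?thesis .
    qed
    then show "dominated (real n) (f n)" unfolding dominated_def by auto
    have "(\<integral>\<^sup>+x. f n x \<partial>N) = (\<integral>\<^sup>+x. D n x \<partial>mm)" using fD[of "\<lambda>_. 1"] by simp
    also have "\<dots> \<le> (\<integral>\<^sup>+x. D n x \<partial>mm) + (\<integral>\<^sup>+x. d x \<partial>mm)" by simp
    also have "\<dots> = 1" by (rule sum1)
    finally show "(\<integral>\<^sup>+x. f n x \<partial>N) \<le> 1" .
    fix G :: "real \<Rightarrow> ennreal" assume G: "G \<in> borel_measurable borel" "\<forall>y. G y \<le> 1"
    have "(\<integral>\<^sup>+x. d x * G x \<partial>mm) \<le> (\<integral>\<^sup>+x. d x \<partial>mm)" using G(2) by (intro nn_integral_mult_le) auto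
    also have "\<dots> \<le> ennreal e" by (rule de)
    finally show "(\<integral>\<^sup>+x. ennreal (c0 x) * G x \<partial>mm) \<le> \<langle>f n, G\<rangle> + ennreal e"
      unfolding sum[OF G(1)] fD[OF G(1)] by (intro add_left_mono)
  qed
qed

lemma solution_nn_integral:
  assumes sol: "frag_solution \<alpha> h c0 c" and c0: "c0 \<in> Dm" and t: "0 \<le> t" and F[measurable]: "F \<in> borel_measurable borel"
  shows "(\<integral>\<^sup>+x. ennreal (c t x) * F x \<partial>mm) = (\<integral>\<^sup>+x. ennreal (c0 x) * K t F x \<partial>mm)"
proof -
  have ct: "c t \<in> Dm" "distr (jump_space h c0) borel (\<lambda>\<omega>. Yproc \<alpha> \<omega> t) = density mm (\<lambda>x. ennreal (c t x))"
    using sol t by (auto simp: frag_solution_def)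
  note [measurable] = DmD(1)[OF ct(1)] DmD(1)[OF c0]
  show ?thesis using law_Yproc[of c0 F t] unfolding ct(2) by (simp add: nn_integral_density)
qed

lemma convergence:
  assumes L: "Lmean < \<infinity>" and c0: "c0 \<in> Dm" and sol: "frag_solution \<alpha> h c0 c"
  shows "((\<lambda>t. \<integral>x. \<bar>c t x - cs t x\<bar> \<partial>mm) \<longlongrightarrow> 0) at_top"
proof (rule tendstoI)
  fix \<epsilon> :: real assume \<epsilon>: "0 < \<epsilon>"
  \<comment> \<open>Truncation and contraction cost \<open>e\<close> each, and
    \<open>Dm_L1_le\<close> doubles the sum: 2 (2 e) = \<epsilon> / 2.\<close>
  define e where "e = \<epsilon> / 8"
  have e: "0 < e" using \<epsilon> by (simp add: e_def)
  obtain n f where n: "1 \<le> real n" and f: "dominated (real n) f" and f1: "mass f \<le> 1"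
    and app: "\<And>G. G \<in> borel_measurable borel \<Longrightarrow> (\<forall>y. G y \<le> 1) \<Longrightarrow> (\<integral>\<^sup>+x. ennreal (c0 x) * G x \<partial>mm) \<le> \<langle>f, G\<rangle> + ennreal e"
    using truncation[OF L c0 e] by blast
  have n0: "0 < real n" using n by linarith
  obtain k where k: "\<And>f1 f2 F. dominated (real n) f1 \<Longrightarrow> dominated (real n) f2 \<Longrightarrow> mass f1 = mass f2 \<Longrightarrow> mass f1 \<le> 1 \<Longrightarrow>
    F \<in> borel_measurable borel \<Longrightarrow> (\<forall>y. F y \<le> 1) \<Longrightarrow>
    \<langle>f1, (Q ^^ k) F\<rangle> \<le> \<langle>f2, (Q ^^ k) F\<rangle> + ennreal e"
    using contraction[OF L n0 e] by blast
  \<comment> \<open>The competitor of \<open>f\<close> is the constant \<open>p\<close>, that is, p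
    times the invariant law. It has the same mass, and it is dominated because p \<le> 1 \<le>
    n.\<close>
  define p where "p = mass f"
  have dp: "dominated (real n) (\<lambda>_. p)"
    unfolding dominated_def
  proof (intro conjI ballI)
    fix F :: "real \<Rightarrow> ennreal" assume [measurable]: "F \<in> borel_measurable borel"
    have "(\<integral>\<^sup>+x. p * F x \<partial>N) = p * (\<integral>\<^sup>+x. F x \<partial>N)" by (rule nn_integral_cmult) measurable
    also have "\<dots> \<le> ennreal (real n) * (\<integral>\<^sup>+x. F x \<partial>N)"
    proof (rule mult_right_mono)
      have "p \<le> 1" using f1 by (simp add: p_def)
      also have "1 \<le> ennreal (real n)" using n by simp
      finally show "p \<le> ennreal (real n)" .
    qed simp
    finally show "(\<integral>\<^sup>+x. p * F x \<partial>N) \<le> ennreal (real n) * (\<integral>\<^sup>+x. F x \<partial>N)" .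
  qed simp
  have emN: "emeasure N UNIV = 1"
    using prob_space.emeasure_space_1[OF prob_space_density_Dm[OF us_Dm[OF L]]] by (simp add: N_def)
  have bound: "(\<integral>x. \<bar>c t x - cs t x\<bar> \<partial>mm) \<le> 2 * (2 * e)" if t: "2 ^ k - 1 \<le> t" for t
  proof -
    have "(1::real) \<le> 2 ^ k" by simp
    then have t0: "0 \<le> t" using t by linarith
    have ct: "c t \<in> Dm" using sol t0 by (auto simp: frag_solution_def)
    note [measurable] = DmD(1)[OF ct]
    define B where "B = {x. cs t x < c t x}"
    have [measurable]: "B \<in> sets borel" unfolding B_def by measurable
    \<comment> \<open>The evolution after time 2^k - 1 is absorbed into the test function, with the
      dilation by c2^k undone. Thus one \<open>k\<close> serves all later times and not only those
      of the form 2^j - 1.\<close>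
    define F where "F y = K (t - (2 ^ k - 1)) (indicator B) (y / c2 ^ k)" for y
    have [measurable]: "F \<in> borel_measurable borel" unfolding F_def[abs_def] by measurable
    have Fle: "F y \<le> 1" for y unfolding F_def by (rule K_le_1) (simp add: indicator_def)
    have QF: "(Q ^^ k) F x = K t (indicator B) x" if x: "0 < x" for x
    proof -
      have "(Q ^^ k) F x = K (2 ^ k - 1) (\<lambda>y. F (c2 ^ k * y)) x" by (rule Q_pow) (use Fle x in auto)
      also have "(\<lambda>y. F (c2 ^ k * y)) = K (t - (2 ^ k - 1)) (indicator B)" using c2(2) by (simp add: F_def fun_eq_iff)
      also have "K (2 ^ k - 1) (K (t - (2 ^ k - 1)) (indicator B)) x = K ((2 ^ k - 1) + (t - (2 ^ k - 1))) (indicator B) x"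
        using t x by (intro K_semigroup[symmetric]) (auto simp: indicator_def)
      finally show ?thesis by simp
    qed
    have repl: "(\<integral>\<^sup>+x. ennreal (u x) * K t (indicator B) x \<partial>mm) = (\<integral>\<^sup>+x. ennreal (u x) * (Q ^^ k) F x \<partial>mm)" for u
      using AE_mm by (intro nn_integral_cong_AE) (auto elim!: eventually_mono simp: QF)
    have "(\<integral>\<^sup>+x. ennreal (c t x) * indicator B x \<partial>mm) = (\<integral>\<^sup>+x. ennreal (c0 x) * (Q ^^ k) F x \<partial>mm)"
      unfolding repl[symmetric] by (rule solution_nn_integral[OF sol c0 t0]) measurable
    also have "\<dots> \<le> \<langle>f, (Q ^^ k) F\<rangle> + ennreal e"
      by (rule app) (auto intro: Q_pow_le_1 Fle)
    also have "\<dots> \<le> ((\<integral>\<^sup>+x. p * (Q ^^ k) F x \<partial>N) + ennreal e) + ennreal e"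
      by (intro add_right_mono k f dp) (use emN f1 Fle in \<open>auto simp: p_def N_def\<close>)
    also have "\<dots> \<le> ((\<integral>\<^sup>+x. (Q ^^ k) F x \<partial>N) + ennreal e) + ennreal e"
    proof (intro add_right_mono nn_integral_mono)
      have "p \<le> 1" using f1 by (simp add: p_def)
      then show "p * (Q ^^ k) F x \<le> (Q ^^ k) F x" for x by (metis mult_1 mult_right_mono zero_le)
    qed
    also have "(\<integral>\<^sup>+x. (Q ^^ k) F x \<partial>N) = (\<integral>\<^sup>+x. ennreal (us x) * (Q ^^ k) F x \<partial>mm)" by (rule nn_integral_N[OF L]) measurable
    also have "\<dots> = (\<integral>\<^sup>+x. ennreal (us x) * K t (indicator B) x \<partial>mm)" unfolding repl ..
    also have "\<dots> = (\<integral>\<^sup>+x. ennreal (cs t x) * indicator B x \<partial>mm)" by (rule us_K[OF L t0]) measurable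
    finally have "(\<integral>\<^sup>+x. ennreal (c t x) * indicator B x \<partial>mm) \<le> (\<integral>\<^sup>+x. ennreal (cs t x) * indicator B x \<partial>mm) + ennreal (2 * e)"
      using e by (simp add: add.assoc flip: ennreal_plus)
    then show ?thesis
      unfolding B_def using e by (intro Dm_L1_le[OF ct cs_Dm[OF L t0]]) auto
  qed
  have "\<forall>\<^sub>F t in at_top. (2 ^ k - 1 :: real) \<le> t" by (rule eventually_ge_at_top)
  then show "\<forall>\<^sub>F t in at_top. dist (\<integral>x. \<bar>c t x - cs t x\<bar> \<partial>mm) 0 < \<epsilon>"
  proof eventually_elim
    case (elim t)
    have "0 \<le> (\<integral>x. \<bar>c t x - cs t x\<bar> \<partial>mm)" by (rule integral_nonneg_AE) simp
    then show ?case using bound[OF elim] \<epsilon> by (simp add: e_def)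
  qed
qed

end

theorem theorem1p1:
  fixes \<alpha> :: real and h :: "real \<Rightarrow> real"
  assumes "\<alpha> > 0"
    and "set_borel_measurable borel {0<..<1} h"
    and "\<forall>r\<in>{0<..<1}. 0 \<le> h r"
    and "(\<integral>\<^sup>+ r\<in>{0<..<1}. ennreal (h r * r) \<partial>lborel) = 1"
  shows "(\<exists>u\<in>Dm.
            (\<forall>t\<ge>0. (\<lambda>x. ((1 + t) powr (1 / \<alpha>))\<^sup>2 * u ((1 + t) powr (1 / \<alpha>) * x)) \<in> Dm) \<and>
            frag_solution \<alpha> h u (\<lambda>t x. ((1 + t) powr (1 / \<alpha>))\<^sup>2 * u ((1 + t) powr (1 / \<alpha>) * x)) \<and>
            (\<forall>c0\<in>Dm. \<forall>c. frag_solution \<alpha> h c0 c \<longrightarrow>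
               ((\<lambda>t. \<integral>x. \<bar>c t x - ((1 + t) powr (1 / \<alpha>))\<^sup>2 * u ((1 + t) powr (1 / \<alpha>) * x)\<bar> \<partial>mm)
                  \<longlongrightarrow> 0) at_top))
         \<longleftrightarrow> (\<integral>\<^sup>+ z\<in>{0<..<1}. ennreal (- ln z * h z * z) \<partial>lborel) < \<infinity>"
proof -
  interpret fragmentation \<alpha> h by standard fact+
  have cs: "cs = (\<lambda>t x. ((1 + t) powr (1 / \<alpha>))\<^sup>2 * us ((1 + t) powr (1 / \<alpha>) * x))"
    by (simp add: cs_def fun_eq_iff)
  show ?thesis
    unfolding Lmean_eq[symmetric]
  proof
    assume L: "Lmean < \<infinity>"
    show "\<exists>u\<in>Dm.
            (\<forall>t\<ge>0. (\<lambda>x. ((1 + t) powr (1 / \<alpha>))\<^sup>2 * u ((1 + t) powr (1 / \<alpha>) * x)) \<in> Dm) \<and>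
            frag_solution \<alpha> h u (\<lambda>t x. ((1 + t) powr (1 / \<alpha>))\<^sup>2 * u ((1 + t) powr (1 / \<alpha>) * x)) \<and>
            (\<forall>c0\<in>Dm. \<forall>c. frag_solution \<alpha> h c0 c \<longrightarrow>
               ((\<lambda>t. \<integral>x. \<bar>c t x - ((1 + t) powr (1 / \<alpha>))\<^sup>2 * u ((1 + t) powr (1 / \<alpha>) * x)\<bar> \<partial>mm)
                  \<longlongrightarrow> 0) at_top)"
      using us_Dm[OF L] cs_Dm[OF L] cs_solution[OF L] convergence[OF L] unfolding cs by blast
  qed (use self_similar_imp_log_moment in blast)
qed

end
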